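(* Let $\{\mathbf X_1,\dots,\mathbf X_n\}$ be an i.i.d. sample drawn from a distribution $P$ on $\mathcal X$ whose probability array $\mathbf p\in\mathcal P$ has support $\mathcal S_{\mathbf p}$ such that $\Gamma(\mathcal S_{\mathbf p})\neq\emptyset$ and $d_\circ=\dim(\boldsymbol\Delta^\circ(\mathcal S_{\mathbf p}))\ge1$. Let $\Delta_1,\dots,\Delta_{d_\circ}$ be a basis of $\boldsymbol\Delta^\circ(\mathcal S_{\mathbf p})$, let $A$ be the matrix with columns $\mathrm{vec}(\Delta_1),\dots,\mathrm{vec}(\Delta_{d_\circ})$, $R=R_{\mathcal S_{\mathbf p}}$ the entry selection matrix of $\mathcal S_{\mathbf p}$ and $\widetilde A=RA$. Let $\boldsymbol\theta_{\mathbf p}$ and $\widehat{\boldsymbol\theta}_n$ be the unique vectors of $\mathbb R^{d_\circ}$ such that $\mathcal I_\Gamma(\mathbf p)=\boldsymbol\gamma(\boldsymbol\theta_{\mathbf p})$ and $\mathcal I_\Gamma(\widehat{\mathbf p}_n)=\boldsymbol\gamma(\widehat{\boldsymbol\theta}_n)$. Then: (1) $\mathbf p$ shows quasi-independence, i.e. there exist positive constants $\{\beta^{(\ell)}_{i}\}_{\ell\in[d],i\in[r_\ell]}$ such that $p_{\boldsymbol i}=\left\{\prod_{\ell=1}^d\beta^{(\ell)}_{i_\ell}\right\}\mathbf 1\{\boldsymbol i\in\mathcal S_{\mathbf p}\}$ for all $\boldsymbol i\in\mathcal R$, if and only if $\boldsymbol\theta_{\mathbf p}=\mathbf 0$. (2)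 If $\boldsymbol\theta_{\mathbf p}=\mathbf 0$, then, as $n\to\infty$, $$n\,\widehat{\boldsymbol\theta}_n^{\top}\boldsymbol\Sigma_\theta^{-1}\widehat{\boldsymbol\theta}_n\to\chi^2_{d_\circ}\quad\text{in distribution},$$ where, with $\underline{\boldsymbol p}=\mathrm{vec}(\mathbf p)$ and $\underline{\boldsymbol\gamma}_{\mathbf p}=\mathrm{vec}(\mathcal I_\Gamma(\mathbf p))$, $$\boldsymbol\Sigma_\theta=\left[\widetilde A^{\top}\mathrm{diag}^{-1}(R\,\underline{\boldsymbol\gamma}_{\mathbf p})\widetilde A\right]^{-1}\left[\widetilde A^{\top}\mathrm{diag}^{-1}(R\,\underline{\boldsymbol p})\widetilde A\right]\left[\widetilde A^{\top}\mathrm{diag}^{-1}(R\,\underline{\boldsymbol\gamma}_{\mathbf p})\widetilde A\right]^{-1}$$ is of full rank $d_\circ$.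
   Context: Arrays. Fix positive integers $d$ and $r_1,\dots,r_d$; $[s]=\{1,\dots,s\}$; $\mathcal R=[r_1]\times\cdots\times[r_d]$; $\mathbb R^{r_1\times\cdots\times r_d}$ is the set of real arrays $\mathbf a=(a_{\boldsymbol i})_{\boldsymbol i\in\mathcal R}$; $\mathrm{Supp}(\mathbf a)=\{\boldsymbol i\in\mathcal R:a_{\boldsymbol i}\ne0\}$. The $\ell$-th margin of $\mathbf a$ is the vector $(a^{(\ell)}_i)_{i\in[r_\ell]}$ with $a^{(\ell)}_i=\sum_{\boldsymbol i\in\mathcal R:\,i_\ell=i}a_{\boldsymbol i}$. $\mathcal P$ is the set of arrays $\mathbf p$ with entries in $[0,1]$ summing to $1$ and with $p^{(\ell)}_i>0$ for all $\ell\in[d]$, $i\in[r_\ell]$. $\Gamma=\{\boldsymbol\gamma\in\mathcal P:\gamma^{(\ell)}_i=1/r_\ell\ \forall \ell\in[d],i\in[r_\ell]\}$. For nonempty $\mathcal S\subseteq\mathcal R$, $\Gamma(\mathcal S)=\{\boldsymbol\gamma\in\Gamma:\mathrm{Supp}(\boldsymbol\gamma)=\mathcal S\}$, and $\boldsymbol\Delta^\circ(\mathcal S)$ is the linear space of arrays $\mathbf a$ with $\mathrm{Supp}(\mathbf a)\subseteq\mathcal S$ and $a^{(\ell)}_i=0$ for all $\ell\in[d]$, $i\in[r_\ell]$. $\mathcal I$-projection. For $\mathbf p,\mathbf q\in\mathcal P$, $\mathcal I(\mathbf q\|\mathbf p)=\sum_{\boldsymbol i\in\mathrm{Supp}(\mathbf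 p)}q_{\boldsymbol i}\log(q_{\boldsymbol i}/p_{\boldsymbol i})$ if $\mathrm{Supp}(\mathbf q)\subseteq\mathrm{Supp}(\mathbf p)$ (with $0\log0=0$) and $\infty$ otherwise. $\mathcal I_\Gamma(\mathbf p)$ denotes the minimiser of $\boldsymbol\gamma\mapsto\mathcal I(\boldsymbol\gamma\|\mathbf p)$ over $\Gamma$; when $\Gamma(\mathrm{Supp}(\mathbf p))\neq\emptyset$ it exists, is unique, and has support $\mathrm{Supp}(\mathbf p)$. Vectorisation. $N=\prod_\ell r_\ell$; $\mathrm{vec}:\mathbb R^{r_1\times\cdots\times r_d}\to\mathbb R^{N}$ is column-major vectorisation: $\mathrm{vec}(\mathbf a)_{\phi(\boldsymbol i)}=a_{\boldsymbol i}$ with $\phi(\boldsymbol i)=i_1+\sum_{k=2}^d(i_k-1)\prod_{m=1}^{k-1}r_m$. $R_{\mathcal S}$ is the $|\mathcal S|\times N$ matrix obtained from the $N\times N$ identity matrix by deleting the rows with index $\phi(\boldsymbol i)$, $\boldsymbol i\in\mathcal R\setminus\mathcal S$. $\mathrm{diag}^{-1}(\boldsymbol v)$ is the inverse of $\mathrm{diag}(\boldsymbol v)$. Parameterisation. Let $\mathbf q$ be the array $q_{\boldsymbol i}=|\mathcal S_{\mathbf p}|^{-1}\mathbf 1\{\boldsymbol i\in\mathcal S_{\mathbf p}\}$ and $\boldsymbol\gamma^{(q)}=\mathcal I_\Gamma(\mathbf q)$ (the quasi-independence copula array with support $\mathcal S_{\mathbf p}$). For $\boldsymbol\theta\in\mathbb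 R^{d_\circ}$, $\boldsymbol\gamma(\boldsymbol\theta)=\boldsymbol\gamma^{(q)}+\sum_{k=1}^{d_\circ}\theta_k\Delta_k$. Sampling. $\mathcal X=\mathcal X_1\times\cdots\times\mathcal X_d$ with $\mathcal X_\ell=\{x^{(\ell)}_1<\dots<x^{(\ell)}_{r_\ell}\}\subset\mathbb R$. The probability array of $P$ is $p_{\boldsymbol i}=P(\{(x^{(1)}_{i_1},\dots,x^{(d)}_{i_d})\})$. The empirical array $\mathbf p_n$ has entries $\frac1n\sum_{k=1}^n\mathbf 1\{\mathbf X_k=(x^{(1)}_{i_1},\dots,x^{(d)}_{i_d})\}$, and $\widehat{\mathbf p}_n=\frac{n}{n+1}\mathbf p_n+\frac1{n+1}\mathbf q$ (the support $\mathcal S_{\mathbf p}$ is known). *)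

theory Defs
  imports
    "HOL-Probability.Probability"
    "HOL-Library.Function_Algebras"
    "Jordan_Normal_Form.Gauss_Jordan_Elimination"
    "Jordan_Normal_Form.DL_Rank"
begin

unbundle no vec_syntax
unbundle no inner_syntax

subsection \<open>Arrays\<close>

text \<open>
  A multi-index is an extensional function on \<open>{1..d}\<close>; an array of shape
  \<open>r 1 \<times> \<dots> \<times> r d\<close> is a real function of multi-indices that vanishes off the
  index set, so that arrays with equal entries are equal and linear combinations of arrays
  can be formed pointwise.
\<close>

type_synonym multi_index = "nat \<Rightarrow> nat"
type_synonym array = "multi_index \<Rightarrow> real"

definition index_set :: "nat \<Rightarrow> (nat \<Rightarrow> nat) \<Rightarrow> multi_index set" where
  "index_set d r = (\<Pi>\<^sub>E l\<in>{1..d}. {1..r l})"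

definition arrays :: "nat \<Rightarrow> (nat \<Rightarrow> nat) \<Rightarrow> array set" where
  "arrays d r = {a. \<forall>i. i \<notin> index_set d r \<longrightarrow> a i = 0}"

definition array_scale :: "real \<Rightarrow> array \<Rightarrow> array" where
  "array_scale c a = (\<lambda>i. c * a i)"

interpretation array: vector_space array_scale
  by unfold_locales (auto simp: array_scale_def fun_eq_iff algebra_simps)

definition Supp :: "nat \<Rightarrow> (nat \<Rightarrow> nat) \<Rightarrow> array \<Rightarrow> multi_index set" where
  "Supp d r a = {i \<in> index_set d r. a i \<noteq> 0}"

definition margin :: "nat \<Rightarrow> (nat \<Rightarrow> nat) \<Rightarrow> array \<Rightarrow> nat \<Rightarrow> nat \<Rightarrow> real" where
  "margin d r a l j = (\<Sum>i | i \<in> index_set d r \<and> i l = j. a i)"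

definition prob_arrays :: "nat \<Rightarrow> (nat \<Rightarrow> nat) \<Rightarrow> array set" where
  "prob_arrays d r = {p \<in> arrays d r.
     (\<forall>i\<in>index_set d r. 0 \<le> p i \<and> p i \<le> 1) \<and>
     (\<Sum>i\<in>index_set d r. p i) = 1 \<and>
     (\<forall>l\<in>{1..d}. \<forall>j\<in>{1..r l}. 0 < margin d r p l j)}"

definition copula_arrays :: "nat \<Rightarrow> (nat \<Rightarrow> nat) \<Rightarrow> array set" where
  "copula_arrays d r = {g \<in> prob_arrays d r.
     \<forall>l\<in>{1..d}. \<forall>j\<in>{1..r l}. margin d r g l j = 1 / real (r l)}"

definition copula_arrays_on ::
  "nat \<Rightarrow> (nat \<Rightarrow> nat) \<Rightarrow> multi_index set \<Rightarrow> array set" where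
  "copula_arrays_on d r S = {g \<in> copula_arrays d r. Supp d r g = S}"

definition zero_margin_space ::
  "nat \<Rightarrow> (nat \<Rightarrow> nat) \<Rightarrow> multi_index set \<Rightarrow> array set" where
  "zero_margin_space d r S = {a \<in> arrays d r. Supp d r a \<subseteq> S \<and>
     (\<forall>l\<in>{1..d}. \<forall>j\<in>{1..r l}. margin d r a l j = 0)}"

definition quasi_independent :: "nat \<Rightarrow> (nat \<Rightarrow> nat) \<Rightarrow> array \<Rightarrow> bool" where
  "quasi_independent d r p \<longleftrightarrow>
     (\<exists>\<beta> :: nat \<Rightarrow> nat \<Rightarrow> real. (\<forall>l\<in>{1..d}. \<forall>j\<in>{1..r l}. 0 < \<beta> l j) \<and>
       (\<forall>i\<in>index_set d r. p i = (\<Prod>l=1..d. \<beta> l (i l)) * indicator (Supp d r p) i))"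

subsection \<open>Information projection\<close>

text \<open>The convention \<open>0 * log 0 = 0\<close> needs no case distinction, since \<open>0 * y = 0\<close> for all \<open>y\<close>.\<close>

definition I_div :: "nat \<Rightarrow> (nat \<Rightarrow> nat) \<Rightarrow> array \<Rightarrow> array \<Rightarrow> ereal" where
  "I_div d r q p =
     (if Supp d r q \<subseteq> Supp d r p then ereal (\<Sum>i\<in>Supp d r p. q i * ln (q i / p i)) else \<infinity>)"

definition I_proj :: "nat \<Rightarrow> (nat \<Rightarrow> nat) \<Rightarrow> array \<Rightarrow> array" where
  "I_proj d r p = (THE g. is_arg_min (\<lambda>g. I_div d r g p) (\<lambda>g. g \<in> copula_arrays d r) g)"

definition uniform_on :: "multi_index set \<Rightarrow> array" where
  "uniform_on S = (\<lambda>i. indicator S i / real (card S))"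

definition copula_param ::
  "nat \<Rightarrow> (nat \<Rightarrow> nat) \<Rightarrow> multi_index set \<Rightarrow> array list \<Rightarrow> real vec \<Rightarrow> array" where
  "copula_param d r S \<Delta>s \<theta> =
     I_proj d r (uniform_on S) + (\<Sum>k<length \<Delta>s. array_scale (vec_index \<theta> k) (\<Delta>s ! k))"

definition is_theta ::
  "nat \<Rightarrow> (nat \<Rightarrow> nat) \<Rightarrow> multi_index set \<Rightarrow> array list \<Rightarrow> array \<Rightarrow> real vec \<Rightarrow> bool" where
  "is_theta d r S \<Delta>s p \<theta> \<longleftrightarrow>
     \<theta> \<in> carrier_vec (length \<Delta>s) \<and> I_proj d r p = copula_param d r S \<Delta>s \<theta>"

definition theta_of ::
  "nat \<Rightarrow> (nat \<Rightarrow> nat) \<Rightarrow> multi_index set \<Rightarrow> array list \<Rightarrow> array \<Rightarrow> real vec" where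
  "theta_of d r S \<Delta>s p = (THE \<theta>. is_theta d r S \<Delta>s p \<theta>)"

subsection \<open>Vectorisation and matrices\<close>

definition array_size :: "nat \<Rightarrow> (nat \<Rightarrow> nat) \<Rightarrow> nat" where
  "array_size d r = (\<Prod>l=1..d. r l)"

definition position :: "nat \<Rightarrow> (nat \<Rightarrow> nat) \<Rightarrow> multi_index \<Rightarrow> nat" where
  "position d r i = i 1 + (\<Sum>k=2..d. (i k - 1) * (\<Prod>m=1..k-1. r m))"

text \<open>
  \<open>position\<close> is a bijection from the index set onto \<open>{1..array_size d r}\<close>, whereas vectors and
  matrices are indexed from \<open>0\<close>: coordinate \<open>j\<close> carries the entry at position \<open>Suc j\<close>.
\<close>

definition vectorise :: "nat \<Rightarrow> (nat \<Rightarrow> nat) \<Rightarrow> array \<Rightarrow> real vec" where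
  "vectorise d r a =
     Matrix.vec (array_size d r) (\<lambda>j. a (the_inv_into (index_set d r) (position d r) (Suc j)))"

definition selection_mat :: "nat \<Rightarrow> (nat \<Rightarrow> nat) \<Rightarrow> multi_index set \<Rightarrow> real mat" where
  "selection_mat d r S = mat_of_rows (array_size d r)
     (nths (rows (1\<^sub>m (array_size d r))) {j. Suc j \<notin> position d r ` (index_set d r - S)})"

text \<open>\<open>mat_inv B\<close> is unspecified if \<open>B\<close> is singular.\<close>

definition mat_inv :: "real mat \<Rightarrow> real mat" where
  "mat_inv B = the (mat_inverse B)"

definition diag_inv :: "real vec \<Rightarrow> real mat" where
  "diag_inv v = mat_inv (mat_diag (dim_vec v) (vec_index v))"

definition Sigma_theta ::
  "nat \<Rightarrow> (nat \<Rightarrow> nat) \<Rightarrow> multi_index set \<Rightarrow> array list \<Rightarrow> array \<Rightarrow> real mat" where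
  "Sigma_theta d r S \<Delta>s p =
    (let A = mat_of_cols (array_size d r) (map (vectorise d r) \<Delta>s);
         R = selection_mat d r S;
         A' = R * A;
         p' = vectorise d r p;
         g' = vectorise d r (I_proj d r p);
         G = mat_inv (transpose_mat A' * diag_inv (R *\<^sub>v g') * A')
     in G * (transpose_mat A' * diag_inv (R *\<^sub>v p') * A') * G)"

subsection \<open>Sampling\<close>

definition grid_point :: "nat \<Rightarrow> (nat \<Rightarrow> nat \<Rightarrow> real) \<Rightarrow> multi_index \<Rightarrow> nat \<Rightarrow> real" where
  "grid_point d x i = (\<lambda>l\<in>{1..d}. x l (i l))"

definition grid :: "nat \<Rightarrow> (nat \<Rightarrow> nat) \<Rightarrow> (nat \<Rightarrow> nat \<Rightarrow> real) \<Rightarrow> (nat \<Rightarrow> real) set" where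
  "grid d r x = (\<Pi>\<^sub>E l\<in>{1..d}. x l ` {1..r l})"

definition prob_array ::
  "nat \<Rightarrow> (nat \<Rightarrow> nat) \<Rightarrow> (nat \<Rightarrow> nat \<Rightarrow> real) \<Rightarrow> (nat \<Rightarrow> real) measure \<Rightarrow> array" where
  "prob_array d r x P =
     (\<lambda>i. if i \<in> index_set d r then measure P {grid_point d x i} else 0)"

definition empirical_array ::
  "nat \<Rightarrow> (nat \<Rightarrow> nat) \<Rightarrow> (nat \<Rightarrow> nat \<Rightarrow> real) \<Rightarrow> (nat \<Rightarrow> 'w \<Rightarrow> nat \<Rightarrow> real) \<Rightarrow> nat \<Rightarrow> 'w \<Rightarrow> array" where
  "empirical_array d r x X n \<omega> =
     (\<lambda>i. if i \<in> index_set d r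
          then 1 / real n * (\<Sum>k=1..n. indicator {grid_point d x i} (X k \<omega>)) else 0)"

definition smoothed_array ::
  "nat \<Rightarrow> (nat \<Rightarrow> nat) \<Rightarrow> (nat \<Rightarrow> nat \<Rightarrow> real) \<Rightarrow> multi_index set \<Rightarrow>
   (nat \<Rightarrow> 'w \<Rightarrow> nat \<Rightarrow> real) \<Rightarrow> nat \<Rightarrow> 'w \<Rightarrow> array" where
  "smoothed_array d r x S X n \<omega> =
     array_scale (real n / real (n + 1)) (empirical_array d r x X n \<omega>) +
     array_scale (1 / real (n + 1)) (uniform_on S)"

text \<open>The law of a sum of \<open>k\<close> squared independent standard normal variables.\<close>

definition chi_square :: "nat \<Rightarrow> real measure" where
  "chi_square k =
     distr (\<Pi>\<^sub>M j\<in>{..<k}. std_normal_distribution) borel (\<lambda>z. \<Sum>j<k. (z j)\<^sup>2)"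

end

theory Submission
  imports Defs "HOL-Real_Asymp.Real_Asymp"
begin

text \<open>
  The projection \<open>\<gamma>\<close> of an array \<open>p\<close> with support \<open>S\<close> is characterised by \<open>supp \<gamma> = S\<close> together with
  orthogonality of \<open>ln (\<gamma> / p)\<close> to the zero-margin space. As the orthogonal complement of that space
  consists of the sums of functions of single coordinates, \<open>p\<close> and the uniform array have the same
  projection iff \<open>ln p\<close> is such a sum, that is, iff \<open>p\<close> is quasi-independent.

  For the limit law, the difference of the stationarity conditions at \<open>p\<close> and at the smoothed
  empirical array gives an explicit linearisation of the projection with an error quadratic in the
  deviation, whose expectation is of order \<open>1 / n\<close>. In a basis \<open>e\<close> of the zero-margin space that is
  orthonormal for the weight \<open>1 / p\<close>, the statistic is a sum of squares of coordinates \<open>W j\<close>, and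
  every linear combination of these coordinates obeys the one-dimensional central limit theorem.
  Averaging the characteristic functions of these combinations over Gaussian coefficients gives the
  Laplace transform of the sum of squares.
\<close>

subsection \<open>Weighted inner products on a finite set\<close>

text \<open>Why the limit is exactly chi-square: \<open>G\<close>, with weight
  \<open>1 / \<gamma>\<close>, turns \<open>\<theta>\<close> into the pairings of the relative
  deviation of the projection with the zero-margin space. To leading order these are the pairings of
  \<open>(q - p) / p\<close>, whose covariance is, up to the factor 1 / n, the Gram matrix
  \<open>H\<close> for the weight \<open>1 / p\<close>. So
  \<open>mat_inv \<Sigma> = G * mat_inv H * G\<close> whitens these pairings, and a basis
  orthonormal for \<open>1 / p\<close> makes the whitening invisible. Quasi-independence enters only
  by placing the origin of the parameterisation at the projection of \<open>p\<close>. The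
  projection is known only through its minimality. Smoothness in \<open>p\<close> is replaced by a
  quantitative comparison of stationarity conditions, valid for \<open>q\<close> near
  \<open>p\<close>; the remaining samples are absorbed by the trivial bound 2 on differences of
  characters. Measurability comes from the finite range of the smoothed empirical array. Mixing in
  the uniform array keeps all cells of \<open>S\<close> positive, so that almost surely the
  projection has support \<open>S\<close> at every sample size; the bias of order 1 / n disappears
  at scale sqrt n.\<close>

definition wip :: "'a set \<Rightarrow> ('a \<Rightarrow> real) \<Rightarrow> ('a \<Rightarrow> real) \<Rightarrow> ('a \<Rightarrow> real) \<Rightarrow> real" where
  "wip S w f g = (\<Sum>i\<in>S. w i * f i * g i)"

lemma wip_commute: "wip S w f g = wip S w g f"
  by (simp add: wip_def mult.commute mult.left_commute)

lemma wip_diff_left: "wip S w (\<lambda>i. f i - g i) h = wip S w f h - wip S w g h"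
  by (simp add: wip_def algebra_simps sum_subtractf)

lemma wip_scale_left: "wip S w (\<lambda>i. c * f i) h = c * wip S w f h"
  by (simp add: wip_def algebra_simps sum_distrib_left)

lemma wip_scale_right: "wip S w h (\<lambda>i. c * f i) = c * wip S w h f"
  by (simp add: wip_def algebra_simps sum_distrib_left)

lemma wip_sum_left: "wip S w (\<lambda>i. \<Sum>k\<in>K. c k * b k i) h = (\<Sum>k\<in>K. c k * wip S w (b k) h)"
proof -
  have "wip S w (\<lambda>i. \<Sum>k\<in>K. c k * b k i) h = (\<Sum>i\<in>S. \<Sum>k\<in>K. w i * (c k * b k i) * h i)"
    by (simp add: wip_def sum_distrib_left sum_distrib_right)
  also have "\<dots> = (\<Sum>k\<in>K. \<Sum>i\<in>S. w i * (c k * b k i) * h i)"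
    by (rule sum.swap)
  also have "\<dots> = (\<Sum>k\<in>K. c k * wip S w (b k) h)"
    by (simp add: wip_def sum_distrib_left algebra_simps)
  finally show ?thesis .
qed

lemma wip_sum_right: "wip S w h (\<lambda>i. \<Sum>k\<in>K. c k * b k i) = (\<Sum>k\<in>K. c k * wip S w h (b k))"
  by (simp add: wip_commute[of S w h] wip_sum_left)

lemma wip_cong:
  "(\<And>i. i \<in> S \<Longrightarrow> f i = f' i) \<Longrightarrow> (\<And>i. i \<in> S \<Longrightarrow> g i = g' i) \<Longrightarrow> wip S w f g = wip S w f' g'"
  by (simp add: wip_def)

lemma wip_self_nonneg:
  assumes "\<And>i. i \<in> S \<Longrightarrow> 0 < w i"
  shows "0 \<le> wip S w f f"
  unfolding wip_def
proof (rule sum_nonneg)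
  fix i assume "i \<in> S"
  then have "0 \<le> w i * (f i * f i)" using assms by (simp add: less_imp_le)
  then show "0 \<le> w i * f i * f i" by (simp add: mult.assoc)
qed

lemma wip_self_eq_0_iff:
  assumes "finite S" "\<And>i. i \<in> S \<Longrightarrow> 0 < w i"
  shows "wip S w f f = 0 \<longleftrightarrow> (\<forall>i\<in>S. f i = 0)"
proof -
  have "\<And>i. i \<in> S \<Longrightarrow> 0 \<le> w i * f i * f i"
    using assms(2) by (simp add: mult.assoc less_imp_le)
  then have "wip S w f f = 0 \<longleftrightarrow> (\<forall>i\<in>S. w i * f i * f i = 0)"
    unfolding wip_def by (rule sum_nonneg_eq_0_iff[OF assms(1)])
  also have "\<dots> \<longleftrightarrow> (\<forall>i\<in>S. f i = 0)"
    using assms(2) by (metis less_irrefl mult_eq_0_iff)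
  finally show ?thesis .
qed

text \<open>Gram-Schmidt without normalisation, so that the family \<open>b\<close> may be
  dependent. \<open>f\<close> stays arbitrary in the induction because the hypothesis is applied to
  \<open>f\<close> and to the new vector \<open>b m\<close>.\<close>

lemma wip_projection:
  assumes S: "finite S" "\<And>i. i \<in> S \<Longrightarrow> 0 < w i" and "finite K"
  shows "\<exists>c. \<forall>k\<in>K. wip S w (\<lambda>i. f i - (\<Sum>j\<in>K. c j * b j i)) (b k) = 0"
  using \<open>finite K\<close>
proof (induction K arbitrary: f)
  case empty
  then show ?case by simp
next
  case (insert m K)
  obtain c where c: "\<And>k. k \<in> K \<Longrightarrow> wip S w (\<lambda>i. f i - (\<Sum>j\<in>K. c j * b j i)) (b k) = 0"
    using insert.IH[of f] by blast
  obtain a where a: "\<And>k. k \<in> K \<Longrightarrow> wip S w (\<lambda>i. b m i - (\<Sum>j\<in>K. a j * b j i)) (b k) = 0"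
    using insert.IH[of "b m"] by blast
  define f' where "f' = (\<lambda>i. f i - (\<Sum>j\<in>K. c j * b j i))"
  define h where "h = (\<lambda>i. b m i - (\<Sum>j\<in>K. a j * b j i))"
  define t where "t = wip S w f' h / wip S w h h"
  \<comment> \<open>\<open>h\<close> differs from \<open>b m\<close> by a combination of the earlier
    \<open>b j\<close>, which a function orthogonal to all of them does not see.\<close>
  have h_right: "wip S w g h = wip S w g (b m)" if "\<And>k. k \<in> K \<Longrightarrow> wip S w g (b k) = 0" for g
  proof -
    have "wip S w g h = wip S w (b m) g - (\<Sum>j\<in>K. a j * wip S w (b j) g)"
      by (subst wip_commute) (simp add: h_def wip_diff_left wip_sum_left)
    also have "\<dots> = wip S w g (b m)"
      using that by (simp add: wip_commute[of S w _ g])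
    finally show ?thesis .
  qed
  have fh: "wip S w f' h = wip S w f' (b m)"
    using c by (intro h_right) (simp add: f'_def)
  have hh: "wip S w h (b m) = wip S w h h"
    using a by (intro h_right[symmetric]) (simp add: h_def)
  \<comment> \<open>If \<open>h\<close> has length 0, it vanishes on \<open>S\<close>, and
    \<open>t\<close> is 0 because division by 0 yields 0.\<close>
  have orth_m: "wip S w (\<lambda>i. f' i - t * h i) (b m) = 0"
  proof (cases "wip S w h h = 0")
    case True
    then have "\<And>i. i \<in> S \<Longrightarrow> h i = 0"
      using wip_self_eq_0_iff[of S w h] S by blast
    then have "wip S w f' h = 0" by (simp add: wip_def)
    then show ?thesis
      using True by (simp add: t_def fh wip_diff_left wip_scale_left)
  next
    case False
    then show ?thesis by (simp only: wip_diff_left wip_scale_left hh fh t_def) simp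
  qed
  have orth_K: "wip S w (\<lambda>i. f' i - t * h i) (b k) = 0" if "k \<in> K" for k
    using a[OF that] c[OF that]
    by (simp add: wip_diff_left[of S w f'] wip_scale_left f'_def[symmetric] h_def[symmetric])
  define c' where "c' = (\<lambda>j. if j = m then t else c j - t * a j)"
  have "f i - (\<Sum>j\<in>insert m K. c' j * b j i) = f' i - t * h i" for i
  proof -
    have "(\<Sum>j\<in>K. c' j * b j i) = (\<Sum>j\<in>K. (c j - t * a j) * b j i)"
      using insert.hyps by (intro sum.cong) (auto simp: c'_def)
    then have "(\<Sum>j\<in>insert m K. c' j * b j i) = t * b m i + (\<Sum>j\<in>K. (c j - t * a j) * b j i)"
      using insert.hyps by (simp add: c'_def)
    then show ?thesis
      by (simp add: f'_def h_def algebra_simps sum_subtractf sum_distrib_left)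
  qed
  then show ?case
    using orth_m orth_K by (intro exI[of _ c']) auto
qed

text \<open>Double annihilator in finite dimension: the residual \<open>a\<close> of the projection
  of \<open>f\<close> annihilates the family, hence \<open>f\<close> by assumption, hence
  itself.\<close>

lemma in_span_if_orthogonal_to_annihilator:
  fixes f :: "'a \<Rightarrow> real"
  assumes S: "finite S" and K: "finite K"
    and orth: "\<And>a. (\<And>k. k \<in> K \<Longrightarrow> (\<Sum>i\<in>S. a i * b k i) = 0) \<Longrightarrow> (\<Sum>i\<in>S. a i * f i) = 0"
  shows "\<exists>c. \<forall>i\<in>S. f i = (\<Sum>k\<in>K. c k * b k i)"
proof -
  let ?w = "\<lambda>_::'a. 1::real"
  obtain c where c: "\<And>k. k \<in> K \<Longrightarrow> wip S ?w (\<lambda>i. f i - (\<Sum>j\<in>K. c j * b j i)) (b k) = 0"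
    using wip_projection[of S ?w K f b] S K by auto
  define a where "a = (\<lambda>i. f i - (\<Sum>j\<in>K. c j * b j i))"
  have "wip S ?w a f = 0"
    using orth[of a] c by (simp add: wip_def a_def)
  moreover have "wip S ?w a (\<lambda>i. \<Sum>j\<in>K. c j * b j i) = 0"
    using c by (simp add: wip_sum_right a_def)
  ultimately have "wip S ?w a a = 0"
    by (subst (2) a_def) (simp add: wip_commute[of S ?w a] wip_diff_left)
  then have "\<forall>i\<in>S. a i = 0" using wip_self_eq_0_iff[of S ?w a] S by simp
  then show ?thesis by (auto simp: a_def)
qed

text \<open>Both changes of basis are recorded: \<open>C\<close> later shows that each
  \<open>e j\<close> has zero margins, and \<open>D\<close> that the \<open>e j\<close> span the
  whole zero-margin space. Independence is required on \<open>S\<close> because \<open>wip\<close>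
  sees nothing else.\<close>

lemma wip_gram_schmidt:
  fixes b :: "nat \<Rightarrow> 'a \<Rightarrow> real"
  assumes S: "finite S" "\<And>i. i \<in> S \<Longrightarrow> 0 < w i"
    and indep: "\<And>c. (\<And>i. i \<in> S \<Longrightarrow> (\<Sum>k<m. c k * b k i) = 0) \<Longrightarrow> \<forall>k<m. c k = 0"
  shows "\<exists>e C D. (\<forall>j<m. e j = (\<lambda>i. \<Sum>k<m. C j k * b k i)) \<and>
    (\<forall>j<m. \<forall>k<m. wip S w (e j) (e k) = (if j = k then 1 else 0)) \<and>
    (\<forall>k<m. \<forall>i\<in>S. b k i = (\<Sum>j<m. D k j * e j i))"
  using indep
proof (induction m)
  case 0
  then show ?case by simp
next
  case (Suc m)
  have "\<forall>k<m. c k = 0" if "\<And>i. i \<in> S \<Longrightarrow> (\<Sum>k<m. c k * b k i) = 0" for c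
  proof -
    have "(\<Sum>k<Suc m. (c(m := 0)) k * b k i) = (\<Sum>k<m. c k * b k i)" for i
      by (simp add: sum.lessThan_Suc)
    then have "\<forall>k<Suc m. (c(m := 0)) k = 0"
      using Suc.prems[of "c(m := 0)"] that by simp
    then show ?thesis
      by (metis fun_upd_other less_Suc_eq less_irrefl)
  qed
  from Suc.IH[OF this] obtain e C D where
    e: "\<And>j. j < m \<Longrightarrow> e j = (\<lambda>i. \<Sum>k<m. C j k * b k i)"
    and on: "\<And>j k. j < m \<Longrightarrow> k < m \<Longrightarrow> wip S w (e j) (e k) = (if j = k then 1 else 0)"
    and D: "\<And>k i. k < m \<Longrightarrow> i \<in> S \<Longrightarrow> b k i = (\<Sum>j<m. D k j * e j i)"
    by blast
  obtain c where c: "\<And>k. k < m \<Longrightarrow> wip S w (\<lambda>i. b m i - (\<Sum>j<m. c j * b j i)) (b k) = 0"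
    using wip_projection[of S w "{..<m}" "b m" b] S by auto
  define h where "h = (\<lambda>i. b m i - (\<Sum>j<m. c j * b j i))"
  have "wip S w h h \<noteq> 0"
  proof
    assume "wip S w h h = 0"
    then have h0: "\<And>i. i \<in> S \<Longrightarrow> h i = 0" using wip_self_eq_0_iff[of S w h] S by blast
    \<comment> \<open>The coefficient of \<open>b m\<close> in \<open>h\<close> is 1, so a vanishing
      \<open>h\<close> would be a nontrivial relation.\<close>
    have "(\<Sum>k<Suc m. ((\<lambda>k. - c k)(m := 1)) k * b k i) = 0" if "i \<in> S" for i
      using h0[OF that] by (simp add: h_def sum_negf)
    from Suc.prems[OF this] show False by auto
  qed
  then have hpos: "0 < wip S w h h"
    using wip_self_nonneg[of S w h] S(2) by fastforce
  define s where "s = sqrt (wip S w h h)"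
  have s: "s > 0" "s * s = wip S w h h" using hpos by (auto simp: s_def)
  define e' where "e' = e(m := (\<lambda>i. (1 / s) * h i))"
  define C' where "C' = (\<lambda>j k. if j < m then (if k < m then C j k else 0)
     else (if k < m then - c k / s else 1 / s))"
  define D' where "D' = (\<lambda>k j. if k < m then (if j < m then D k j else 0)
     else (if j < m then (\<Sum>k<m. c k * D k j) else s))"
  have he: "wip S w h (e j) = 0" if "j < m" for j
    using c by (simp add: e[OF that] wip_sum_right h_def)
  have "e' j = (\<lambda>i. \<Sum>k<Suc m. C' j k * b k i)" if "j < Suc m" for j
  proof (cases "j = m")
    case True
    then show ?thesis
      by (auto simp: e'_def C'_def h_def fun_eq_iff diff_divide_distrib sum_negf sum_divide_distrib)
  next
    case False
    then have "j < m" using that by simp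
    then show ?thesis by (simp add: e'_def C'_def e)
  qed
  moreover have "wip S w (e' j) (e' k) = (if j = k then 1 else 0)" if "j < Suc m" "k < Suc m" for j k
  proof -
    have "wip S w (e' m) (e' m) = 1"
    proof -
      have "wip S w (e' m) (e' m) = (1 / s) * ((1 / s) * wip S w h h)"
        by (simp only: e'_def fun_upd_same wip_scale_left wip_scale_right)
      also have "\<dots> = 1" using s(1) by (simp flip: s(2))
      finally show ?thesis .
    qed
    moreover have "wip S w (e' m) (e' k) = 0" if "k < m" for k
    proof -
      have "e' k = e k" using that by (simp add: e'_def)
      then show ?thesis
        using he[OF that] by (simp only: e'_def fun_upd_same wip_scale_left mult_zero_right)
    qed
    moreover have "wip S w (e' j) (e' k) = (if j = k then 1 else 0)" if "j < m" "k < m"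
      using on[OF that] that by (simp add: e'_def)
    ultimately show ?thesis
      using that wip_commute[of S w "e' j" "e' m"]
      by (cases "j = m"; cases "k = m") (auto simp: less_Suc_eq)
  qed
  moreover have "b k i = (\<Sum>j<Suc m. D' k j * e' j i)" if "k < Suc m" "i \<in> S" for k i
  proof (cases "k = m")
    case True
    have "(\<Sum>k<m. c k * b k i) = (\<Sum>k<m. \<Sum>j<m. c k * D k j * e j i)"
      using D that by (simp add: sum_distrib_left mult.assoc)
    also have "\<dots> = (\<Sum>j<m. \<Sum>k<m. c k * D k j * e j i)" by (rule sum.swap)
    finally have "b m i = (\<Sum>j<m. (\<Sum>k<m. c k * D k j) * e j i) + h i"
      by (simp add: h_def sum_distrib_right)
    then show ?thesis using s True by (simp add: D'_def e'_def)
  next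
    case False
    then have "k < m" using that by simp
    then show ?thesis using D that by (simp add: e'_def D'_def)
  qed
  ultimately show ?case
    by (intro exI[of _ e'] exI[of _ C'] exI[of _ D'] conjI allI impI ballI)
qed

text \<open>Parseval: orthonormality forces the coefficients \<open>D j\<close> to be the inner
  products with \<open>e j\<close>.\<close>

lemma wip_orthonormal_expansion:
  fixes e :: "nat \<Rightarrow> 'a \<Rightarrow> real"
  assumes on: "\<And>j k. j < m \<Longrightarrow> k < m \<Longrightarrow> wip S w (e j) (e k) = (if j = k then 1 else 0)"
    and g: "\<And>i. i \<in> S \<Longrightarrow> g i = (\<Sum>j<m. D j * e j i)"
  shows "wip S w g g = (\<Sum>j<m. (wip S w (e j) g)\<^sup>2)"
proof -
  have D: "wip S w (e j) g = D j" if "j < m" for j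
  proof -
    have "wip S w (e j) g = (\<Sum>k<m. D k * wip S w (e j) (e k))"
      by (subst wip_cong[of S "e j" "e j" g, OF refl g]) (auto simp: wip_sum_right)
    also have "\<dots> = (\<Sum>k<m. if k = j then D j else 0)"
      using on[OF that] by (intro sum.cong) auto
    also have "\<dots> = D j" using that by simp
    finally show ?thesis .
  qed
  have "wip S w g g = (\<Sum>k<m. D k * wip S w (e k) g)"
    by (subst wip_cong[of S g "\<lambda>i. \<Sum>j<m. D j * e j i" g g, OF g refl]) (auto simp: wip_sum_left)
  then show ?thesis by (simp add: D power2_eq_square)
qed

subsection \<open>Existence and characterisation of the projection\<close>

lemma finite_index_set [simp]: "finite (index_set d r)"
  unfolding index_set_def by (intro finite_PiE) auto

lemma index_set_component: "i \<in> index_set d r \<Longrightarrow> l \<in> {1..d} \<Longrightarrow> i l \<in> {1..r l}"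
  by (auto simp: index_set_def)

text \<open>Grouping by the value of coordinate \<open>l\<close>. In particular, arrays with zero
  margins are orthogonal to every function of a single coordinate.\<close>

lemma sum_eq_weighted_margins:
  assumes "l \<in> {1..d}"
  shows "(\<Sum>i\<in>index_set d r. a i * f (i l)) = (\<Sum>j=1..r l. f j * margin d r a l j)"
proof -
  have "(\<Sum>i\<in>index_set d r. a i * f (i l))
      = (\<Sum>j=1..r l. \<Sum>i | i \<in> index_set d r \<and> i l = j. a i * f (i l))"
    using index_set_component[OF _ assms]
    by (intro sum.group[symmetric]) auto
  also have "\<dots> = (\<Sum>j=1..r l. f j * margin d r a l j)"
    unfolding margin_def sum_distrib_left by (intro sum.cong refl) auto
  finally show ?thesis .
qed

text \<open>Pointwise Gibbs inequality, from \<open>ln y \<le> y - 1\<close> at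
  \<open>y = g / h\<close> with equality only at 1. Summed over arrays of equal mass it gives
  positivity of the divergence.\<close>

lemma mult_ln_ge:
  fixes h g :: real
  assumes "0 \<le> h" "0 < g"
  shows "h - g \<le> h * ln (h / g)" and "h * ln (h / g) = h - g \<Longrightarrow> h = g"
proof -
  have "h - g \<le> h * ln (h / g) \<and> (h * ln (h / g) = h - g \<longrightarrow> h = g)"
  proof (cases "h = 0")
    case True
    then show ?thesis using assms by auto
  next
    case False
    then have h: "0 < h" using assms by simp
    then have gh: "0 < g / h" using assms by simp
    have eq: "h * ln (h / g) = - (h * ln (g / h))"
      using h assms by (simp add: ln_div algebra_simps)
    have "h * ln (g / h) \<le> h * (g / h - 1)"
      using ln_le_minus_one[OF gh] h by (intro mult_left_mono) auto
    also have "\<dots> = g - h" using h by (simp add: field_simps)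
    finally have 1: "h * ln (g / h) \<le> g - h" .
    have "h = g" if "h * ln (h / g) = h - g"
    proof -
      have "h * ln (g / h) = h * (g / h - 1)"
        using that eq h by (simp add: right_diff_distrib)
      then have "ln (g / h) = g / h - 1" using h by simp
      then have "g / h = 1" using ln_eq_minus_one[OF gh] by simp
      then show ?thesis using h by simp
    qed
    then show ?thesis using 1 eq by auto
  qed
  then show "h - g \<le> h * ln (h / g)" and "h * ln (h / g) = h - g \<Longrightarrow> h = g" by auto
qed

lemma mult_ln_div_split:
  fixes h g p :: real
  assumes "0 \<le> h" "0 < g" "0 < p"
  shows "h * ln (h / p) = h * ln (h / g) + h * ln (g / p)"
  using assms by (cases "h = 0") (auto simp: ln_div algebra_simps)

text \<open>Convexity through tangents: by \<open>mult_ln_ge\<close> the tangent at the mixture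
  \<open>m\<close> lies below the function, and averaging it over the two endpoints returns the
  value at \<open>m\<close>.\<close>

lemma mult_ln_div_convex:
  fixes x y p t :: real
  assumes "0 \<le> x" "0 < y" "0 < p" "0 < t" "t < 1"
  shows "((1 - t) * x + t * y) * ln (((1 - t) * x + t * y) / p)
    \<le> (1 - t) * (x * ln (x / p)) + t * (y * ln (y / p))"
proof -
  define m where "m = (1 - t) * x + t * y"
  have m: "0 < m" unfolding m_def using assms by (intro add_nonneg_pos) auto
  have *: "z - m + z * ln (m / p) \<le> z * ln (z / p)" if "0 \<le> z" for z
    using mult_ln_ge(1)[of z m] mult_ln_div_split[of z m p] that m assms by simp
  have "(1 - t) * (x - m + x * ln (m / p)) + t * (y - m + y * ln (m / p))
      \<le> (1 - t) * (x * ln (x / p)) + t * (y * ln (y / p))"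
    using *[of x] *[of y] assms by (intro add_mono mult_left_mono) auto
  moreover have "(1 - t) * (x - m + x * ln (m / p)) + t * (y - m + y * ln (m / p))
      = m * ln (m / p) + (((1 - t) * x + t * y) - m)"
    unfolding m_def by (simp add: algebra_simps)
  ultimately show ?thesis by (simp add: m_def)
qed

text \<open>The only delicate point is 0, where the limit of \<open>x * ln x\<close> agrees with the
  conventional value. This permits minimisation over a closed set that reaches the boundary.\<close>

lemma continuous_on_mult_ln_div:
  fixes p :: real
  assumes "0 < p"
  shows "continuous_on {0..} (\<lambda>x. x * ln (x / p))"
  unfolding continuous_on_def
proof
  fix x :: real
  assume "x \<in> {0..}"
  show "((\<lambda>x. x * ln (x / p)) \<longlongrightarrow> x * ln (x / p)) (at x within {0..})"
  proof (cases "x = 0")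
    case True
    have "((\<lambda>x. x * ln (x / p)) \<longlongrightarrow> 0) (at_right 0)"
      using assms by real_asymp
    moreover have "at (0::real) within {0..} = at_right 0"
      by (simp add: at_within_def atLeast_def greaterThan_def) (intro arg_cong2[of _ _ _ _ inf] refl arg_cong[of _ _ principal], auto)
    ultimately show ?thesis using True by simp
  next
    case False
    then have "isCont (\<lambda>x. x * ln (x / p)) x"
      using assms \<open>x \<in> {0..}\<close> by (intro continuous_intros) auto
    then show ?thesis
      unfolding isCont_def by (rule tendsto_within_subset) simp
  qed
qed

text \<open>Total mass 1 is the sum of the \<open>r 1\<close> equal margins of the first coordinate,
  and the upper bound 1 on the entries follows from it.\<close>

lemma copula_arraysI:
  assumes d: "1 \<le> d" and r: "\<And>l. l \<in> {1..d} \<Longrightarrow> 1 \<le> r l"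
    and arr: "g \<in> arrays d r" and nonneg: "\<And>i. i \<in> index_set d r \<Longrightarrow> 0 \<le> g i"
    and marg: "\<And>l j. l \<in> {1..d} \<Longrightarrow> j \<in> {1..r l} \<Longrightarrow> margin d r g l j = 1 / real (r l)"
  shows "g \<in> copula_arrays d r"
proof -
  have d1: "1 \<in> {1..d}" using d by simp
  have "(\<Sum>i\<in>index_set d r. g i) = (\<Sum>j=1..r 1. 1 * margin d r g 1 j)"
    using sum_eq_weighted_margins[OF d1, where r = r and a = g and f = "\<lambda>_. 1"] by simp
  also have "\<dots> = (\<Sum>j=1..r 1. 1 / real (r 1))"
    using marg[OF d1] by (intro sum.cong) auto
  also have "\<dots> = 1" using r[OF d1] by simp
  finally have sum1: "(\<Sum>i\<in>index_set d r. g i) = 1" .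
  have "g i \<le> 1" if "i \<in> index_set d r" for i
    using member_le_sum[of i "index_set d r" g] that nonneg sum1 by simp
  moreover have "0 < margin d r g l j" if "l \<in> {1..d}" "j \<in> {1..r l}" for l j
    using r[OF that(1)] by (simp add: marg[OF that])
  ultimately show ?thesis
    using arr nonneg sum1 marg by (simp add: copula_arrays_def prob_arrays_def)
qed

text \<open>Arrays are functions on an infinite type, so compactness is meant in the product
  topology: a box whose factors outside \<open>S\<close> are single points, cut by the closed margin
  conditions.\<close>

lemma compact_fixed_margin_arrays:
  assumes "S \<subseteq> index_set d r"
  shows "compact {h :: array. (\<forall>i. h i \<in> (if i \<in> S then {0..1} else {0})) \<and>
    (\<forall>l\<in>{1..d}. \<forall>j\<in>{1..r l}. margin d r h l j = c l)}" (is "compact ?K")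
proof -
  define B where "B = (\<lambda>i. if i \<in> S then {0..1} else {0::real})"
  have "compactin (product_topology (\<lambda>_. euclidean) UNIV) (PiE UNIV B)"
    by (subst compactin_PiE) (auto simp: B_def)
  then have "compact (PiE UNIV B)"
    by (simp add: euclidean_product_topology)
  moreover have "closed (\<Inter>l\<in>{1..d}. \<Inter>j\<in>{1..r l}. {h :: array. margin d r h l j = c l})"
    unfolding margin_def
    by (intro closed_INT ballI closed_Collect_eq continuous_intros continuous_on_product_coordinates)
  ultimately have "compact (PiE UNIV B \<inter> (\<Inter>l\<in>{1..d}. \<Inter>j\<in>{1..r l}. {h. margin d r h l j = c l}))"
    by (rule compact_Int_closed)
  moreover have "{h. (\<forall>i. h i \<in> B i) \<and> (\<forall>l\<in>{1..d}. \<forall>j\<in>{1..r l}. margin d r h l j = c l)}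
      = PiE UNIV B \<inter> (\<Inter>l\<in>{1..d}. \<Inter>j\<in>{1..r l}. {h. margin d r h l j = c l})"
    by (rule Set.set_eqI) (simp add: PiE_UNIV_domain Pi_iff)
  ultimately show ?thesis by (simp add: B_def)
qed

section \<open>Copula arrays and the projection for a fixed support\<close>

locale copula_support =
  fixes d :: nat and r :: "nat \<Rightarrow> nat" and S :: "multi_index set"
  assumes d_pos: "1 \<le> d"
    and r_pos: "\<And>l. l \<in> {1..d} \<Longrightarrow> 1 \<le> r l"
    and S_subset: "S \<subseteq> index_set d r"
    and copulas_on_S: "copula_arrays_on d r S \<noteq> {}"
begin

abbreviation Z :: "array set" where "Z \<equiv> zero_margin_space d r S"

lemma finite_S [simp]: "finite S"
  using S_subset finite_index_set finite_subset by blast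

lemma zero_margin_outside: "a \<in> Z \<Longrightarrow> i \<notin> S \<Longrightarrow> a i = 0"
  by (auto simp: zero_margin_space_def arrays_def Supp_def)

lemma sum_zero_margin:
  assumes a: "a \<in> Z" and l: "l \<in> {1..d}"
  shows "(\<Sum>i\<in>S. a i * f (i l)) = 0"
proof -
  have "(\<Sum>i\<in>S. a i * f (i l)) = (\<Sum>i\<in>index_set d r. a i * f (i l))"
    using zero_margin_outside[OF a] S_subset by (intro sum.mono_neutral_left) auto
  also have "\<dots> = 0"
    using a l by (simp add: sum_eq_weighted_margins zero_margin_space_def)
  finally show ?thesis .
qed

lemma sum_zero_margin_space: "a \<in> Z \<Longrightarrow> (\<Sum>i\<in>S. a i) = 0"
  using sum_zero_margin[of a 1 "\<lambda>_. 1"] d_pos by simp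

lemma copula_diff_in_zero_margin_space:
  assumes "g \<in> copula_arrays d r" "h \<in> copula_arrays d r" "Supp d r g \<subseteq> S" "Supp d r h \<subseteq> S"
  shows "(\<lambda>i. g i - h i) \<in> Z"
proof -
  have "Supp d r (\<lambda>i. g i - h i) \<subseteq> Supp d r g \<union> Supp d r h" by (auto simp: Supp_def)
  then show ?thesis
    using assms
    by (auto simp: zero_margin_space_def copula_arrays_def prob_arrays_def arrays_def
        margin_def sum_subtractf)
qed

lemma copula_add_in_copula_arrays:
  assumes g: "g \<in> copula_arrays d r" and a: "a \<in> Z"
    and nonneg: "\<And>i. i \<in> S \<Longrightarrow> 0 \<le> g i + t * a i"
  shows "(\<lambda>i. g i + t * a i) \<in> copula_arrays d r"
proof (rule copula_arraysI[OF d_pos r_pos])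
  show "(\<lambda>i. g i + t * a i) \<in> arrays d r"
    using g a by (auto simp: copula_arrays_def prob_arrays_def arrays_def zero_margin_space_def)
  show "0 \<le> g i + t * a i" if "i \<in> index_set d r" for i
    using nonneg[of i] that g zero_margin_outside[OF a, of i]
    by (cases "i \<in> S") (auto simp: copula_arrays_def prob_arrays_def)
  show "margin d r (\<lambda>i. g i + t * a i) l j = 1 / real (r l)"
    if "l \<in> {1..d}" "j \<in> {1..r l}" for l j
    using g a that
    by (auto simp: margin_def sum.distrib sum_distrib_left[symmetric] copula_arrays_def
        zero_margin_space_def)
qed

lemma copula_on_props:
  assumes "g \<in> copula_arrays_on d r S"
  shows "g \<in> copula_arrays d r" "Supp d r g = S" "i \<in> S \<Longrightarrow> 0 < g i" "g i \<le> 1" "0 \<le> g i"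
    "i \<notin> S \<Longrightarrow> g i = 0" "(\<Sum>i\<in>S. g i) = 1"
proof -
  have sum1: "(\<Sum>i\<in>index_set d r. g i) = 1" and Supp: "Supp d r g = S"
    and 01: "\<And>i. i \<in> index_set d r \<Longrightarrow> 0 \<le> g i \<and> g i \<le> 1"
    and out: "\<And>i. i \<notin> index_set d r \<Longrightarrow> g i = 0"
    using assms by (auto simp: copula_arrays_on_def copula_arrays_def prob_arrays_def arrays_def)
  have "(\<Sum>i\<in>S. g i) = (\<Sum>i\<in>index_set d r. g i)"
    using Supp by (intro sum.mono_neutral_left) (auto simp: Supp_def)
  then show "(\<Sum>i\<in>S. g i) = 1" using sum1 by simp
  show "g \<in> copula_arrays d r" "Supp d r g = S"
    using assms by (auto simp: copula_arrays_on_def)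
  show "0 \<le> g i" "g i \<le> 1" using 01[of i] out[of i] by (cases "i \<in> index_set d r"; simp)+
  show "0 < g i" if "i \<in> S"
    using that Supp 01[of i] S_subset by (auto simp: Supp_def order_le_less)
  show "g i = 0" if "i \<notin> S"
    using that Supp out[of i] by (auto simp: Supp_def)
qed

lemma S_nonempty: "S \<noteq> {}"
  using copulas_on_S copula_on_props(7) by fastforce

text \<open>The first-order condition along directions of \<open>Z\<close>. The summand
  \<open>a i\<close> from differentiating \<open>x * ln x\<close> is absent since \<open>a\<close>
  sums to 0 over \<open>S\<close>.\<close>

definition stationary :: "array \<Rightarrow> array \<Rightarrow> bool" where
  "stationary p g \<longleftrightarrow> g \<in> copula_arrays_on d r S \<and> (\<forall>a\<in>Z. (\<Sum>i\<in>S. a i * ln (g i / p i)) = 0)"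

definition positive_on_S :: "array \<Rightarrow> bool" where
  "positive_on_S p \<longleftrightarrow> Supp d r p = S \<and> (\<forall>i\<in>S. 0 < p i)"

abbreviation divergence :: "array \<Rightarrow> array \<Rightarrow> real" where
  "divergence p h \<equiv> (\<Sum>i\<in>S. h i * ln (h i / p i))"

text \<open>Pythagorean identity of information projection: the excess of \<open>h\<close> over
  \<open>g\<close> is the divergence of \<open>h\<close> from \<open>g\<close>, because stationarity
  kills the cross term. An \<open>h\<close> charging cells outside \<open>S\<close> has infinite
  divergence.\<close>

lemma stationary_less_I_div:
  assumes p: "positive_on_S p" and g: "stationary p g"
    and h: "h \<in> copula_arrays d r" "h \<noteq> g"
  shows "I_div d r g p < I_div d r h p"
proof -
  have pS: "Supp d r p = S" "\<And>i. i \<in> S \<Longrightarrow> 0 < p i"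
    using p by (auto simp: positive_on_S_def)
  have gS: "g \<in> copula_arrays_on d r S" using g by (simp add: stationary_def)
  show ?thesis
  proof (cases "Supp d r h \<subseteq> S")
    case False
    then show ?thesis using copula_on_props(2)[OF gS] pS by (simp add: I_div_def)
  next
    case True
    have h0: "0 \<le> h i" for i
      using h by (cases "i \<in> index_set d r") (auto simp: copula_arrays_def prob_arrays_def arrays_def)
    have hout: "h i = 0" if "i \<notin> S" for i
      using True that h by (auto simp: Supp_def copula_arrays_def prob_arrays_def arrays_def)
    let ?a = "\<lambda>i. h i - g i"
    have a: "?a \<in> Z"
      using copula_diff_in_zero_margin_space[OF h(1) copula_on_props(1)[OF gS] True] copula_on_props(2)[OF gS]
      by simp
    have "divergence p h - divergence p g
      = (\<Sum>i\<in>S. h i * ln (h i / g i) + ?a i * ln (g i / p i))"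
      unfolding sum_subtractf[symmetric]
      using mult_ln_div_split[OF h0 copula_on_props(3)[OF gS] pS(2)]
      by (intro sum.cong refl) (simp add: algebra_simps)
    \<comment> \<open>Subtracting the vanishing sum of \<open>?a\<close> makes every summand
      nonnegative by \<open>mult_ln_ge\<close>, and strictly positive where \<open>h\<close> and
      \<open>g\<close> differ.\<close>
    also have "\<dots> = (\<Sum>i\<in>S. h i * ln (h i / g i)) - (\<Sum>i\<in>S. ?a i)"
      using g a sum_zero_margin_space[OF a] by (simp add: sum.distrib stationary_def)
    also have "\<dots> = (\<Sum>i\<in>S. h i * ln (h i / g i) - ?a i)"
      by (simp add: sum_subtractf)
    also have "\<dots> > 0"
    proof -
      obtain i where i: "i \<in> S" "h i \<noteq> g i"
        using h(2) hout copula_on_props(6)[OF gS] by (metis ext)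
      have "0 \<le> h i * ln (h i / g i) - ?a i" if "i \<in> S" for i
        using mult_ln_ge(1)[OF h0 copula_on_props(3)[OF gS that]] by simp
      moreover have "0 < h i * ln (h i / g i) - ?a i"
        using mult_ln_ge[OF h0[of i] copula_on_props(3)[OF gS i(1)]] i(2) by linarith
      ultimately show ?thesis using i(1) by (intro sum_pos2[of S i]) auto
    qed
    finally have "divergence p g < divergence p h" by simp
    then show ?thesis using copula_on_props(2)[OF gS] pS True by (simp add: I_div_def)
  qed
qed

lemma I_proj_eqI:
  assumes "positive_on_S p" "stationary p g"
  shows "I_proj d r p = g"
  unfolding I_proj_def
proof (rule the_equality)
  have g: "g \<in> copula_arrays d r"
    using assms by (simp add: stationary_def copula_arrays_on_def)
  show "is_arg_min (\<lambda>g. I_div d r g p) (\<lambda>g. g \<in> copula_arrays d r) g"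
    using stationary_less_I_div[OF assms] g by (auto simp: is_arg_min_def) (metis order.asym)
  show "h = g" if "is_arg_min (\<lambda>g. I_div d r g p) (\<lambda>g. g \<in> copula_arrays d r) h" for h
    using stationary_less_I_div[OF assms] g that by (auto simp: is_arg_min_def)
qed

text \<open>A continuous function attains its minimum on the nonempty compact set \<open>K\<close>.
  At this stage the minimiser may still vanish at cells of \<open>S\<close>.\<close>

lemma divergence_minimiser_exists:
  assumes p: "\<And>i. i \<in> S \<Longrightarrow> 0 < p i"
  obtains g where "g \<in> copula_arrays d r" "Supp d r g \<subseteq> S"
    "\<And>h. h \<in> copula_arrays d r \<Longrightarrow> Supp d r h \<subseteq> S \<Longrightarrow> divergence p g \<le> divergence p h"
proof -
  define K :: "array set" where "K = {h. (\<forall>i. h i \<in> (if i \<in> S then {0..1} else {0})) \<and>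
    (\<forall>l\<in>{1..d}. \<forall>j\<in>{1..r l}. margin d r h l j = 1 / real (r l))}"
  have K_iff: "h \<in> K \<longleftrightarrow> h \<in> copula_arrays d r \<and> Supp d r h \<subseteq> S" for h
  proof
    assume h: "h \<in> K"
    then have out: "h i = 0" if "i \<notin> S" for i using that by (auto simp: K_def dest: spec[of _ i])
    have "h \<in> copula_arrays d r"
    proof (rule copula_arraysI[OF d_pos r_pos])
      show "h \<in> arrays d r" using out S_subset by (auto simp: arrays_def)
      show "0 \<le> h i" for i using h by (auto simp: K_def dest: spec[of _ i] split: if_splits)
    qed (use h in \<open>auto simp: K_def\<close>)
    then show "h \<in> copula_arrays d r \<and> Supp d r h \<subseteq> S" using out by (auto simp: Supp_def)
  next
    assume "h \<in> copula_arrays d r \<and> Supp d r h \<subseteq> S"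
    then show "h \<in> K"
      using S_subset by (auto simp: K_def copula_arrays_def prob_arrays_def Supp_def arrays_def)
  qed
  have "compact K"
    unfolding K_def by (rule compact_fixed_margin_arrays[OF S_subset])
  moreover have "K \<noteq> {}"
    using copulas_on_S K_iff by (auto simp: copula_arrays_on_def)
  moreover have "continuous_on K (divergence p)"
  proof (rule continuous_on_sum)
    fix i assume i: "i \<in> S"
    have "(\<lambda>h. h i) ` K \<subseteq> {0..}"
    proof
      fix y assume "y \<in> (\<lambda>h. h i) ` K"
      then obtain h where "h \<in> K" "y = h i" by blast
      then have "h i \<in> (if i \<in> S then {0..1} else {0})" "y = h i" unfolding K_def by blast+
      then show "y \<in> {0..}" using i by simp
    qed
    moreover have "continuous_on K (\<lambda>h. h i)"
      by (rule continuous_on_subset[OF continuous_on_product_coordinates]) simp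
    ultimately show "continuous_on K (\<lambda>h. h i * ln (h i / p i))"
      by (intro continuous_on_compose2[OF continuous_on_mult_ln_div[OF p[OF i]], where f = "\<lambda>h. h i"])
  qed
  ultimately obtain g where "g \<in> K" "\<And>h. h \<in> K \<Longrightarrow> divergence p g \<le> divergence p h"
    using continuous_attains_inf[of K "divergence p"] by blast
  then show ?thesis using that K_iff by blast
qed

text \<open>The slope of \<open>x ln x\<close> at \<open>0\<close> is \<open>-\<infinity>\<close>, so moving a boundary point towards an interior one
  decreases the divergence.\<close>

lemma divergence_minimiser_positive:
  assumes p: "\<And>i. i \<in> S \<Longrightarrow> 0 < p i" and g: "g \<in> copula_arrays d r" "Supp d r g \<subseteq> S"
    and min: "\<And>h. h \<in> copula_arrays d r \<Longrightarrow> Supp d r h \<subseteq> S \<Longrightarrow> divergence p g \<le> divergence p h"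
    and i: "i \<in> S"
  shows "g i \<noteq> 0"
proof
  assume gi: "g i = 0"
  obtain q where q: "q \<in> copula_arrays_on d r S" using copulas_on_S by blast
  have g0: "0 \<le> g i" for i
    using g by (cases "i \<in> index_set d r") (auto simp: copula_arrays_def prob_arrays_def arrays_def)
  \<comment> \<open>The mass that \<open>q\<close> puts on the zeros of \<open>g\<close>; these
    cells alone produce the term of order \<open>t * ln t\<close>.\<close>
  define c where "c = (\<Sum>i\<in>S. if g i = 0 then q i else 0)"
  have c: "0 < c"
    unfolding c_def using i gi copula_on_props[OF q] by (intro sum_pos2[of S i]) auto
  define B where "B = divergence p q - divergence p g"
  have key: "0 \<le> B + c * ln t" if t: "0 < t" "t < 1" for t
  proof -
    define h where "h = (\<lambda>i. g i + t * (q i - g i))"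
    have h_eq: "h i = (1 - t) * g i + t * q i" for i by (simp add: h_def algebra_simps)
    have a: "(\<lambda>i. q i - g i) \<in> Z"
      using copula_diff_in_zero_margin_space[OF copula_on_props(1)[OF q] g(1) _ g(2)]
        copula_on_props(2)[OF q] by simp
    have "0 \<le> h i" for i
      using t g0 copula_on_props(5)[OF q] by (simp add: h_eq)
    then have h: "h \<in> copula_arrays d r"
      unfolding h_def using copula_add_in_copula_arrays[OF g(1) a, of t] by simp
    have "Supp d r h \<subseteq> S"
      using g(2) zero_margin_outside[OF a] by (auto simp: h_def Supp_def)
    then have "divergence p g \<le> divergence p h" using min h by blast
    also have "\<dots> \<le> (\<Sum>i\<in>S. (1 - t) * (g i * ln (g i / p i)) + t * (q i * ln (q i / p i))
        + t * ln t * (if g i = 0 then q i else 0))"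
    proof (rule sum_mono)
      fix i assume i: "i \<in> S"
      note qi = copula_on_props(3)[OF q i]
      show "h i * ln (h i / p i) \<le> (1 - t) * (g i * ln (g i / p i)) + t * (q i * ln (q i / p i))
        + t * ln t * (if g i = 0 then q i else 0)"
      proof (cases "g i = 0")
        case True
        then show ?thesis
          using t qi p[OF i] by (simp add: h_eq ln_mult ln_div algebra_simps)
      next
        case False
        then show ?thesis
          using mult_ln_div_convex[OF g0 qi p[OF i] t, of i] by (simp add: h_eq)
      qed
    qed
    also have "\<dots> = (1 - t) * divergence p g + t * divergence p q + t * ln t * c"
      by (simp add: sum.distrib sum_distrib_left c_def)
    finally have "0 \<le> t * (B + c * ln t)" by (simp add: B_def algebra_simps)
    then show ?thesis using t by (simp add: zero_le_mult_iff)
  qed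
  \<comment> \<open>Chosen so that \<open>c * ln t\<close> outweighs \<open>B\<close> by at least 1,
    contradicting \<open>key\<close>.\<close>
  define t where "t = exp (- (\<bar>B\<bar> + 1) / c)"
  have "- (\<bar>B\<bar> + 1) / c < 0" using c by (intro divide_neg_pos) auto
  then have "0 < t" "t < 1" unfolding t_def by simp_all
  moreover have "c * ln t = - (\<bar>B\<bar> + 1)" using c by (simp add: t_def)
  ultimately show False using key[of t] by linarith
qed

text \<open>The minimiser charges all of \<open>S\<close>, so every direction of \<open>Z\<close>
  can be followed a little way both forwards and backwards, and the derivative at 0 has to
  vanish.\<close>

lemma stationary_exists:
  assumes "positive_on_S p"
  shows "\<exists>g. stationary p g"
proof -
  have p: "\<And>i. i \<in> S \<Longrightarrow> 0 < p i" using assms by (simp add: positive_on_S_def)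
  obtain g where g: "g \<in> copula_arrays d r" "Supp d r g \<subseteq> S"
    and min: "\<And>h. h \<in> copula_arrays d r \<Longrightarrow> Supp d r h \<subseteq> S \<Longrightarrow> divergence p g \<le> divergence p h"
    using divergence_minimiser_exists[of p] p by blast
  have "S \<subseteq> Supp d r g"
    using divergence_minimiser_positive[OF p g min] S_subset by (auto simp: Supp_def)
  then have gS: "g \<in> copula_arrays_on d r S"
    using g by (auto simp: copula_arrays_on_def)
  have "(\<Sum>i\<in>S. a i * ln (g i / p i)) = 0" if a: "a \<in> Z" for a
  proof -
    \<comment> \<open>A step below \<open>\<epsilon>\<close> keeps all entries on \<open>S\<close>
      nonnegative; the added 1 avoids a zero denominator where \<open>a i = 0\<close>.\<close>
    define \<epsilon> where "\<epsilon> = Min ((\<lambda>i. g i / (\<bar>a i\<bar> + 1)) ` S)"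
    have \<epsilon>: "0 < \<epsilon>"
      unfolding \<epsilon>_def using S_nonempty copula_on_props(3)[OF gS] by (subst Min_gr_iff) auto
    have le: "\<epsilon> * (\<bar>a i\<bar> + 1) \<le> g i" if "i \<in> S" for i
    proof -
      have "\<epsilon> \<le> g i / (\<bar>a i\<bar> + 1)" unfolding \<epsilon>_def using that by (intro Min_le) auto
      then show ?thesis by (simp add: pos_le_divide_eq)
    qed
    have "DERIV (\<lambda>t. divergence p (\<lambda>i. g i + t * a i)) 0 :>
        (\<Sum>i\<in>S. a i * ln (g i / p i) + a i)"
    proof (rule DERIV_sum)
      fix i assume i: "i \<in> S"
      show "DERIV (\<lambda>t. (g i + t * a i) * ln ((g i + t * a i) / p i)) 0 :>
          a i * ln (g i / p i) + a i"
        using copula_on_props(3)[OF gS i] p[OF i]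
        by (auto intro!: derivative_eq_intros simp: field_simps)
    qed
    moreover have "\<forall>t. \<bar>0 - t\<bar> < \<epsilon> \<longrightarrow>
        divergence p (\<lambda>i. g i + 0 * a i) \<le> divergence p (\<lambda>i. g i + t * a i)"
    proof (intro allI impI)
      fix t :: real assume t: "\<bar>0 - t\<bar> < \<epsilon>"
      have "0 \<le> g i + t * a i" if "i \<in> S" for i
      proof -
        have "\<bar>t * a i\<bar> \<le> \<epsilon> * (\<bar>a i\<bar> + 1)"
          unfolding abs_mult using t by (intro mult_mono) auto
        then show ?thesis using le[OF that] by linarith
      qed
      then have "(\<lambda>i. g i + t * a i) \<in> copula_arrays d r"
        using copula_add_in_copula_arrays[OF g(1) a] by blast
      moreover have "Supp d r (\<lambda>i. g i + t * a i) \<subseteq> S"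
        using g(2) zero_margin_outside[OF a] by (auto simp: Supp_def)
      ultimately show "divergence p (\<lambda>i. g i + 0 * a i) \<le> divergence p (\<lambda>i. g i + t * a i)"
        using min by simp
    qed
    ultimately have "(\<Sum>i\<in>S. a i * ln (g i / p i) + a i) = 0"
      by (intro DERIV_local_min[where f = "\<lambda>t. divergence p (\<lambda>i. g i + t * a i)" and x = 0, OF _ \<epsilon>])
    then show ?thesis using sum_zero_margin_space[OF a] by (simp add: sum.distrib)
  qed
  then show ?thesis using gS by (auto simp: stationary_def)
qed

lemma stationary_I_proj:
  assumes "positive_on_S p"
  shows "stationary p (I_proj d r p)"
  using stationary_exists[OF assms] I_proj_eqI[OF assms] by auto

end

subsection \<open>From one-dimensional characteristic functions to the chi-square law\<close>

lemma (in prob_space) indep_sets_reindex: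
  assumes "inj_on f J" "indep_sets F (f ` J)"
  shows "indep_sets (\<lambda>j. F (f j)) J"
proof (rule indep_setsI)
  show "F (f j) \<subseteq> events" if "j \<in> J" for j
    using assms(2) that by (auto simp: indep_sets_def)
next
  fix A K assume K: "K \<noteq> {}" "K \<subseteq> J" "finite K" and A: "\<forall>j\<in>K. A j \<in> F (f j)"
  have inj: "inj_on f K" using assms(1) K(2) by (rule inj_on_subset)
  define B where "B = (\<lambda>l. A (the_inv_into K f l))"
  have B: "B (f j) = A j" if "j \<in> K" for j
    using that inj by (simp add: B_def the_inv_into_f_f)
  have "prob (\<Inter>l\<in>f ` K. B l) = (\<Prod>l\<in>f ` K. prob (B l))"
    using assms(2) K A B by (intro indep_setsD[OF assms(2)]) auto
  then show "prob (\<Inter>j\<in>K. A j) = (\<Prod>j\<in>K. prob (A j))"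
    using B by (simp add: prod.reindex[OF inj] image_image)
qed

text \<open>Used to pass from a sample numbered from 1 to the sequence numbered from 0 in the
  central limit theorem.\<close>

lemma (in prob_space) indep_vars_reindex:
  assumes "inj_on f J" "indep_vars M' X (f ` J)"
  shows "indep_vars (\<lambda>j. M' (f j)) (\<lambda>j. X (f j)) J"
  using assms indep_sets_reindex[OF assms(1)] by (auto simp: indep_vars_def2)

lemma norm_iexp_diff_le: "cmod (iexp a - iexp b) \<le> \<bar>a - b\<bar>"
proof -
  have "iexp a - iexp b = iexp b * (iexp (a - b) - 1)"
    by (simp add: algebra_simps flip: exp_add)
  then have "cmod (iexp a - iexp b) = cmod (iexp (a - b) - 1)"
    by (simp add: norm_mult)
  also have "\<dots> \<le> \<bar>a - b\<bar>"
    using iexp_approx1[of "a - b" 0] by simp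
  finally show ?thesis .
qed

lemma norm_iexp_diff_le_2: "cmod (iexp a - iexp b) \<le> 2"
  using norm_triangle_ineq4[of "iexp a" "iexp b"] by simp

text \<open>The standardised sums converge weakly, hence so do their characteristic functions;
  evaluating at the standard deviation \<open>\<sigma>\<close> undoes the standardisation.\<close>

lemma (in prob_space) clt_characteristic_function:
  fixes Y :: "nat \<Rightarrow> 'a \<Rightarrow> real"
  assumes indep: "indep_vars (\<lambda>_. borel) Y {1..}"
    and distr: "\<And>k. 1 \<le> k \<Longrightarrow> distr M borel (Y k) = \<mu>"
    and mean: "\<And>k. 1 \<le> k \<Longrightarrow> expectation (Y k) = 0"
    and sq: "\<And>k. 1 \<le> k \<Longrightarrow> integrable M (\<lambda>\<omega>. (Y k \<omega>)\<^sup>2)"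
    and var: "\<And>k. 1 \<le> k \<Longrightarrow> expectation (\<lambda>\<omega>. (Y k \<omega>)\<^sup>2) = v" and "0 < v"
  shows "(\<lambda>n. CLINT \<omega>|M. iexp ((\<Sum>k=1..n. Y k \<omega>) / sqrt (real n))) \<longlonglongrightarrow> complex_of_real (exp (- v / 2))"
proof -
  define \<sigma> where "\<sigma> = sqrt v"
  have \<sigma>: "0 < \<sigma>" "\<sigma>\<^sup>2 = v" using \<open>0 < v\<close> by (auto simp: \<sigma>_def)
  define X where "X = (\<lambda>i. Y (Suc i))"
  have rv: "random_variable borel (Y k)" if "1 \<le> k" for k
    using indep that by (auto simp: indep_vars_def)
  have "range Suc = {1..}"
    by (auto simp: image_iff Suc_le_eq dest: gr0_implies_Suc)
  then have "indep_vars (\<lambda>_. borel) X UNIV"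
    unfolding X_def using indep_vars_reindex[of Suc UNIV "\<lambda>_. borel" Y] indep by simp
  then have "weak_conv_m (\<lambda>n. distr M borel (\<lambda>x. (\<Sum>i<n. X i x) / sqrt (real n * \<sigma>\<^sup>2)))
      std_normal_distribution"
    using \<sigma> mean sq var distr
    by (intro central_limit_theorem_zero_mean[where \<mu> = \<mu>]) (auto simp: X_def)
  moreover have [measurable]: "random_variable borel (\<lambda>x. \<Sum>i<n. X i x)" for n
    using rv by (auto simp: X_def)
  ultimately have lim: "(\<lambda>n. char (distr M borel (\<lambda>x. (\<Sum>i<n. X i x) / sqrt (real n * \<sigma>\<^sup>2))) \<sigma>)
      \<longlonglongrightarrow> char std_normal_distribution \<sigma>"
    by (intro levy_continuity1 real_distribution_distr real_dist_normal_dist) auto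
  have "char (distr M borel (\<lambda>x. (\<Sum>i<n. X i x) / sqrt (real n * \<sigma>\<^sup>2))) \<sigma>
      = (CLINT \<omega>|M. iexp ((\<Sum>k=1..n. Y k \<omega>) / sqrt (real n)))" for n
  proof -
    have "\<sigma> * ((\<Sum>i<n. X i \<omega>) / sqrt (real n * \<sigma>\<^sup>2)) = (\<Sum>k=1..n. Y k \<omega>) / sqrt (real n)" for \<omega>
      using \<sigma>(1) by (simp add: X_def real_sqrt_mult sum.atLeast1_atMost_eq)
    then show ?thesis
      unfolding char_def by (subst integral_distr) auto
  qed
  then show ?thesis using lim \<sigma>(2) by (simp add: char_std_normal_distribution)
qed

abbreviation std_gaussian :: "nat \<Rightarrow> (nat \<Rightarrow> real) measure" where
  "std_gaussian m \<equiv> \<Pi>\<^sub>M j\<in>{..<m}. std_normal_distribution"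

lemma prob_space_std_gaussian: "prob_space (std_gaussian m)"
  by (intro prob_space_PiM prob_space_normal_density) simp

lemma measurable_std_gaussian_component [measurable]:
  "j < m \<Longrightarrow> (\<lambda>z. z j) \<in> borel_measurable (std_gaussian m)"
  by (rule measurable_compose[OF measurable_component_singleton[of j "{..<m}"]]) simp_all

lemma std_gaussian_characteristic_function:
  "(CLINT z|std_gaussian m. iexp (\<Sum>j<m. w j * z j)) = complex_of_real (exp (- (\<Sum>j<m. (w j)\<^sup>2) / 2))"
proof -
  interpret N: prob_space std_normal_distribution by (rule prob_space_normal_density) simp
  interpret product_sigma_finite "\<lambda>_::nat. std_normal_distribution" ..
  have "(CLINT z|std_gaussian m. iexp (\<Sum>j<m. w j * z j))
      = (CLINT z|std_gaussian m. (\<Prod>j<m. iexp (w j * z j)))"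
    by (simp add: exp_sum sum_distrib_left flip: of_real_mult)
  also have "\<dots> = (\<Prod>j<m. CLINT x|std_normal_distribution. iexp (w j * x))"
    by (intro product_integral_prod N.integrable_iexp) auto
  also have "\<dots> = (\<Prod>j<m. complex_of_real (exp (- (w j)\<^sup>2 / 2)))"
    using char_std_normal_distribution by (simp add: char_def fun_eq_iff)
  also have "\<dots> = complex_of_real (exp (- (\<Sum>j<m. (w j)\<^sup>2) / 2))"
    by (simp add: sum_negf[symmetric] sum_divide_distrib exp_sum flip: of_real_prod)
  finally show ?thesis .
qed

text \<open>By the Gaussian identity \<open>exp (- s |w|\<^sup>2) = E exp (i sqrt (2 s) w \<bullet> Z)\<close>, one-dimensional
  characteristic functions of the projections control the Laplace transform of \<open>|W|\<^sup>2\<close>, which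
  makes a multivariate central limit theorem unnecessary.\<close>

lemma (in prob_space) laplace_sum_squares_tendsto:
  fixes W :: "nat \<Rightarrow> 'a \<Rightarrow> nat \<Rightarrow> real"
  assumes rv: "\<And>n j. j < m \<Longrightarrow> random_variable borel (\<lambda>\<omega>. W n \<omega> j)"
    and lim: "\<And>z. (\<lambda>n. CLINT \<omega>|M. iexp (\<Sum>j<m. z j * W n \<omega> j))
        \<longlonglongrightarrow> complex_of_real (exp (- (\<Sum>j<m. (z j)\<^sup>2) / 2))"
    and s: "0 \<le> s"
  shows "(\<lambda>n. expectation (\<lambda>\<omega>. exp (- s * (\<Sum>j<m. (W n \<omega> j)\<^sup>2))))
      \<longlonglongrightarrow> (LINT z|std_gaussian m. exp (- s * (\<Sum>j<m. (z j)\<^sup>2)))"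
proof -
  \<comment> \<open>With \<open>t\<^sup>2 / 2 = s\<close>, scaling by \<open>t\<close> turns the
    Gaussian characteristic function into \<open>exp (- s * _)\<close>. This is used twice: for the
    integral over \<open>z\<close> at fixed \<open>W\<close>, and for the limit at fixed
    \<open>z\<close>.\<close>
  define t where "t = sqrt (2 * s)"
  have t: "t\<^sup>2 = 2 * s" using s by (simp add: t_def)
  note total = prob_space
  interpret G: prob_space "std_gaussian m" by (rule prob_space_std_gaussian)
  interpret pair_prob_space M "std_gaussian m" ..
  note rv[measurable]
  have eq: "complex_of_real (LINT \<omega>|M. exp (- s * (\<Sum>j<m. (W n \<omega> j)\<^sup>2)))
      = (CLINT z|std_gaussian m. CLINT \<omega>|M. iexp (\<Sum>j<m. (t * z j) * W n \<omega> j))" for n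
  proof -
    have "complex_of_real (exp (- s * (\<Sum>j<m. (W n \<omega> j)\<^sup>2)))
        = (CLINT z|std_gaussian m. iexp (\<Sum>j<m. (t * z j) * W n \<omega> j))" for \<omega>
    proof -
      have "(CLINT z|std_gaussian m. iexp (\<Sum>j<m. (t * z j) * W n \<omega> j))
          = (CLINT z|std_gaussian m. iexp (\<Sum>j<m. (t * W n \<omega> j) * z j))"
        by (simp add: mult.commute mult.left_commute)
      also have "\<dots> = complex_of_real (exp (- (\<Sum>j<m. (t * W n \<omega> j)\<^sup>2) / 2))"
        by (rule std_gaussian_characteristic_function)
      also have "(\<Sum>j<m. (t * W n \<omega> j)\<^sup>2) = 2 * s * (\<Sum>j<m. (W n \<omega> j)\<^sup>2)"
        by (simp add: power_mult_distrib t sum_distrib_left)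
      finally show ?thesis by simp
    qed
    then have "complex_of_real (LINT \<omega>|M. exp (- s * (\<Sum>j<m. (W n \<omega> j)\<^sup>2)))
        = (CLINT \<omega>|M. CLINT z|std_gaussian m. iexp (\<Sum>j<m. (t * z j) * W n \<omega> j))"
      by (simp flip: integral_complex_of_real)
    \<comment> \<open>After the exchange, the inner integral is what \<open>lim\<close> controls for
      each fixed \<open>z\<close>, and it is bounded by 1.\<close>
    also have "\<dots> = (CLINT z|std_gaussian m. CLINT \<omega>|M. iexp (\<Sum>j<m. (t * z j) * W n \<omega> j))"
    proof (rule Fubini_integral[symmetric])
      show "integrable (M \<Otimes>\<^sub>M std_gaussian m)
          (case_prod (\<lambda>\<omega> z. iexp (\<Sum>j<m. (t * z j) * W n \<omega> j)))"
      proof (rule P.integrable_const_bound[of _ 1])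
        have "(\<lambda>x. \<Sum>j<m. (t * snd x j) * W n (fst x) j) \<in> borel_measurable (M \<Otimes>\<^sub>M std_gaussian m)"
        proof (rule borel_measurable_sum)
          fix j assume "j \<in> {..<m}"
          then have [measurable]: "(\<lambda>z. z j) \<in> borel_measurable (std_gaussian m)"
            "(\<lambda>\<omega>. W n \<omega> j) \<in> borel_measurable M" by auto
          show "(\<lambda>x. (t * snd x j) * W n (fst x) j) \<in> borel_measurable (M \<Otimes>\<^sub>M std_gaussian m)"
            by measurable
        qed
        then show "(case_prod (\<lambda>\<omega> z. iexp (\<Sum>j<m. (t * z j) * W n \<omega> j)))
            \<in> borel_measurable (M \<Otimes>\<^sub>M std_gaussian m)"
          by (simp add: case_prod_beta')
      qed auto
    qed
    finally show ?thesis .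
  qed
  have "(\<lambda>n. CLINT z|std_gaussian m. CLINT \<omega>|M. iexp (\<Sum>j<m. (t * z j) * W n \<omega> j))
      \<longlonglongrightarrow> (CLINT z|std_gaussian m. complex_of_real (exp (- s * (\<Sum>j<m. (z j)\<^sup>2))))"
  proof (rule integral_dominated_convergence[where w = "\<lambda>_. 1"])
    show "(\<lambda>z. complex_of_real (exp (- s * (\<Sum>j<m. (z j)\<^sup>2)))) \<in> borel_measurable (std_gaussian m)"
      by measurable
    show "(\<lambda>z. CLINT \<omega>|M. iexp (\<Sum>j<m. (t * z j) * W n \<omega> j)) \<in> borel_measurable (std_gaussian m)" for n
    proof (rule sigma_finite_measure.borel_measurable_lebesgue_integral)
      show "sigma_finite_measure M" by unfold_locales
      have "(\<lambda>x. \<Sum>j<m. (t * fst x j) * W n (snd x) j) \<in> borel_measurable (std_gaussian m \<Otimes>\<^sub>M M)"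
      proof (rule borel_measurable_sum)
        fix j assume "j \<in> {..<m}"
        then have [measurable]: "(\<lambda>z. z j) \<in> borel_measurable (std_gaussian m)"
          "(\<lambda>\<omega>. W n \<omega> j) \<in> borel_measurable M" by auto
        show "(\<lambda>x. (t * fst x j) * W n (snd x) j) \<in> borel_measurable (std_gaussian m \<Otimes>\<^sub>M M)"
          by measurable
      qed
      then show "(\<lambda>(z, \<omega>). iexp (\<Sum>j<m. (t * z j) * W n \<omega> j)) \<in> borel_measurable (std_gaussian m \<Otimes>\<^sub>M M)"
        by (simp add: case_prod_beta')
    qed
    show "integrable (std_gaussian m) (\<lambda>_. 1::real)" by simp
    show "AE z in std_gaussian m. (\<lambda>n. CLINT \<omega>|M. iexp (\<Sum>j<m. (t * z j) * W n \<omega> j))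
        \<longlonglongrightarrow> complex_of_real (exp (- s * (\<Sum>j<m. (z j)\<^sup>2)))"
    proof (rule AE_I2)
      fix z
      have "(\<Sum>j<m. (t * z j)\<^sup>2) = 2 * s * (\<Sum>j<m. (z j)\<^sup>2)"
        by (simp add: power_mult_distrib t sum_distrib_left)
      then show "(\<lambda>n. CLINT \<omega>|M. iexp (\<Sum>j<m. (t * z j) * W n \<omega> j))
        \<longlonglongrightarrow> complex_of_real (exp (- s * (\<Sum>j<m. (z j)\<^sup>2)))"
        using lim[of "\<lambda>j. t * z j"] by simp
    qed
    show "AE z in std_gaussian m. cmod (CLINT \<omega>|M. iexp (\<Sum>j<m. (t * z j) * W n \<omega> j)) \<le> 1" for n
    proof (rule AE_I2)
      fix z
      have "cmod (CLINT \<omega>|M. iexp (\<Sum>j<m. (t * z j) * W n \<omega> j))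
          \<le> (LINT \<omega>|M. cmod (iexp (\<Sum>j<m. (t * z j) * W n \<omega> j)))"
        by (rule integral_norm_bound)
      then show "cmod (CLINT \<omega>|M. iexp (\<Sum>j<m. (t * z j) * W n \<omega> j)) \<le> 1"
        by (simp add: total)
    qed
  qed
  then have "(\<lambda>n. complex_of_real (LINT \<omega>|M. exp (- s * (\<Sum>j<m. (W n \<omega> j)\<^sup>2))))
      \<longlonglongrightarrow> complex_of_real (LINT z|std_gaussian m. exp (- s * (\<Sum>j<m. (z j)\<^sup>2)))"
    by (simp only: eq integral_complex_of_real)
  then show ?thesis by (simp only: tendsto_of_real_iff)
qed

text \<open>Interchange of limits. Here \<open>b\<close> will consist of expectations of a
  polynomial in \<open>exp (- T n)\<close> that is uniformly close to the test function.\<close>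

lemma LIMSEQ_uniform_approximation:
  fixes a :: "nat \<Rightarrow> real"
  assumes "\<And>\<epsilon>. 0 < \<epsilon> \<Longrightarrow> \<exists>b l'. b \<longlonglongrightarrow> l' \<and> (\<forall>n. \<bar>a n - b n\<bar> \<le> \<epsilon>) \<and> \<bar>l - l'\<bar> \<le> \<epsilon>"
  shows "a \<longlonglongrightarrow> l"
proof (rule LIMSEQ_I)
  fix e :: real assume e: "0 < e"
  obtain b l' where b: "b \<longlonglongrightarrow> l'" "\<And>n. \<bar>a n - b n\<bar> \<le> e / 4" "\<bar>l - l'\<bar> \<le> e / 4"
    using assms[of "e / 4"] e by auto
  obtain N where N: "\<And>n. n \<ge> N \<Longrightarrow> norm (b n - l') < e / 4"
    using LIMSEQ_D[OF b(1), of "e / 4"] e by auto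
  have "norm (a n - l) < e" if "n \<ge> N" for n
    using N[OF that] b(2)[of n] b(3) e unfolding real_norm_def by linarith
  then show "\<exists>N. \<forall>n\<ge>N. norm (a n - l) < e" by blast
qed

text \<open>Laplace transforms at the natural numbers are the moments of \<open>exp (- T)\<close>, so the
  Weierstrass approximation theorem on the unit interval applies.\<close>

lemma (in prob_space) weak_conv_if_laplace_tendsto:
  fixes T :: "nat \<Rightarrow> 'a \<Rightarrow> real"
  assumes rv: "\<And>n. random_variable borel (T n)" and T: "\<And>n \<omega>. 0 \<le> T n \<omega>"
    and \<mu>: "real_distribution \<mu>" "AE x in \<mu>. 0 \<le> x"
    and lim: "\<And>k::nat. (\<lambda>n. expectation (\<lambda>\<omega>. exp (- real k * T n \<omega>))) \<longlonglongrightarrow> (LINT x|\<mu>. exp (- real k * x))"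
  shows "weak_conv_m (\<lambda>n. distr M borel (T n)) \<mu>"
proof (rule integral_cts_step_conv_imp_weak_conv)
  interpret \<mu>: real_distribution \<mu> by fact
  note rv[measurable]
  show "real_distribution (distr M borel (T n))" for n by (intro real_distribution_distr rv)
  show "real_distribution \<mu>" by fact
  fix a b :: real assume ab: "a < b"
  define f where "f = cts_step a b"
  have cont: "continuous_on UNIV f"
    unfolding f_def using cts_step_uniformly_continuous[OF ab] uniformly_continuous_imp_continuous by blast
  have [measurable]: "f \<in> borel_measurable borel"
    using cont by (rule borel_measurable_continuous_onI)
  have f1: "\<bar>f x\<bar> \<le> 1" for x using ab by (auto simp: f_def cts_step_def)
  \<comment> \<open>The test function in the variable \<open>y = exp (- x)\<close>. Truncating at
    \<open>exp (- b)\<close> makes it continuous at \<open>y = 0\<close> and changes nothing, since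
    \<open>cts_step a b\<close> vanishes beyond \<open>b\<close>.\<close>
  define g where "g = (\<lambda>y. f (- ln (max y (exp (- b)))))"
  have gf: "g (exp (- x)) = f x" for x
  proof (cases "x \<le> b")
    case True
    then show ?thesis by (simp add: g_def max_def)
  next
    case False
    then show ?thesis using ab by (simp add: g_def max_def f_def cts_step_def)
  qed
  have "continuous_on {0..1} g"
  proof -
    have "0 < max y (exp (- b))" for y by (simp add: less_max_iff_disj)
    then have "continuous_on {0..1} (\<lambda>y. - ln (max y (exp (- b))))"
      by (intro continuous_intros) (metis less_irrefl)
    then show ?thesis
      unfolding g_def by (rule continuous_on_compose2[OF cont]) simp
  qed
  note sw = Stone_Weierstrass_real_polynomial_function[OF compact_Icc this]
  have "(\<lambda>n. expectation (\<lambda>\<omega>. f (T n \<omega>))) \<longlonglongrightarrow> integral\<^sup>L \<mu> f"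
  proof (rule LIMSEQ_uniform_approximation)
    fix \<epsilon> :: real assume "0 < \<epsilon>"
    from sw[OF this] obtain q where q: "real_polynomial_function q"
      and qg: "\<And>y. y \<in> {0..1} \<Longrightarrow> \<bar>g y - q y\<bar> < \<epsilon>" by blast
    obtain c N where c: "q = (\<lambda>y. \<Sum>k\<le>N. c k * y ^ k)"
      using q by (auto simp: real_polynomial_function_iff_sum)
    have q_exp: "q (exp (- x)) = (\<Sum>k\<le>N. c k * exp (- real k * x))" for x
      by (simp add: c exp_of_nat_mult[symmetric])
    have fq: "\<bar>f x - q (exp (- x))\<bar> \<le> \<epsilon>" if "0 \<le> x" for x
      using qg[of "exp (- x)"] that by (simp add: gf less_imp_le)
    have int_T: "integrable M (\<lambda>\<omega>. exp (- real k * T n \<omega>))" for k n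
      by (rule integrable_const_bound[of _ 1]) (auto simp: T)
    have int_\<mu>: "integrable \<mu> (\<lambda>x. exp (- real k * x))" for k
      by (rule \<mu>.integrable_const_bound[of _ 1]) (use \<mu>(2) in auto)
    have int_fT: "integrable M (\<lambda>\<omega>. f (T n \<omega>))" for n
      by (rule integrable_const_bound[of _ 1]) (auto simp: f1)
    have int_f\<mu>: "integrable \<mu> f"
      by (rule \<mu>.integrable_const_bound[of _ 1]) (auto simp: f1)
    have int_qT: "integrable M (\<lambda>\<omega>. q (exp (- T n \<omega>)))" for n
      unfolding q_exp by (intro Bochner_Integration.integrable_sum integrable_mult_right int_T)
    have int_q\<mu>: "integrable \<mu> (\<lambda>x. q (exp (- x)))"
      unfolding q_exp by (intro Bochner_Integration.integrable_sum integrable_mult_right int_\<mu>)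
    have "(\<lambda>n. expectation (\<lambda>\<omega>. q (exp (- T n \<omega>)))) = (\<lambda>n. \<Sum>k\<le>N. c k * expectation (\<lambda>\<omega>. exp (- real k * T n \<omega>)))"
      unfolding q_exp using int_T by (simp add: Bochner_Integration.integral_sum)
    also have "\<dots> \<longlonglongrightarrow> (\<Sum>k\<le>N. c k * (LINT x|\<mu>. exp (- real k * x)))"
      by (intro tendsto_sum tendsto_mult_left lim)
    finally have "(\<lambda>n. expectation (\<lambda>\<omega>. q (exp (- T n \<omega>))))
        \<longlonglongrightarrow> (\<Sum>k\<le>N. c k * (LINT x|\<mu>. exp (- real k * x)))" .
    moreover have "(\<Sum>k\<le>N. c k * (LINT x|\<mu>. exp (- real k * x))) = (LINT x|\<mu>. q (exp (- x)))"
      unfolding q_exp using int_\<mu> by (simp add: Bochner_Integration.integral_sum)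
    ultimately have 1: "(\<lambda>n. expectation (\<lambda>\<omega>. q (exp (- T n \<omega>)))) \<longlonglongrightarrow> (LINT x|\<mu>. q (exp (- x)))" by simp
    have 2: "\<bar>expectation (\<lambda>\<omega>. f (T n \<omega>)) - expectation (\<lambda>\<omega>. q (exp (- T n \<omega>)))\<bar> \<le> \<epsilon>" for n
    proof -
      have "\<bar>expectation (\<lambda>\<omega>. f (T n \<omega>)) - expectation (\<lambda>\<omega>. q (exp (- T n \<omega>)))\<bar>
          = \<bar>expectation (\<lambda>\<omega>. f (T n \<omega>) - q (exp (- T n \<omega>)))\<bar>"
        using int_fT int_qT by simp
      also have "\<dots> \<le> expectation (\<lambda>\<omega>. \<bar>f (T n \<omega>) - q (exp (- T n \<omega>))\<bar>)"
        by (rule integral_abs_bound)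
      also have "\<dots> \<le> expectation (\<lambda>\<omega>. \<epsilon>)"
        using int_fT int_qT fq[OF T] by (intro integral_mono) auto
      finally show ?thesis by (simp add: prob_space)
    qed
    have "\<bar>integral\<^sup>L \<mu> f - (LINT x|\<mu>. q (exp (- x)))\<bar> = \<bar>LINT x|\<mu>. f x - q (exp (- x))\<bar>"
      using int_f\<mu> int_q\<mu> by simp
    also have "\<dots> \<le> (LINT x|\<mu>. \<bar>f x - q (exp (- x))\<bar>)"
      by (rule integral_abs_bound)
    also have "\<dots> \<le> (LINT x|\<mu>. \<epsilon>)"
      using int_f\<mu> int_q\<mu> fq \<mu>(2) by (intro integral_mono_AE) auto
    finally have "\<bar>integral\<^sup>L \<mu> f - (LINT x|\<mu>. q (exp (- x)))\<bar> \<le> \<epsilon>"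
      using \<mu>.prob_space by simp
    then show "\<exists>b l'. b \<longlonglongrightarrow> l' \<and> (\<forall>n. \<bar>expectation (\<lambda>\<omega>. f (T n \<omega>)) - b n\<bar> \<le> \<epsilon>) \<and> \<bar>integral\<^sup>L \<mu> f - l'\<bar> \<le> \<epsilon>"
      using 1 2 by blast
  qed
  then show "(\<lambda>n. integral\<^sup>L (distr M borel (T n)) (cts_step a b)) \<longlonglongrightarrow> integral\<^sup>L \<mu> (cts_step a b)"
    unfolding f_def[symmetric] by (subst integral_distr) auto
qed

text \<open>\<open>chi_square m\<close> is the image of \<open>std_gaussian m\<close> under the sum
  of squares, so the limit in \<open>laplace_sum_squares_tendsto\<close> is its Laplace
  transform.\<close>

lemma (in prob_space) sum_squares_weak_conv_chi_square:
  fixes W :: "nat \<Rightarrow> 'a \<Rightarrow> nat \<Rightarrow> real"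
  assumes rv: "\<And>n j. j < m \<Longrightarrow> random_variable borel (\<lambda>\<omega>. W n \<omega> j)"
    and lim: "\<And>z. (\<lambda>n. CLINT \<omega>|M. iexp (\<Sum>j<m. z j * W n \<omega> j))
        \<longlonglongrightarrow> complex_of_real (exp (- (\<Sum>j<m. (z j)\<^sup>2) / 2))"
  shows "weak_conv_m (\<lambda>n. distr M borel (\<lambda>\<omega>. \<Sum>j<m. (W n \<omega> j)\<^sup>2)) (chi_square m)"
proof (rule weak_conv_if_laplace_tendsto)
  interpret G: prob_space "std_gaussian m" by (rule prob_space_std_gaussian)
  have [measurable]: "(\<lambda>z. \<Sum>j<m. (z j)\<^sup>2) \<in> borel_measurable (std_gaussian m)"
    by (intro borel_measurable_sum borel_measurable_power) auto
  show "random_variable borel (\<lambda>\<omega>. \<Sum>j<m. (W n \<omega> j)\<^sup>2)" for n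
    using rv by (intro borel_measurable_sum borel_measurable_power) auto
  show "0 \<le> (\<Sum>j<m. (W n \<omega> j)\<^sup>2)" for n \<omega> by (simp add: sum_nonneg)
  show "real_distribution (chi_square m)"
    unfolding chi_square_def by (rule G.real_distribution_distr) measurable
  show "AE x in chi_square m. 0 \<le> x"
    unfolding chi_square_def by (subst AE_distr_iff) (auto simp: sum_nonneg)
  show "(\<lambda>n. expectation (\<lambda>\<omega>. exp (- real k * (\<Sum>j<m. (W n \<omega> j)\<^sup>2))))
      \<longlonglongrightarrow> (LINT x|chi_square m. exp (- real k * x))" for k
    unfolding chi_square_def using laplace_sum_squares_tendsto[OF rv lim, of "real k"]
    by (subst integral_distr) auto
qed

subsection \<open>Coordinates and quasi-independence\<close>

lemma sum_array_scale_apply: "(\<Sum>k\<in>K. array_scale (c k) (b k)) i = (\<Sum>k\<in>K. c k * b k i)"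
  by (induction K rule: infinite_finite_induct) (auto simp: array_scale_def)

text \<open>Pairing with the indicators \<open>b (l, j)\<close> computes the margins, so
  \<open>Z\<close> is their annihilator on \<open>S\<close>. Orthogonality to \<open>Z\<close>
  therefore puts \<open>ln p\<close> into their span on \<open>S\<close>, and the exponentials of
  the coefficients are the positive factors.\<close>

lemma (in copula_support) quasi_independent_iff_orthogonal:
  assumes p: "positive_on_S p" and arr: "p \<in> arrays d r"
  shows "quasi_independent d r p \<longleftrightarrow> (\<forall>a\<in>Z. (\<Sum>i\<in>S. a i * ln (p i)) = 0)"
proof
  have pS: "Supp d r p = S" "\<And>i. i \<in> S \<Longrightarrow> 0 < p i"
    using p by (auto simp: positive_on_S_def)
  have S_comp: "i l \<in> {1..r l}" if "i \<in> S" "l \<in> {1..d}" for i l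
    using index_set_component[of i d r l] that S_subset by blast
  show "\<forall>a\<in>Z. (\<Sum>i\<in>S. a i * ln (p i)) = 0" if qi: "quasi_independent d r p"
  proof
    fix a assume a: "a \<in> Z"
    obtain \<beta> :: "nat \<Rightarrow> nat \<Rightarrow> real"
      where \<beta>: "\<forall>l\<in>{1..d}. \<forall>j\<in>{1..r l}. 0 < \<beta> l j"
        and eq: "\<forall>i\<in>index_set d r. p i = (\<Prod>l=1..d. \<beta> l (i l)) * indicator (Supp d r p) i"
      using qi unfolding quasi_independent_def by blast
    have "ln (p i) = (\<Sum>l=1..d. ln (\<beta> l (i l)))" if "i \<in> S" for i
    proof -
      have "p i = (\<Prod>l=1..d. \<beta> l (i l))" using bspec[OF eq, of i] that pS S_subset by auto
      moreover have "0 < \<beta> l (i l)" if "l \<in> {1..d}" for l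
        using \<beta> S_comp[OF \<open>i \<in> S\<close> that] that by blast
      then have "\<beta> l (i l) \<noteq> 0" if "l \<in> {1..d}" for l
        using that by (metis less_irrefl)
      then have "ln (\<Prod>l=1..d. \<beta> l (i l)) = (\<Sum>l=1..d. ln (\<beta> l (i l)))"
        by (rule ln_prod[OF finite_atLeastAtMost])
      ultimately show ?thesis by simp
    qed
    then have "(\<Sum>i\<in>S. a i * ln (p i)) = (\<Sum>i\<in>S. \<Sum>l=1..d. a i * ln (\<beta> l (i l)))"
      by (simp add: sum_distrib_left)
    also have "\<dots> = (\<Sum>l=1..d. \<Sum>i\<in>S. a i * ln (\<beta> l (i l)))"
      by (rule sum.swap)
    also have "\<dots> = 0"
      by (rule sum.neutral, rule ballI, rule sum_zero_margin[OF a])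
    finally show "(\<Sum>i\<in>S. a i * ln (p i)) = 0" .
  qed
  show "quasi_independent d r p" if orth: "\<forall>a\<in>Z. (\<Sum>i\<in>S. a i * ln (p i)) = 0"
  proof -
    define K where "K = (SIGMA l:{1..d}. {1..r l})"
    define b :: "nat \<times> nat \<Rightarrow> multi_index \<Rightarrow> real"
      where "b = (\<lambda>(l, j) i. if i l = j then 1 else 0)"
    have "\<exists>c. \<forall>i\<in>S. ln (p i) = (\<Sum>k\<in>K. c k * b k i)"
    proof (rule in_span_if_orthogonal_to_annihilator)
      show "finite K" by (simp add: K_def)
      fix a :: array
      assume ann: "\<And>k. k \<in> K \<Longrightarrow> (\<Sum>i\<in>S. a i * b k i) = 0"
      \<comment> \<open>The annihilator condition concerns \<open>S\<close> only, whereas members of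
        \<open>Z\<close> have to vanish off \<open>S\<close>.\<close>
      define a' where "a' = (\<lambda>i. if i \<in> S then a i else 0)"
      have "a' \<in> Z"
      proof -
        have "margin d r a' l j = 0" if "l \<in> {1..d}" "j \<in> {1..r l}" for l j
        proof -
          have "margin d r a' l j = (\<Sum>i\<in>index_set d r. a' i * b (l, j) i)"
            unfolding margin_def by (intro sum.mono_neutral_cong_left) (auto simp: b_def)
          also have "\<dots> = (\<Sum>i\<in>S. a i * b (l, j) i)"
            using S_subset by (intro sum.mono_neutral_cong_right) (auto simp: a'_def)
          also have "\<dots> = 0" using that by (intro ann) (auto simp: K_def)
          finally show ?thesis .
        qed
        then show ?thesis
          using S_subset by (auto simp: zero_margin_space_def arrays_def Supp_def a'_def)
      qed
      then have "(\<Sum>i\<in>S. a' i * ln (p i)) = 0" using orth by blast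
      then show "(\<Sum>i\<in>S. a i * ln (p i)) = 0" by (simp add: a'_def)
    qed simp
    then obtain c where c: "\<And>i. i \<in> S \<Longrightarrow> ln (p i) = (\<Sum>k\<in>K. c k * b k i)" by blast
    have "p i = (\<Prod>l=1..d. exp (c (l, i l)))" if i: "i \<in> S" for i
    proof -
      have "(\<Sum>k\<in>K. c k * b k i) = (\<Sum>l=1..d. \<Sum>j=1..r l. c (l, j) * b (l, j) i)"
        unfolding K_def by (subst sum.Sigma) (auto simp: case_prod_beta')
      also have "\<dots> = (\<Sum>l=1..d. c (l, i l))"
      proof (intro sum.cong refl)
        fix l assume "l \<in> {1..d}"
        have "(\<Sum>j=1..r l. c (l, j) * b (l, j) i) = (\<Sum>j=1..r l. if j = i l then c (l, i l) else 0)"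
          by (intro sum.cong) (auto simp: b_def)
        then show "(\<Sum>j=1..r l. c (l, j) * b (l, j) i) = c (l, i l)"
          using S_comp[OF i \<open>l \<in> {1..d}\<close>] by simp
      qed
      finally have "ln (p i) = (\<Sum>l=1..d. c (l, i l))" using c[OF i] by simp
      then have "exp (ln (p i)) = (\<Prod>l=1..d. exp (c (l, i l)))" by (simp add: exp_sum)
      then show ?thesis using pS(2)[OF i] by simp
    qed
    moreover have "p i = 0" if "i \<in> index_set d r" "i \<notin> S" for i
      using that pS(1) by (auto simp: Supp_def)
    ultimately show ?thesis
      unfolding quasi_independent_def pS(1)
      by (intro exI[of _ "\<lambda>l j. exp (c (l, j))"]) (auto simp: indicator_def)
  qed
qed

context copula_support
begin

abbreviation U :: array where "U \<equiv> uniform_on S"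

lemma card_S_pos: "0 < card S"
  using S_nonempty by (simp add: card_gt_0_iff)

lemma positive_on_S_uniform: "positive_on_S U"
  using card_S_pos S_subset
  by (auto simp: positive_on_S_def uniform_on_def Supp_def indicator_def split: if_splits)

lemma sum_mult_ln_div:
  assumes "positive_on_S p" "\<And>i. i \<in> S \<Longrightarrow> 0 < g i"
  shows "(\<Sum>i\<in>S. a i * ln (g i / p i)) = (\<Sum>i\<in>S. a i * ln (g i)) - (\<Sum>i\<in>S. a i * ln (p i))"
  unfolding sum_subtractf[symmetric]
proof (intro sum.cong refl)
  fix i assume "i \<in> S"
  then have "0 < g i" "0 < p i" using assms by (auto simp: positive_on_S_def)
  then show "a i * ln (g i / p i) = a i * ln (g i) - a i * ln (p i)"
    by (simp add: ln_div algebra_simps)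
qed

lemma orthogonal_ln_uniform:
  assumes "a \<in> Z"
  shows "(\<Sum>i\<in>S. a i * ln (U i)) = 0"
proof -
  have "(\<Sum>i\<in>S. a i * ln (U i)) = (\<Sum>i\<in>S. a i * ln (1 / real (card S)))"
    by (intro sum.cong) (auto simp: uniform_on_def)
  also have "\<dots> = (\<Sum>i\<in>S. a i) * ln (1 / real (card S))" by (rule sum_distrib_right[symmetric])
  finally show ?thesis using sum_zero_margin_space[OF assms] by simp
qed

text \<open>\<open>ln U\<close> is constant on \<open>S\<close> and drops out against
  \<open>Z\<close>. Hence \<open>ln g\<close> is orthogonal to \<open>Z\<close>, and
  \<open>g\<close> is stationary for \<open>p\<close> exactly when \<open>ln p\<close> is orthogonal
  too.\<close>

lemma quasi_independent_iff_I_proj_eq: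
  assumes p: "positive_on_S p" and arr: "p \<in> arrays d r"
  shows "quasi_independent d r p \<longleftrightarrow> I_proj d r p = I_proj d r U"
proof -
  define g where "g = I_proj d r U"
  have g: "stationary U g"
    unfolding g_def by (rule stationary_I_proj[OF positive_on_S_uniform])
  then have gS: "g \<in> copula_arrays_on d r S" by (simp add: stationary_def)
  note gpos = copula_on_props(3)[OF gS]
  have g_orth: "(\<Sum>i\<in>S. a i * ln (g i)) = 0" if "a \<in> Z" for a
    using g that orthogonal_ln_uniform[OF that] sum_mult_ln_div[OF positive_on_S_uniform, of g a] gpos
    by (simp add: stationary_def)
  have "(\<Sum>i\<in>S. a i * ln (g i / p i)) = - (\<Sum>i\<in>S. a i * ln (p i))" if "a \<in> Z" for a
    using sum_mult_ln_div[OF p, of g a] gpos g_orth[OF that] by simp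
  then have "quasi_independent d r p \<longleftrightarrow> stationary p g"
    unfolding quasi_independent_iff_orthogonal[OF assms] stationary_def
    using gS by simp
  also have "\<dots> \<longleftrightarrow> I_proj d r p = g"
    using I_proj_eqI[OF p] stationary_I_proj[OF p] by metis
  finally show ?thesis unfolding g_def .
qed

end

section \<open>Coordinates with respect to a basis of the zero-margin space\<close>

locale copula_basis = copula_support +
  fixes \<Delta>s :: "array list"
  assumes distinct_basis: "distinct \<Delta>s"
    and independent_basis: "array.independent (set \<Delta>s)"
    and span_basis: "array.span (set \<Delta>s) = zero_margin_space d r S"
begin

abbreviation m :: nat where "m \<equiv> length \<Delta>s"

definition comb :: "(nat \<Rightarrow> real) \<Rightarrow> array" where
  "comb c = (\<lambda>i. \<Sum>k<m. c k * (\<Delta>s ! k) i)"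

lemma dim_zero_margin_space: "array.dim (zero_margin_space d r S) = m"
  using array.dim_span_eq_card_independent[OF independent_basis] distinct_card[OF distinct_basis]
  by (simp add: span_basis)

lemma sum_set_basis:
  "(\<Sum>v\<in>set \<Delta>s. array_scale (u v) v) = comb (\<lambda>k. u (\<Delta>s ! k))"
proof -
  have "(\<Sum>v\<in>set \<Delta>s. array_scale (u v) v) = (\<Sum>k<m. array_scale (u (\<Delta>s ! k)) (\<Delta>s ! k))"
    by (rule sum.reindex_bij_betw[OF bij_betw_nth[OF distinct_basis refl refl], symmetric])
  then show ?thesis by (simp add: comb_def fun_eq_iff sum_array_scale_apply)
qed

lemma comb_in_Z: "comb c \<in> Z"
proof -
  have "comb c = (\<Sum>k<m. array_scale (c k) (\<Delta>s ! k))"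
    by (simp add: comb_def fun_eq_iff sum_array_scale_apply)
  also have "\<dots> \<in> array.span (set \<Delta>s)"
    by (intro array.span_sum array.span_scale array.span_base) auto
  finally show ?thesis by (simp add: span_basis)
qed

lemma in_Z_comb:
  assumes "a \<in> Z"
  obtains c where "a = comb c"
proof -
  from assms obtain u where "a = (\<Sum>v\<in>set \<Delta>s. array_scale (u v) v)"
    using span_basis array.span_finite[of "set \<Delta>s"] by auto
  then show ?thesis using that sum_set_basis by auto
qed

text \<open>Independence survives restriction to \<open>S\<close> because combinations of the basis
  vanish elsewhere. \<open>u\<close> carries coefficients from list positions to basis elements,
  which is possible since the list is distinct.\<close>

lemma comb_eq_0_on_S:
  assumes "\<And>i. i \<in> S \<Longrightarrow> comb c i = 0" "k < m"
  shows "c k = 0"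
proof -
  define u where "u = (\<lambda>v. c (the_inv_into {..<m} ((!) \<Delta>s) v))"
  have inj: "inj_on ((!) \<Delta>s) {..<m}"
    using distinct_basis by (auto simp: inj_on_def nth_eq_iff_index_eq)
  have u: "u (\<Delta>s ! k) = c k" if "k < m" for k
    using that inj by (simp add: u_def the_inv_into_f_f)
  have "comb c i = 0" for i
    using assms(1) zero_margin_outside[OF comb_in_Z] by (cases "i \<in> S") auto
  then have "(\<Sum>v\<in>set \<Delta>s. array_scale (u v) v) = 0"
    using u by (simp add: sum_set_basis comb_def fun_eq_iff)
  then have "\<forall>v\<in>set \<Delta>s. u v = 0"
    using independent_basis array.dependent_finite[of "set \<Delta>s"] by blast
  then show ?thesis using u[OF assms(2)] assms(2) by auto
qed

lemma comb_inj:
  assumes "comb c = comb c'" "k < m"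
  shows "c k = c' k"
proof -
  have "comb (\<lambda>k. c k - c' k) i = 0" for i
    using assms(1) by (simp add: comb_def fun_eq_iff algebra_simps sum_subtractf)
  then show ?thesis using comb_eq_0_on_S[of "\<lambda>k. c k - c' k" k] assms(2) by simp
qed

lemma is_theta_iff:
  "is_theta d r S \<Delta>s p \<theta> \<longleftrightarrow> \<theta> \<in> carrier_vec m \<and>
    (\<lambda>i. I_proj d r p i - I_proj d r U i) = comb (vec_index \<theta>)"
  by (auto simp: is_theta_def copula_param_def fun_eq_iff comb_def sum_array_scale_apply algebra_simps)

lemma theta_exists_unique:
  assumes p: "positive_on_S p"
  shows "\<exists>!\<theta>. is_theta d r S \<Delta>s p \<theta>"
proof -
  have "(\<lambda>i. I_proj d r p i - I_proj d r U i) \<in> Z"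
    using stationary_I_proj[OF p] stationary_I_proj[OF positive_on_S_uniform]
    by (intro copula_diff_in_zero_margin_space) (auto simp: stationary_def copula_arrays_on_def)
  then obtain c where c: "(\<lambda>i. I_proj d r p i - I_proj d r U i) = comb c" by (rule in_Z_comb)
  show ?thesis
  proof (rule ex1I[of _ "Matrix.vec m c"])
    show "is_theta d r S \<Delta>s p (Matrix.vec m c)"
      using c by (simp add: is_theta_iff comb_def)
    show "\<theta> = Matrix.vec m c" if "is_theta d r S \<Delta>s p \<theta>" for \<theta>
      using that comb_inj[of "vec_index \<theta>" c] c by (intro eq_vecI) (auto simp: is_theta_iff)
  qed
qed

lemma is_theta_theta_of: "positive_on_S p \<Longrightarrow> is_theta d r S \<Delta>s p (theta_of d r S \<Delta>s p)"
  unfolding theta_of_def using theta_exists_unique by (rule theI')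

lemma theta_of_eq_0_iff:
  assumes p: "positive_on_S p"
  shows "theta_of d r S \<Delta>s p = 0\<^sub>v m \<longleftrightarrow> I_proj d r p = I_proj d r U"
proof -
  have "is_theta d r S \<Delta>s p (0\<^sub>v m) \<longleftrightarrow> I_proj d r p = I_proj d r U"
    by (auto simp: is_theta_iff comb_def fun_eq_iff)
  then show ?thesis
    using is_theta_theta_of[OF p] theta_exists_unique[OF p] by metis
qed

end

subsection \<open>The matrices\<close>

lemma mixed_radix_less:
  fixes q r :: "nat \<Rightarrow> nat"
  assumes "\<And>k. k \<in> {1..n} \<Longrightarrow> q k < r k"
  shows "(\<Sum>k=1..n. q k * (\<Prod>m=1..k-1. r m)) < (\<Prod>k=1..n. r k)"
  using assms
proof (induction n)
  case 0
  then show ?case by simp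
next
  case (Suc n)
  have IH: "(\<Sum>k=1..n. q k * (\<Prod>m=1..k-1. r m)) < (\<Prod>k=1..n. r k)"
    using Suc.prems by (intro Suc.IH) auto
  have "q (Suc n) < r (Suc n)" using Suc.prems[of "Suc n"] by simp
  then have "(q (Suc n) + 1) * (\<Prod>k=1..n. r k) \<le> r (Suc n) * (\<Prod>k=1..n. r k)"
    by (intro mult_right_mono) auto
  then show ?case using IH by (simp add: algebra_simps)
qed

text \<open>The leading digit is the quotient, and the number formed by the others the remainder, on
  division by the product \<open>N\<close> of the lower radices.\<close>

lemma mixed_radix_inj:
  fixes q q' r :: "nat \<Rightarrow> nat"
  assumes "\<And>k. k \<in> {1..n} \<Longrightarrow> q k < r k" "\<And>k. k \<in> {1..n} \<Longrightarrow> q' k < r k"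
    and "(\<Sum>k=1..n. q k * (\<Prod>m=1..k-1. r m)) = (\<Sum>k=1..n. q' k * (\<Prod>m=1..k-1. r m))"
    and "k \<in> {1..n}"
  shows "q k = q' k"
  using assms
proof (induction n)
  case 0
  then show ?case by simp
next
  case (Suc n)
  define A where "A = (\<Sum>k=1..n. q k * (\<Prod>m=1..k-1. r m))"
  define A' where "A' = (\<Sum>k=1..n. q' k * (\<Prod>m=1..k-1. r m))"
  define N where "N = (\<Prod>k=1..n. r k)"
  have "A < N"
    unfolding A_def N_def by (rule mixed_radix_less) (use Suc.prems(1) in simp)
  moreover have "A' < N"
    unfolding A'_def N_def by (rule mixed_radix_less) (use Suc.prems(2) in simp)
  ultimately have lt: "A < N" "A' < N" by blast+
  have eq: "A + q (Suc n) * N = A' + q' (Suc n) * N"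
    using Suc.prems(3) by (simp add: A_def A'_def N_def)
  have "A = A'" using arg_cong[OF eq, of "\<lambda>x. x mod N"] lt by simp
  moreover have "q (Suc n) = q' (Suc n)" using eq \<open>A = A'\<close> lt by simp
  ultimately show ?case
    using Suc.IH Suc.prems by (cases "k = Suc n") (auto simp: A_def A'_def)
qed

text \<open>With the zero-based digits \<open>q\<close>, a position is one more than a mixed-radix
  number. Surjectivity follows by counting.\<close>

lemma position_bij_betw:
  assumes d: "1 \<le> d"
  shows "bij_betw (position d r) (index_set d r) {1..array_size d r}"
proof -
  define q where "q = (\<lambda>(i::multi_index) k. i k - 1)"
  have q_less: "q i k < r k" if "i \<in> index_set d r" "k \<in> {1..d}" for i k
    using index_set_component[OF that] by (auto simp: q_def)
  have pos: "position d r i = Suc (\<Sum>k=1..d. q i k * (\<Prod>m=1..k-1. r m))" if "i \<in> index_set d r" for i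
  proof -
    have "{1..d} = insert 1 {2..d}" using d by auto
    then have "(\<Sum>k=1..d. q i k * (\<Prod>m=1..k-1. r m)) = q i 1 + (\<Sum>k=2..d. q i k * (\<Prod>m=1..k-1. r m))"
      by simp
    then show ?thesis
      using index_set_component[OF that, of 1] d by (simp add: position_def q_def)
  qed
  have inj: "inj_on (position d r) (index_set d r)"
  proof (rule inj_onI)
    fix i i' assume i: "i \<in> index_set d r" "i' \<in> index_set d r" and eq: "position d r i = position d r i'"
    have qq: "q i k = q i' k" if "k \<in> {1..d}" for k
      using mixed_radix_inj[of d "q i" r "q i'" k] q_less i eq that by (simp add: pos)
    have "i k = i' k" if "k \<in> {1..d}" for k
      using qq[OF that] index_set_component[OF i(1) that] index_set_component[OF i(2) that]
      by (auto simp: q_def)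
    then show "i = i'"
      using i unfolding index_set_def by (intro PiE_ext)
  qed
  have sub: "position d r ` index_set d r \<subseteq> {1..array_size d r}"
  proof (rule image_subsetI)
    fix i assume i: "i \<in> index_set d r"
    have "(\<Sum>k=1..d. q i k * (\<Prod>m=1..k-1. r m)) < (\<Prod>k=1..d. r k)"
      using q_less[OF i] by (rule mixed_radix_less)
    then show "position d r i \<in> {1..array_size d r}" by (simp add: pos[OF i] array_size_def)
  qed
  have "card (index_set d r) = card {1..array_size d r}"
    by (simp add: index_set_def card_PiE array_size_def)
  then have "position d r ` index_set d r = {1..array_size d r}"
    using inj sub by (intro card_subset_eq) (auto simp: card_image)
  then show ?thesis using inj by (simp add: bij_betw_def)
qed

section \<open>Row selection and matrix inverses\<close>

lemma nths_upt: "nths [0..<n] J = filter (\<lambda>j. j \<in> J) [0..<n]"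
  by (simp add: nths_def zip_same_conv_map filter_map o_def)

text \<open>A two-sided inverse makes \<open>B\<close> a unit, which excludes the result
  \<open>None\<close>; associativity then leaves \<open>C\<close> as the only possible
  inverse.\<close>

lemma mat_inv_eqI:
  assumes B: "B \<in> carrier_mat n n" and C: "C \<in> carrier_mat n n"
    and BC: "B * C = 1\<^sub>m n" and CB: "C * B = 1\<^sub>m n"
  shows "mat_inv B = C"
proof (cases "mat_inverse B")
  case None
  have "B \<in> Units (ring_mat TYPE(real) n ())"
    using B C BC CB by (auto simp: Units_def ring_mat_def)
  then show ?thesis using mat_inverse(1)[OF B None, of "()"] by blast
next
  case (Some D)
  have DB: "D * B = 1\<^sub>m n" and D: "D \<in> carrier_mat n n"
    using mat_inverse(2)[OF B Some] by auto
  have "D = D * (B * C)" by (simp only: BC right_mult_one_mat[OF D])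
  also have "\<dots> = (D * B) * C" by (rule assoc_mult_mat[OF D B C, symmetric])
  also have "\<dots> = C" by (simp only: DB left_mult_one_mat[OF C])
  finally show ?thesis using Some by (simp add: mat_inv_def)
qed

lemma mat_inv_inverse:
  fixes B :: "real mat"
  assumes B: "B \<in> carrier_mat n n" and "Determinant.det B \<noteq> 0"
  shows "B * mat_inv B = 1\<^sub>m n" "mat_inv B * B = 1\<^sub>m n" "mat_inv B \<in> carrier_mat n n"
proof -
  obtain D where "mat_inverse B = Some D"
    using mat_inverse(1)[OF B, of "()"] det_non_zero_imp_unit[OF assms, of "()"] by (cases "mat_inverse B") auto
  then show "B * mat_inv B = 1\<^sub>m n" "mat_inv B * B = 1\<^sub>m n" "mat_inv B \<in> carrier_mat n n"
    using mat_inverse(2)[OF B] by (auto simp: mat_inv_def)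
qed

text \<open>Covers both orders of multiplication of \<open>\<Sigma>\<close>, a sandwich of inverses
  of \<open>G\<close> around \<open>H\<close>, with \<open>G * mat_inv H * G\<close>.\<close>

lemma mult_mat_sandwich_inverse:
  fixes A A' B B' :: "real mat"
  assumes A: "A \<in> carrier_mat n n" and A': "A' \<in> carrier_mat n n"
    and B: "B \<in> carrier_mat n n" and B': "B' \<in> carrier_mat n n"
    and "A * A' = 1\<^sub>m n" "B * B' = 1\<^sub>m n"
  shows "(A * B * A) * (A' * B' * A') = 1\<^sub>m n"
proof -
  note carrier = mult_carrier_mat[of _ n n _ n]
  note assoc = assoc_mult_mat[of _ n n _ n _ n]
  have "(A * B * A) * (A' * B' * A') = (A * B) * (A * (A' * (B' * A')))"
    using A A' B B' by (simp only: assoc carrier)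
  also have "A * (A' * (B' * A')) = (A * A') * (B' * A')"
    using A A' B B' by (simp only: assoc carrier)
  also have "\<dots> = B' * A'"
    using carrier[OF B' A'] by (simp only: assms(5) left_mult_one_mat)
  also have "(A * B) * (B' * A') = A * ((B * B') * A')"
    using A A' B B' by (simp only: assoc carrier)
  also have "\<dots> = A * A'" using A' by (simp only: assms(6) left_mult_one_mat)
  finally show ?thesis using assms(5) by simp
qed

lemma diag_inv_eq:
  assumes "\<And>i. i < dim_vec v \<Longrightarrow> vec_index v i \<noteq> 0"
  shows "diag_inv v = mat_diag (dim_vec v) (\<lambda>i. 1 / vec_index v i)"
proof -
  have *: "mat_diag (dim_vec v) (\<lambda>i. vec_index v i * (1 / vec_index v i)) = 1\<^sub>m (dim_vec v)"
    using assms by (intro eq_matI) (auto simp: mat_diag_def)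
  then have "mat_diag (dim_vec v) (\<lambda>i. (1 / vec_index v i) * vec_index v i) = 1\<^sub>m (dim_vec v)"
    by (simp add: mult.commute)
  then show ?thesis
    unfolding diag_inv_def using * by (intro mat_inv_eqI[of _ "dim_vec v"]) auto
qed

section \<open>Enumeration of the support by positions\<close>

context copula_support
begin

definition pos_index :: "nat \<Rightarrow> multi_index" where
  "pos_index j = the_inv_into (index_set d r) (position d r) (Suc j)"

text \<open>The zero-based indices of the rows that \<open>selection_mat\<close> keeps, in their
  order: row \<open>a\<close> belongs to the multi-index
  \<open>pos_index (support_positions ! a)\<close>.\<close>

definition support_positions :: "nat list" where
  "support_positions = filter (\<lambda>j. Suc j \<notin> position d r ` (index_set d r - S)) [0..<array_size d r]"

lemma pos_index_bij_betw: "bij_betw pos_index (set support_positions) S"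
proof -
  note bij = position_bij_betw[OF d_pos, of r]
  have inj: "inj_on (position d r) (index_set d r)"
    and img: "position d r ` index_set d r = {1..array_size d r}"
    using bij by (auto simp: bij_betw_def)
  have pos_index: "pos_index j \<in> index_set d r" "position d r (pos_index j) = Suc j"
    if "j < array_size d r" for j
  proof -
    have "Suc j \<in> position d r ` index_set d r" using that img by auto
    then show "pos_index j \<in> index_set d r" "position d r (pos_index j) = Suc j"
      unfolding pos_index_def
      using f_the_inv_into_f[OF inj] the_inv_into_into[OF inj _ subset_refl] by blast+
  qed
  have mem: "j \<in> set support_positions \<longleftrightarrow> j < array_size d r \<and> pos_index j \<in> S" for j
  proof (cases "j < array_size d r")
    case True
    then have "Suc j \<in> position d r ` (index_set d r - S) \<longleftrightarrow> pos_index j \<in> index_set d r - S"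
      using inj_on_image_mem_iff[OF inj pos_index(1)[OF True], of "index_set d r - S"]
      by (simp only: pos_index(2)[OF True] Diff_subset)
    then show ?thesis using True pos_index[OF True] by (auto simp: support_positions_def)
  qed (simp add: support_positions_def)
  have "inj_on pos_index (set support_positions)"
  proof (rule inj_onI)
    fix j j' assume "j \<in> set support_positions" "j' \<in> set support_positions"
      and eq: "pos_index j = pos_index j'"
    then have lt: "j < array_size d r" "j' < array_size d r" by (simp_all add: mem)
    have "Suc j = position d r (pos_index j)" by (rule pos_index(2)[OF lt(1), symmetric])
    also have "\<dots> = Suc j'" unfolding eq by (rule pos_index(2)[OF lt(2)])
    finally show "j = j'" by (rule Suc_inject)
  qed
  moreover have "S \<subseteq> pos_index ` set support_positions"
  proof
    fix i assume i: "i \<in> S"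
    then have "position d r i \<in> {1..array_size d r}" using S_subset img by blast
    then obtain j where j: "position d r i = Suc j" "j < array_size d r"
      by (cases "position d r i") auto
    have "pos_index j = i"
      using pos_index[OF j(2)] j(1) i S_subset by (intro inj_onD[OF inj]) auto
    then show "i \<in> pos_index ` set support_positions" using i j mem by blast
  qed
  ultimately show ?thesis using mem by (auto simp: bij_betw_def)
qed

text \<open>Turns sums over selected rows in matrix products into sums over \<open>S\<close>, where
  the enumeration no longer matters.\<close>

lemma sum_support_positions:
  "(\<Sum>a<length support_positions. f (pos_index (support_positions ! a))) = (\<Sum>i\<in>S. f i)"
proof -
  have "distinct support_positions" by (simp add: support_positions_def)
  then have "(\<Sum>a<length support_positions. f (pos_index (support_positions ! a)))
      = (\<Sum>j\<in>set support_positions. f (pos_index j))"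
    by (intro sum.reindex_bij_betw[OF bij_betw_nth]) auto
  also have "\<dots> = (\<Sum>i\<in>S. f i)"
    by (rule sum.reindex_bij_betw[OF pos_index_bij_betw])
  finally show ?thesis .
qed

lemma selection_mat_eq:
  "selection_mat d r S = mat_of_rows (array_size d r) (map (unit_vec (array_size d r)) support_positions)"
proof -
  have "rows (1\<^sub>m (array_size d r) :: real mat) = map (unit_vec (array_size d r)) [0..<array_size d r]"
    by (auto simp: Matrix.rows_def intro!: nth_equalityI)
  then show ?thesis
    by (simp add: selection_mat_def nths_map nths_upt support_positions_def)
qed

lemma support_positions_less: "a < length support_positions \<Longrightarrow> support_positions ! a < array_size d r"
  using nth_mem[of a support_positions] by (auto simp: support_positions_def)

lemma selection_vectorise:
  "selection_mat d r S *\<^sub>v vectorise d r q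
    = Matrix.vec (length support_positions) (\<lambda>a. q (pos_index (support_positions ! a)))"
  by (intro eq_vecI)
    (auto simp: selection_mat_eq vectorise_def pos_index_def support_positions_less)

end

section \<open>Gram matrices of the basis\<close>

context copula_basis
begin

text \<open>The bracketed matrices of \<open>Sigma_theta\<close> are of this kind, as
  \<open>gram_eq\<close> shows; they are Gram matrices for the weights \<open>1 / \<gamma>\<close>
  and \<open>1 / p\<close>.\<close>

definition gram :: "array \<Rightarrow> real mat" where
  "gram q = Matrix.mat m m (\<lambda>(j, k). wip S (\<lambda>i. 1 / q i) (\<Delta>s ! j) (\<Delta>s ! k))"

lemma gram_carrier [simp]: "gram q \<in> carrier_mat m m"
  by (simp add: gram_def)

lemma selection_basis_matrix:
  "selection_mat d r S * mat_of_cols (array_size d r) (map (vectorise d r) \<Delta>s)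
    = Matrix.mat (length support_positions) m (\<lambda>(a, k). (\<Delta>s ! k) (pos_index (support_positions ! a)))"
  by (intro eq_matI)
    (auto simp: selection_mat_eq vectorise_def pos_index_def support_positions_less)

lemma gram_eq:
  assumes q: "\<And>i. i \<in> S \<Longrightarrow> q i \<noteq> 0"
  shows "transpose_mat (selection_mat d r S * mat_of_cols (array_size d r) (map (vectorise d r) \<Delta>s)) *
      diag_inv (selection_mat d r S *\<^sub>v vectorise d r q) *
      (selection_mat d r S * mat_of_cols (array_size d r) (map (vectorise d r) \<Delta>s)) = gram q"
proof -
  define n where "n = length support_positions"
  define \<iota> where "\<iota> = (\<lambda>a. pos_index (support_positions ! a))"
  have \<iota>: "\<iota> a \<in> S" if "a < n" for a
    using that pos_index_bij_betw by (auto simp: \<iota>_def n_def bij_betw_def)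
  have D: "diag_inv (Matrix.vec n (\<lambda>a. q (\<iota> a))) = mat_diag n (\<lambda>a. 1 / q (\<iota> a))"
    using q \<iota> by (subst diag_inv_eq) (auto simp: mat_diag_def intro!: eq_matI)
  define B where "B = Matrix.mat n m (\<lambda>(a, k). (\<Delta>s ! k) (\<iota> a))"
  have "transpose_mat B * mat_diag n (\<lambda>a. 1 / q (\<iota> a)) * B = gram q"
  proof (rule eq_matI)
    fix j k assume "j < dim_row (gram q)" "k < dim_col (gram q)"
    then have jk: "j < m" "k < m" by (simp_all add: gram_def)
    have "transpose_mat B * mat_diag n (\<lambda>a. 1 / q (\<iota> a)) = Matrix.mat m n (\<lambda>(j, a). (\<Delta>s ! j) (\<iota> a) * (1 / q (\<iota> a)))"
      by (subst mat_diag_mult_right[of _ m]) (auto simp: B_def intro!: eq_matI)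
    then have "(transpose_mat B * mat_diag n (\<lambda>a. 1 / q (\<iota> a)) * B) $$ (j, k)
        = (\<Sum>a<n. (\<Delta>s ! j) (\<iota> a) * (1 / q (\<iota> a)) * (\<Delta>s ! k) (\<iota> a))"
      using jk by (simp add: B_def scalar_prod_def atLeast0LessThan)
    also have "\<dots> = (\<Sum>i\<in>S. (\<Delta>s ! j) i * (1 / q i) * (\<Delta>s ! k) i)"
      unfolding \<iota>_def n_def by (rule sum_support_positions)
    also have "\<dots> = gram q $$ (j, k)"
      using jk by (simp add: gram_def wip_def)
    finally show "(transpose_mat B * mat_diag n (\<lambda>a. 1 / q (\<iota> a)) * B) $$ (j, k) = gram q $$ (j, k)" .
  qed (simp_all add: B_def gram_def)
  then show ?thesis
    unfolding selection_basis_matrix selection_vectorise using D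
    by (simp add: B_def \<iota>_def n_def)
qed

lemma gram_mult_vec:
  assumes "v \<in> carrier_vec m"
  shows "gram q *\<^sub>v v = Matrix.vec m (\<lambda>j. wip S (\<lambda>i. 1 / q i) (\<Delta>s ! j) (comb (vec_index v)))"
proof (rule eq_vecI)
  fix j assume "j < dim_vec (Matrix.vec m (\<lambda>j. wip S (\<lambda>i. 1 / q i) (\<Delta>s ! j) (comb (vec_index v))))"
  then have j: "j < m" by simp
  then have "vec_index (gram q *\<^sub>v v) j
      = (\<Sum>k<m. wip S (\<lambda>i. 1 / q i) (\<Delta>s ! j) (\<Delta>s ! k) * vec_index v k)"
    using assms by (simp add: gram_def scalar_prod_def atLeast0LessThan)
  also have "\<dots> = wip S (\<lambda>i. 1 / q i) (\<Delta>s ! j) (comb (vec_index v))"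
    unfolding comb_def wip_sum_right by (simp add: mult.commute)
  finally show "vec_index (gram q *\<^sub>v v) j
      = vec_index (Matrix.vec m (\<lambda>j. wip S (\<lambda>i. 1 / q i) (\<Delta>s ! j) (comb (vec_index v)))) j"
    using j by simp
qed (simp add: gram_def)

lemma scalar_prod_gram_mult_vec:
  assumes "u \<in> carrier_vec m" "v \<in> carrier_vec m"
  shows "u \<bullet> (gram q *\<^sub>v v) = wip S (\<lambda>i. 1 / q i) (comb (vec_index u)) (comb (vec_index v))"
  unfolding gram_mult_vec[OF assms(2)] comb_def[of "vec_index u"] wip_sum_left
  by (simp add: scalar_prod_def atLeast0LessThan)

text \<open>Positive definiteness: a kernel vector gives a combination of length 0, which vanishes
  on \<open>S\<close>.\<close>

lemma det_gram:
  assumes q: "\<And>i. i \<in> S \<Longrightarrow> 0 < q i"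
  shows "Determinant.det (gram q) \<noteq> 0"
proof
  assume "Determinant.det (gram q) = 0"
  then obtain v where v: "v \<in> carrier_vec m" "v \<noteq> 0\<^sub>v m" "gram q *\<^sub>v v = 0\<^sub>v m"
    using det_0_iff_vec_prod_zero_field[OF gram_carrier] by blast
  have "wip S (\<lambda>i. 1 / q i) (comb (vec_index v)) (comb (vec_index v)) = 0"
    using scalar_prod_gram_mult_vec[OF v(1) v(1), of q] v by simp
  then have "\<forall>i\<in>S. comb (vec_index v) i = 0"
    using wip_self_eq_0_iff[OF finite_S, of "\<lambda>i. 1 / q i"] q by simp
  then have "v = 0\<^sub>v m"
    using comb_eq_0_on_S v(1) by (intro eq_vecI) auto
  then show False using v(2) by simp
qed

lemma orthonormal_basis_exists:
  assumes q: "\<And>i. i \<in> S \<Longrightarrow> 0 < q i"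
  obtains e D where "\<And>j. j < m \<Longrightarrow> e j \<in> Z"
    "\<And>j k. j < m \<Longrightarrow> k < m \<Longrightarrow> wip S (\<lambda>i. 1 / q i) (e j) (e k) = (if j = k then 1 else 0)"
    "\<And>k i. k < m \<Longrightarrow> i \<in> S \<Longrightarrow> (\<Delta>s ! k) i = (\<Sum>j<m. D k j * e j i)"
proof -
  have "\<exists>e C D. (\<forall>j<m. e j = (\<lambda>i. \<Sum>k<m. C j k * (\<Delta>s ! k) i)) \<and>
    (\<forall>j<m. \<forall>k<m. wip S (\<lambda>i. 1 / q i) (e j) (e k) = (if j = k then 1 else 0)) \<and>
    (\<forall>k<m. \<forall>i\<in>S. (\<Delta>s ! k) i = (\<Sum>j<m. D k j * e j i))"
  proof (rule wip_gram_schmidt)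
    show "\<forall>k<m. c k = 0" if "\<And>i. i \<in> S \<Longrightarrow> (\<Sum>k<m. c k * (\<Delta>s ! k) i) = 0" for c
      using comb_eq_0_on_S[of c] that by (simp add: comb_def)
  qed (use q in auto)
  then obtain e C D where e: "\<And>j. j < m \<Longrightarrow> e j = comb (C j)"
    and rest: "\<And>j k. j < m \<Longrightarrow> k < m \<Longrightarrow> wip S (\<lambda>i. 1 / q i) (e j) (e k) = (if j = k then 1 else 0)"
    "\<And>k i. k < m \<Longrightarrow> i \<in> S \<Longrightarrow> (\<Delta>s ! k) i = (\<Sum>j<m. D k j * e j i)"
    unfolding comb_def by blast
  show ?thesis using that[of e D] e rest comb_in_Z by auto
qed

section \<open>The covariance matrix and its quadratic form\<close>

context
  fixes p :: array
  assumes p: "positive_on_S p"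
begin

abbreviation G :: "real mat" where "G \<equiv> gram (I_proj d r p)"
abbreviation H :: "real mat" where "H \<equiv> gram p"
abbreviation \<Sigma> :: "real mat" where "\<Sigma> \<equiv> Sigma_theta d r S \<Delta>s p"

lemma p_pos: "i \<in> S \<Longrightarrow> 0 < p i"
  using p by (simp add: positive_on_S_def)

lemma I_proj_pos: "i \<in> S \<Longrightarrow> 0 < I_proj d r p i"
  using stationary_I_proj[OF p] copula_on_props(3) by (auto simp: stationary_def)

lemma Sigma_eq: "\<Sigma> = mat_inv G * H * mat_inv G"
proof -
  have "i \<in> S \<Longrightarrow> p i \<noteq> 0" "i \<in> S \<Longrightarrow> I_proj d r p i \<noteq> 0" for i
    using p_pos[of i] I_proj_pos[of i] by auto
  then show ?thesis by (simp add: Sigma_theta_def Let_def gram_eq)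
qed

lemma G_inv: "G * mat_inv G = 1\<^sub>m m" "mat_inv G * G = 1\<^sub>m m" "mat_inv G \<in> carrier_mat m m"
  using mat_inv_inverse[OF gram_carrier det_gram, of "I_proj d r p"] I_proj_pos by auto

lemma H_inv: "H * mat_inv H = 1\<^sub>m m" "mat_inv H * H = 1\<^sub>m m" "mat_inv H \<in> carrier_mat m m"
  using mat_inv_inverse[OF gram_carrier det_gram, of p] p_pos by auto

lemma Sigma_carrier: "\<Sigma> \<in> carrier_mat m m"
  unfolding Sigma_eq by (intro mult_carrier_mat[of _ m m _ m] G_inv(3) gram_carrier)

lemma Sigma_inverse_carrier: "G * mat_inv H * G \<in> carrier_mat m m"
  by (intro mult_carrier_mat[of _ m m _ m] H_inv(3) gram_carrier)

lemma Sigma_inverse: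
  "\<Sigma> * (G * mat_inv H * G) = 1\<^sub>m m" "(G * mat_inv H * G) * \<Sigma> = 1\<^sub>m m"
  unfolding Sigma_eq
  by (intro mult_mat_sandwich_inverse gram_carrier G_inv H_inv)+

lemma mat_inv_Sigma: "mat_inv \<Sigma> = G * mat_inv H * G"
  by (rule mat_inv_eqI[OF Sigma_carrier Sigma_inverse_carrier Sigma_inverse])

lemma rank_Sigma: "vec_space.rank m \<Sigma> = m"
proof -
  have "Determinant.det \<Sigma> * Determinant.det (G * mat_inv H * G) = 1"
    using det_mult[OF Sigma_carrier Sigma_inverse_carrier] by (simp add: Sigma_inverse)
  then have "Determinant.det \<Sigma> \<noteq> 0" by auto
  then show ?thesis using vec_space.det_rank_iff[OF Sigma_carrier] by blast
qed

text \<open>With \<open>f = p comb \<theta> / \<gamma>\<close>, both sides are the squared length of the orthogonal projection of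
  \<open>f\<close> onto the zero-margin space with respect to the weight \<open>1 / p\<close>.\<close>

lemma Sigma_quadratic_form:
  assumes e: "\<And>j. j < m \<Longrightarrow> e j \<in> Z"
    and on: "\<And>j k. j < m \<Longrightarrow> k < m \<Longrightarrow> wip S (\<lambda>i. 1 / p i) (e j) (e k) = (if j = k then 1 else 0)"
    and span: "\<And>k i. k < m \<Longrightarrow> i \<in> S \<Longrightarrow> (\<Delta>s ! k) i = (\<Sum>j<m. D k j * e j i)"
    and \<theta>: "\<theta> \<in> carrier_vec m"
  shows "\<theta> \<bullet> (mat_inv \<Sigma> *\<^sub>v \<theta>) = (\<Sum>j<m. (\<Sum>i\<in>S. e j i * (comb (vec_index \<theta>) i / I_proj d r p i))\<^sup>2)"
proof -
  let ?ip = "wip S (\<lambda>i. 1 / p i)"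
  have p_nz: "p i \<noteq> 0" if "i \<in> S" for i using p_pos[OF that] by simp
  define u where "u = G *\<^sub>v \<theta>"
  \<comment> \<open>\<open>H c = G \<theta>\<close> are the normal equations:
    \<open>comb (vec_index c)\<close> is the orthogonal projection of \<open>f\<close> onto the
    zero-margin space.\<close>
  define c where "c = mat_inv H *\<^sub>v u"
  define f where "f = (\<lambda>i. p i * comb (vec_index \<theta>) i / I_proj d r p i)"
  have u: "u \<in> carrier_vec m" unfolding u_def by (simp add: gram_mult_vec[OF \<theta>])
  have c: "c \<in> carrier_vec m" unfolding c_def using H_inv(3) u by simp
  have sym: "transpose_mat G = G"
    by (intro eq_matI) (auto simp: gram_def wip_commute)
  have "\<theta> \<bullet> (mat_inv \<Sigma> *\<^sub>v \<theta>) = \<theta> \<bullet> (G *\<^sub>v c)"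
  proof -
    have "(G * mat_inv H * G) *\<^sub>v \<theta> = (G * mat_inv H) *\<^sub>v u"
      unfolding u_def
      by (rule assoc_mult_mat_vec[OF mult_carrier_mat[OF gram_carrier H_inv(3)] gram_carrier \<theta>])
    also have "\<dots> = G *\<^sub>v c"
      unfolding c_def by (rule assoc_mult_mat_vec[OF gram_carrier H_inv(3) u])
    finally show ?thesis by (simp add: mat_inv_Sigma)
  qed
  also have "\<dots> = u \<bullet> c"
    using transpose_vec_mult_scalar[OF gram_carrier c \<theta>, of "I_proj d r p"] sym by (simp add: u_def)
  also have "\<dots> = c \<bullet> u" using u c by (simp add: comm_scalar_prod[of _ m])
  also have Hc: "u = H *\<^sub>v c"
    using assoc_mult_mat_vec[OF gram_carrier[of p] H_inv(3) u] u by (simp add: c_def H_inv(1))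
  also have "c \<bullet> (H *\<^sub>v c) = ?ip (comb (vec_index c)) (comb (vec_index c))"
    by (rule scalar_prod_gram_mult_vec[OF c c])
  also have "\<dots> = (\<Sum>j<m. (?ip (e j) (comb (vec_index c)))\<^sup>2)"
  proof (rule wip_orthonormal_expansion[OF on])
    fix i assume i: "i \<in> S"
    have "comb (vec_index c) i = (\<Sum>k<m. \<Sum>j<m. vec_index c k * D k j * e j i)"
      using span i by (simp add: comb_def sum_distrib_left mult.assoc)
    also have "\<dots> = (\<Sum>j<m. (\<Sum>k<m. vec_index c k * D k j) * e j i)"
      by (subst sum.swap) (simp add: sum_distrib_right)
    finally show "comb (vec_index c) i = (\<Sum>j<m. (\<Sum>k<m. vec_index c k * D k j) * e j i)" .
  qed
  also have "\<dots> = (\<Sum>j<m. (?ip (e j) f)\<^sup>2)"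
  proof -
    \<comment> \<open>The two weights are exchanged here: \<open>f\<close> weighted by
      \<open>1 / p\<close> is \<open>comb (vec_index \<theta>)\<close> weighted by
      \<open>1 / \<gamma>\<close>.\<close>
    have basis: "?ip (\<Delta>s ! k) (comb (vec_index c)) = ?ip (\<Delta>s ! k) f" if k: "k < m" for k
    proof -
      have "?ip (\<Delta>s ! k) (comb (vec_index c)) = vec_index u k"
        using Hc gram_mult_vec[OF c, of p] k by simp
      also have "\<dots> = wip S (\<lambda>i. 1 / I_proj d r p i) (\<Delta>s ! k) (comb (vec_index \<theta>))"
        using gram_mult_vec[OF \<theta>, of "I_proj d r p"] k by (simp add: u_def)
      also have "\<dots> = ?ip (\<Delta>s ! k) f"
        unfolding wip_def f_def by (intro sum.cong) (auto simp: p_nz)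
      finally show ?thesis .
    qed
    have "?ip (e j) (comb (vec_index c)) = ?ip (e j) f" if j: "j < m" for j
    proof -
      obtain a where a: "e j = comb a" using in_Z_comb[OF e[OF j]] .
      show ?thesis unfolding a comb_def[of a] wip_sum_left using basis by simp
    qed
    then show ?thesis by simp
  qed
  also have "\<dots> = (\<Sum>j<m. (\<Sum>i\<in>S. e j i * (comb (vec_index \<theta>) i / I_proj d r p i))\<^sup>2)"
  proof -
    have "?ip (e j) f = (\<Sum>i\<in>S. e j i * (comb (vec_index \<theta>) i / I_proj d r p i))" for j
      unfolding wip_def f_def by (intro sum.cong) (auto simp: p_nz)
    then show ?thesis by simp
  qed
  finally show ?thesis .
qed

end

end

subsection \<open>Linearisation of the projection\<close>

text \<open>Strong monotonicity of \<open>ln\<close>: for \<open>t \<le> s \<le> 1\<close>, the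
  inequality \<open>ln y \<le> y - 1\<close> at \<open>y = t / s\<close> bounds
  \<open>ln (s / t)\<close> below by \<open>(s - t) / s\<close>. The other order is
  symmetric.\<close>

lemma diff_square_le_ln:
  fixes a b :: real
  assumes "0 < a" "a \<le> 1" "0 < b" "b \<le> 1"
  shows "(a - b)\<^sup>2 \<le> (a - b) * ln (a / b)"
proof -
  have *: "(s - t)\<^sup>2 \<le> (s - t) * ln (s / t)" if "0 < t" "t \<le> s" "s \<le> 1" for s t :: real
  proof -
    have s: "0 < s" using that by simp
    have "ln (t / s) \<le> t / s - 1" using that s by (intro ln_le_minus_one) simp
    then have "1 - t / s \<le> ln (s / t)" using that s by (simp add: ln_div)
    moreover have "s - t \<le> 1 - t / s"
    proof -
      have "(s - t) * s \<le> (s - t) * 1" using that s by (intro mult_left_mono) auto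
      then show ?thesis using s by (simp add: field_simps)
    qed
    ultimately have "s - t \<le> ln (s / t)" by simp
    then have "(s - t) * (s - t) \<le> (s - t) * ln (s / t)"
      using that by (intro mult_left_mono) auto
    then show ?thesis by (simp add: power2_eq_square)
  qed
  show ?thesis
  proof (cases "b \<le> a")
    case True
    then show ?thesis using *[of b a] assms by simp
  next
    case False
    then have "(b - a)\<^sup>2 \<le> (b - a) * ln (b / a)" using *[of a b] assms by simp
    also have "\<dots> = (a - b) * ln (a / b)" using assms by (simp add: ln_div algebra_simps)
    finally show ?thesis by (simp add: power2_commute)
  qed
qed

context copula_support
begin

text \<open>Testing the difference of the two stationarity conditions with the difference of the two
  projections bounds the latter, because \<open>ln\<close> has slope at least \<open>1\<close> on the unit interval. A
  second-order expansion then gives the linearisation, without an implicit function theorem.\<close>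

lemma I_proj_linearisation:
  assumes p: "positive_on_S p"
  shows "\<exists>\<eta>>0. \<exists>C\<ge>0. \<forall>q. positive_on_S q \<longrightarrow> (\<Sum>i\<in>S. (q i - p i)\<^sup>2) \<le> \<eta> \<longrightarrow>
    (\<forall>a\<in>Z. \<bar>\<Sum>i\<in>S. a i * ((I_proj d r q i - I_proj d r p i) / I_proj d r p i - (q i - p i) / p i)\<bar>
      \<le> C * (\<Sum>i\<in>S. \<bar>a i\<bar>) * (\<Sum>i\<in>S. (q i - p i)\<^sup>2))"
proof -
  define \<gamma> where "\<gamma> = I_proj d r p"
  have \<gamma>: "stationary p \<gamma>" unfolding \<gamma>_def by (rule stationary_I_proj[OF p])
  then have \<gamma>S: "\<gamma> \<in> copula_arrays_on d r S" by (simp add: stationary_def)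
  note \<gamma>_props = copula_on_props[OF \<gamma>S]
  have p_pos: "0 < p i" if "i \<in> S" for i using p that by (simp add: positive_on_S_def)
  define \<mu> where "\<mu> = Min ((\<lambda>i. min (\<gamma> i) (p i)) ` S)"
  have \<mu>_le: "\<mu> \<le> \<gamma> i" "\<mu> \<le> p i" if "i \<in> S" for i
    using Min_le[of "(\<lambda>i. min (\<gamma> i) (p i)) ` S" "min (\<gamma> i) (p i)"] that
    by (auto simp: \<mu>_def)
  have \<mu>: "0 < \<mu>"
    unfolding \<mu>_def using S_nonempty \<gamma>_props(3) p_pos by (subst Min_gr_iff) auto
  have \<mu>1: "\<mu> \<le> 1" using S_nonempty \<mu>_le(1) \<gamma>_props(4) by (meson all_not_in_conv order_trans)
  \<comment> \<open>\<open>\<eta>\<close> makes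
    \<open>4 / \<mu>\<^sup>2 * \<eta> = (\<mu> / 2)\<^sup>2\<close>, so that \<open>X\<close> and
    \<open>Y\<close> stay below 1 / 2, where the remainder of \<open>ln (1 + x)\<close> is at most
    \<open>2 * x\<^sup>2\<close>. In \<open>C\<close>, the factor \<open>2 / \<mu>\<^sup>2\<close>
    stems from this remainder and the division by entries at least \<open>\<mu>\<close>;
    \<open>4 / \<mu>\<^sup>2\<close> and 1 account for \<open>v\<close> and
    \<open>q - p\<close>.\<close>
  define \<eta> where "\<eta> = \<mu> ^ 4 / 16"
  define C where "C = 2 / \<mu>\<^sup>2 * (4 / \<mu>\<^sup>2 + 1)"
  have "\<bar>\<Sum>i\<in>S. a i * ((I_proj d r q i - \<gamma> i) / \<gamma> i - (q i - p i) / p i)\<bar>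
      \<le> C * (\<Sum>i\<in>S. \<bar>a i\<bar>) * (\<Sum>i\<in>S. (q i - p i)\<^sup>2)"
    if q: "positive_on_S q" and D_le: "(\<Sum>i\<in>S. (q i - p i)\<^sup>2) \<le> \<eta>" and a: "a \<in> Z" for q a
  proof -
    define \<gamma>' where "\<gamma>' = I_proj d r q"
    have \<gamma>': "stationary q \<gamma>'" unfolding \<gamma>'_def by (rule stationary_I_proj[OF q])
    then have \<gamma>'S: "\<gamma>' \<in> copula_arrays_on d r S" by (simp add: stationary_def)
    note \<gamma>'_props = copula_on_props[OF \<gamma>'S]
    have q_pos: "0 < q i" if "i \<in> S" for i using q that by (simp add: positive_on_S_def)
    define D where "D = (\<Sum>i\<in>S. (q i - p i)\<^sup>2)"
    define v where "v = (\<lambda>i. \<gamma>' i - \<gamma> i)"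
    define X where "X = (\<lambda>i. v i / \<gamma> i)"
    define Y where "Y = (\<lambda>i. (q i - p i) / p i)"
    have lnX: "ln (1 + X i) = ln (\<gamma>' i / \<gamma> i)" and lnY: "ln (1 + Y i) = ln (q i / p i)" if "i \<in> S" for i
      using \<gamma>_props(3)[OF that] p_pos[OF that] by (simp_all add: X_def Y_def v_def field_simps)
    have vZ: "v \<in> Z"
      unfolding v_def using \<gamma>_props(1,2) \<gamma>'_props(1,2) by (intro copula_diff_in_zero_margin_space) auto
    have score: "(\<Sum>i\<in>S. b i * ln (1 + X i)) = (\<Sum>i\<in>S. b i * ln (1 + Y i))" if b: "b \<in> Z" for b
    proof -
      have "(\<Sum>i\<in>S. b i * ln (1 + X i)) - (\<Sum>i\<in>S. b i * ln (1 + Y i))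
          = (\<Sum>i\<in>S. b i * ln (\<gamma>' i / q i)) - (\<Sum>i\<in>S. b i * ln (\<gamma> i / p i))"
        unfolding sum_subtractf[symmetric]
      proof (intro sum.cong refl)
        fix i assume i: "i \<in> S"
        show "b i * ln (1 + X i) - b i * ln (1 + Y i) = b i * ln (\<gamma>' i / q i) - b i * ln (\<gamma> i / p i)"
          using \<gamma>_props(3)[OF i] \<gamma>'_props(3)[OF i] p_pos[OF i] q_pos[OF i]
          by (simp add: lnX[OF i] lnY[OF i] ln_div algebra_simps)
      qed
      also have "\<dots> = 0" using \<gamma> \<gamma>' b by (simp add: stationary_def)
      finally show ?thesis by simp
    qed
    have member_D: "(q i - p i)\<^sup>2 \<le> D" if "i \<in> S" for i
      unfolding D_def using that by (intro member_le_sum) auto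
    have \<eta>_le: "\<eta> \<le> (\<mu> / 2)\<^sup>2 * \<mu>\<^sup>2" using \<mu> by (simp add: \<eta>_def power2_eq_square power4_eq_xxxx)
    have \<mu>2: "\<mu>\<^sup>2 \<le> 1" using \<mu> \<mu>1 by (simp add: power_le_one)
    have ratio: "\<bar>s / t\<bar> \<le> 1 / 2" if "s\<^sup>2 \<le> (\<mu> / 2)\<^sup>2" "\<mu> \<le> t" for s t
    proof -
      have "\<bar>s\<bar> \<le> \<mu> / 2" using that(1) \<mu> by (simp add: abs_le_square_iff[symmetric])
      then show ?thesis using that(2) \<mu> by (simp add: abs_div divide_le_eq)
    qed
    have sq_ratio: "(s / t)\<^sup>2 \<le> s\<^sup>2 / \<mu>\<^sup>2" if "\<mu> \<le> t" for s t
      using that \<mu> by (simp add: power_divide) (intro divide_left_mono power_mono, auto)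
    have Y_small: "\<bar>Y i\<bar> \<le> 1 / 2" if i: "i \<in> S" for i
    proof -
      have "(\<mu> / 2)\<^sup>2 * \<mu>\<^sup>2 \<le> (\<mu> / 2)\<^sup>2 * 1" using \<mu>2 by (intro mult_left_mono) auto
      then have "(q i - p i)\<^sup>2 \<le> (\<mu> / 2)\<^sup>2"
        using member_D[OF i] D_le \<eta>_le by (simp add: D_def)
      then show ?thesis unfolding Y_def using \<mu>_le(2)[OF i] by (rule ratio)
    qed
    have lnY_bound: "(ln (1 + Y i))\<^sup>2 \<le> 4 / \<mu>\<^sup>2 * (q i - p i)\<^sup>2" if i: "i \<in> S" for i
    proof -
      have "\<bar>ln (1 + Y i) - Y i\<bar> \<le> 2 * (Y i)\<^sup>2"
        using Y_small[OF i] by (rule abs_ln_one_plus_x_minus_x_bound)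
      also have "\<dots> = 2 * \<bar>Y i\<bar> * \<bar>Y i\<bar>" by (simp add: power2_eq_square)
      also have "\<dots> \<le> 1 * \<bar>Y i\<bar>" using Y_small[OF i] by (intro mult_right_mono) auto
      finally have "\<bar>ln (1 + Y i)\<bar> \<le> \<bar>2 * Y i\<bar>" by linarith
      then have "(ln (1 + Y i))\<^sup>2 \<le> (2 * Y i)\<^sup>2" by (simp only: abs_le_square_iff)
      also have "\<dots> = 4 * (Y i)\<^sup>2" by (simp add: power_mult_distrib)
      also have "\<dots> \<le> 4 * ((q i - p i)\<^sup>2 / \<mu>\<^sup>2)"
        unfolding Y_def using sq_ratio[OF \<mu>_le(2)[OF i]] by (intro mult_left_mono) auto
      finally show ?thesis by simp
    qed
    have v_bound: "(\<Sum>i\<in>S. (v i)\<^sup>2) \<le> 4 / \<mu>\<^sup>2 * D"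
    proof -
      have "(\<Sum>i\<in>S. (v i)\<^sup>2) \<le> (\<Sum>i\<in>S. v i * ln (1 + X i))"
      proof (rule sum_mono)
        fix i assume i: "i \<in> S"
        show "(v i)\<^sup>2 \<le> v i * ln (1 + X i)"
          unfolding lnX[OF i] v_def using \<gamma>_props(3)[OF i] \<gamma>'_props(3)[OF i] \<gamma>_props(4) \<gamma>'_props(4)
          by (intro diff_square_le_ln)
      qed
      also have "\<dots> = (\<Sum>i\<in>S. v i * ln (1 + Y i))" by (rule score[OF vZ])
      \<comment> \<open>Half of the left-hand side reappears and is absorbed.\<close>
      also have "\<dots> \<le> (\<Sum>i\<in>S. (v i)\<^sup>2 / 2 + (ln (1 + Y i))\<^sup>2 / 2)"
      proof (rule sum_mono)
        fix i
        show "v i * ln (1 + Y i) \<le> (v i)\<^sup>2 / 2 + (ln (1 + Y i))\<^sup>2 / 2"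
          using sum_squares_bound[of "v i" "ln (1 + Y i)"] by simp
      qed
      also have "\<dots> = (\<Sum>i\<in>S. (v i)\<^sup>2) / 2 + (\<Sum>i\<in>S. (ln (1 + Y i))\<^sup>2) / 2"
        by (simp add: sum.distrib sum_divide_distrib)
      finally have "(\<Sum>i\<in>S. (v i)\<^sup>2) \<le> (\<Sum>i\<in>S. (ln (1 + Y i))\<^sup>2)" by simp
      also have "\<dots> \<le> (\<Sum>i\<in>S. 4 / \<mu>\<^sup>2 * (q i - p i)\<^sup>2)"
        using lnY_bound by (rule sum_mono)
      finally show ?thesis by (simp add: D_def sum_distrib_left)
    qed
    have X_small: "\<bar>X i\<bar> \<le> 1 / 2" if i: "i \<in> S" for i
    proof -
      have "(v i)\<^sup>2 \<le> (\<Sum>i\<in>S. (v i)\<^sup>2)" using i by (intro member_le_sum) auto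
      also have "\<dots> \<le> 4 / \<mu>\<^sup>2 * \<eta>"
        using v_bound D_le mult_left_mono[of D \<eta> "4 / \<mu>\<^sup>2"] by (simp add: D_def)
      also have "\<dots> = (\<mu> / 2)\<^sup>2" using \<mu> by (simp add: \<eta>_def field_simps power2_eq_square power4_eq_xxxx)
      finally show ?thesis unfolding X_def using \<mu>_le(1)[OF i] by (rule ratio)
    qed
    have rem: "\<bar>(X i - ln (1 + X i)) - (Y i - ln (1 + Y i))\<bar> \<le> C * D" if i: "i \<in> S" for i
    proof -
      have "\<bar>(X i - ln (1 + X i)) - (Y i - ln (1 + Y i))\<bar> \<le> 2 * (X i)\<^sup>2 + 2 * (Y i)\<^sup>2"
        using abs_ln_one_plus_x_minus_x_bound[OF X_small[OF i]]
          abs_ln_one_plus_x_minus_x_bound[OF Y_small[OF i]] by linarith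
      also have "\<dots> \<le> 2 * ((v i)\<^sup>2 / \<mu>\<^sup>2) + 2 * ((q i - p i)\<^sup>2 / \<mu>\<^sup>2)"
        unfolding X_def Y_def using sq_ratio[OF \<mu>_le(1)[OF i]] sq_ratio[OF \<mu>_le(2)[OF i]]
        by (intro add_mono mult_left_mono) auto
      also have "\<dots> = 2 / \<mu>\<^sup>2 * ((v i)\<^sup>2 + (q i - p i)\<^sup>2)" by (simp add: algebra_simps)
      also have "\<dots> \<le> 2 / \<mu>\<^sup>2 * (4 / \<mu>\<^sup>2 * D + D)"
      proof (intro mult_left_mono add_mono member_D[OF i])
        have "(v i)\<^sup>2 \<le> (\<Sum>i\<in>S. (v i)\<^sup>2)" using i by (intro member_le_sum) auto
        then show "(v i)\<^sup>2 \<le> 4 / \<mu>\<^sup>2 * D" using v_bound by linarith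
      qed simp
      also have "\<dots> = C * D" by (simp add: C_def algebra_simps)
      finally show ?thesis .
    qed
    \<comment> \<open>By \<open>score\<close> the logarithms cancel against \<open>a\<close>,
      leaving only the second-order remainders.\<close>
    have "(\<Sum>i\<in>S. a i * (X i - Y i)) = (\<Sum>i\<in>S. a i * ((X i - ln (1 + X i)) - (Y i - ln (1 + Y i))))"
      using score[OF a] by (simp add: algebra_simps sum.distrib sum_subtractf)
    then have "\<bar>\<Sum>i\<in>S. a i * (X i - Y i)\<bar> \<le> (\<Sum>i\<in>S. \<bar>a i * ((X i - ln (1 + X i)) - (Y i - ln (1 + Y i)))\<bar>)"
      using sum_abs[of "\<lambda>i. a i * ((X i - ln (1 + X i)) - (Y i - ln (1 + Y i)))" S] by simp
    also have "\<dots> \<le> (\<Sum>i\<in>S. \<bar>a i\<bar> * (C * D))"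
      unfolding abs_mult using rem by (intro sum_mono mult_left_mono) auto
    also have "\<dots> = C * (\<Sum>i\<in>S. \<bar>a i\<bar>) * D" by (simp add: sum_distrib_right[symmetric])
    finally show ?thesis by (simp add: X_def Y_def v_def \<gamma>'_def D_def)
  qed
  moreover have "0 < \<eta>" "0 \<le> C" using \<mu> by (auto simp: \<eta>_def C_def)
  ultimately show ?thesis unfolding \<gamma>_def by blast
qed

end

subsection \<open>Sampling\<close>

text \<open>Off-diagonal products have expectation 0 by independence and centring; boundedness
  supplies integrability.\<close>

lemma (in prob_space) second_moment_sum_le:
  fixes Y :: "nat \<Rightarrow> 'a \<Rightarrow> real"
  assumes indep: "indep_vars (\<lambda>_. borel) Y {1..}"
    and bound: "\<And>k \<omega>. \<bar>Y k \<omega>\<bar> \<le> B"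
    and mean: "\<And>k. 1 \<le> k \<Longrightarrow> expectation (Y k) = 0"
    and var: "\<And>k. 1 \<le> k \<Longrightarrow> expectation (\<lambda>\<omega>. (Y k \<omega>)\<^sup>2) \<le> v"
  shows "expectation (\<lambda>\<omega>. (\<Sum>k=1..n. Y k \<omega>)\<^sup>2) \<le> real n * v"
proof -
  have rv: "random_variable borel (Y k)" if "1 \<le> k" for k
    using indep that by (auto simp: indep_vars_def)
  have int: "integrable M (Y k)" if "1 \<le> k" for k
    using bound by (intro integrable_const_bound[of _ B] rv[OF that]) auto
  have int2: "integrable M (\<lambda>\<omega>. Y k \<omega> * Y l \<omega>)" if "1 \<le> k" "1 \<le> l" for k l
  proof (rule integrable_const_bound[of _ "B * B"])
    have "0 \<le> B" using bound[of 0 undefined] by linarith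
    then show "AE \<omega> in M. norm (Y k \<omega> * Y l \<omega>) \<le> B * B"
      using bound by (intro AE_I2) (auto simp: abs_mult intro!: mult_mono)
    show "(\<lambda>\<omega>. Y k \<omega> * Y l \<omega>) \<in> borel_measurable M"
      using rv[OF that(1)] rv[OF that(2)] by measurable
  qed
  have off: "expectation (\<lambda>\<omega>. Y k \<omega> * Y l \<omega>) = 0" if "1 \<le> k" "1 \<le> l" "k \<noteq> l" for k l
  proof -
    have "indep_vars (\<lambda>_. borel) Y {k, l}"
      using indep_vars_subset[OF indep, of "{k, l}"] that by auto
    then have "expectation (\<lambda>\<omega>. \<Prod>i\<in>{k, l}. Y i \<omega>) = (\<Prod>i\<in>{k, l}. expectation (Y i))"
      using int that by (intro indep_vars_lebesgue_integral) auto
    then show ?thesis using that mean by simp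
  qed
  have "expectation (\<lambda>\<omega>. (\<Sum>k=1..n. Y k \<omega>)\<^sup>2)
      = expectation (\<lambda>\<omega>. \<Sum>k=1..n. \<Sum>l=1..n. Y k \<omega> * Y l \<omega>)"
    by (simp add: power2_eq_square sum_product)
  also have "\<dots> = (\<Sum>k=1..n. \<Sum>l=1..n. expectation (\<lambda>\<omega>. Y k \<omega> * Y l \<omega>))"
    by (subst Bochner_Integration.integral_sum,
        intro Bochner_Integration.integrable_sum int2, simp, simp, intro sum.cong refl
        Bochner_Integration.integral_sum int2) auto
  also have "\<dots> = (\<Sum>k=1..n. expectation (\<lambda>\<omega>. (Y k \<omega>)\<^sup>2))"
  proof (intro sum.cong refl)
    fix k assume k: "k \<in> {1..n}"
    have "(\<Sum>l=1..n. expectation (\<lambda>\<omega>. Y k \<omega> * Y l \<omega>))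
        = (\<Sum>l=1..n. if l = k then expectation (\<lambda>\<omega>. (Y k \<omega>)\<^sup>2) else 0)"
      using off k by (intro sum.cong) (auto simp: power2_eq_square)
    then show "(\<Sum>l=1..n. expectation (\<lambda>\<omega>. Y k \<omega> * Y l \<omega>)) = expectation (\<lambda>\<omega>. (Y k \<omega>)\<^sup>2)"
      using k by simp
  qed
  also have "\<dots> \<le> (\<Sum>k=1..n. v)" using var by (intro sum_mono) auto
  finally show ?thesis by simp
qed

section \<open>The sample and its smoothed empirical array\<close>

locale copula_sample = copula_basis d r S \<Delta>s + prob_space M
  for d :: nat and r :: "nat \<Rightarrow> nat" and S :: "multi_index set" and \<Delta>s :: "array list"
    and M :: "'w measure" +
  fixes x :: "nat \<Rightarrow> nat \<Rightarrow> real" and P :: "(nat \<Rightarrow> real) measure"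
    and X :: "nat \<Rightarrow> 'w \<Rightarrow> nat \<Rightarrow> real" and p :: array
  assumes x_mono: "\<And>l. l \<in> {1..d} \<Longrightarrow> strict_mono_on {1..r l} (x l)"
    and prob_P: "prob_space P"
    and sets_P: "sets P = sets (count_space (grid d r x))"
    and indep_X: "indep_vars (\<lambda>_. P) X {1..}"
    and distr_X: "\<And>k. 1 \<le> k \<Longrightarrow> distr M P (X k) = P"
    and p_eq: "p = prob_array d r x P"
    and p_prob: "p \<in> prob_arrays d r"
    and S_eq: "S = Supp d r p"
begin

abbreviation p_hat :: "nat \<Rightarrow> 'w \<Rightarrow> array" where
  "p_hat n \<omega> \<equiv> smoothed_array d r x S X n \<omega>"

lemma space_P: "space P = grid d r x"
  using sets_eq_imp_space_eq[OF sets_P] by simp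

text \<open>Every subset of the grid is measurable for \<open>P\<close>.\<close>

lemma measurable_P: "f \<in> space P \<rightarrow> space N \<Longrightarrow> f \<in> measurable P N"
  using measurable_cong_sets[OF sets_P refl, of N] space_P by simp

lemma measurable_X: "1 \<le> k \<Longrightarrow> X k \<in> measurable M P"
  using indep_X by (auto simp: indep_vars_def)

lemma finite_grid: "finite (grid d r x)"
  unfolding grid_def by (intro finite_PiE) auto

lemma grid_point_in_grid: "i \<in> index_set d r \<Longrightarrow> grid_point d x i \<in> grid d r x"
  by (auto simp: grid_point_def grid_def index_set_def)

lemma grid_point_inj: "inj_on (grid_point d x) (index_set d r)"
proof (rule inj_onI)
  fix i i' assume i: "i \<in> index_set d r" "i' \<in> index_set d r"
    and eq: "grid_point d x i = grid_point d x i'"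
  have "i l = i' l" if l: "l \<in> {1..d}" for l
  proof -
    have "x l (i l) = x l (i' l)"
      using fun_cong[OF eq, of l] l by (simp add: grid_point_def)
    then show ?thesis
      using strict_mono_on_imp_inj_on[OF x_mono[OF l]] index_set_component[OF i(1) l]
        index_set_component[OF i(2) l] by (auto dest: inj_onD)
  qed
  then show "i = i'" using i unfolding index_set_def by (intro PiE_ext)
qed

lemma p_props:
  "i \<in> S \<Longrightarrow> 0 < p i" "0 \<le> p i" "p i \<le> 1" "(\<Sum>i\<in>S. p i) = 1" "p \<in> arrays d r"
proof -
  show arr: "p \<in> arrays d r" using p_prob by (simp add: prob_arrays_def)
  show p01: "0 \<le> p i" "p i \<le> 1" for i
    using p_prob by (cases "i \<in> index_set d r"; simp add: prob_arrays_def arrays_def)+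
  show "0 < p i" if "i \<in> S"
    using that p01(1)[of i] by (auto simp: S_eq Supp_def)
  have "(\<Sum>i\<in>S. p i) = (\<Sum>i\<in>index_set d r. p i)"
    by (intro sum.mono_neutral_left) (auto simp: S_eq Supp_def)
  then show "(\<Sum>i\<in>S. p i) = 1" using p_prob by (simp add: prob_arrays_def)
qed

lemma p_positive: "positive_on_S p"
  unfolding positive_on_S_def by (intro conjI ballI S_eq[symmetric] p_props(1))

definition hit :: "multi_index \<Rightarrow> nat \<Rightarrow> 'w \<Rightarrow> real" where
  "hit i k \<omega> = indicator {grid_point d x i} (X k \<omega>)"

lemma hit_measurable [measurable]:
  assumes "1 \<le> k"
  shows "hit i k \<in> borel_measurable M"
proof -
  have "(\<lambda>y. indicator {grid_point d x i} y :: real) \<in> borel_measurable P"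
    by (intro measurable_P) auto
  then show ?thesis
    unfolding hit_def[abs_def] by (rule measurable_compose[OF measurable_X[OF assms]])
qed

lemma hit_bounds: "0 \<le> hit i k \<omega>" "hit i k \<omega> \<le> 1"
  by (auto simp: hit_def indicator_def)

lemma hit_integrable: "1 \<le> k \<Longrightarrow> integrable M (hit i k)"
  using hit_bounds by (intro integrable_const_bound[of _ 1] hit_measurable) auto

lemma expectation_hit:
  assumes i: "i \<in> index_set d r" and k: "1 \<le> k"
  shows "expectation (hit i k) = p i"
proof -
  have A: "{grid_point d x i} \<in> sets P"
    using grid_point_in_grid[OF i] by (simp add: sets_P)
  have "expectation (hit i k) = expectation (indicator (X k -` {grid_point d x i} \<inter> space M))"
    by (intro Bochner_Integration.integral_cong) (auto simp: hit_def indicator_def)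
  also have "\<dots> = measure M (X k -` {grid_point d x i} \<inter> space M)"
    using measurable_sets[OF measurable_X[OF k] A] by simp
  also have "\<dots> = measure (distr M P (X k)) {grid_point d x i}"
    using measurable_X[OF k] A by (simp add: measure_distr)
  also have "\<dots> = p i" using distr_X[OF k] i by (simp add: p_eq prob_array_def)
  finally show ?thesis .
qed

text \<open>An event of probability 1. Outside it, \<open>p_hat n\<close> may charge cells off
  \<open>S\<close>, and its projection need not be of the form \<open>copula_param\<close>.\<close>

definition regular :: "'w \<Rightarrow> bool" where
  "regular \<omega> \<longleftrightarrow> (\<forall>k\<ge>1. X k \<omega> \<in> grid_point d x ` S)"

lemma AE_regular: "AE \<omega> in M. regular \<omega>"
proof -
  interpret P: prob_space P by (rule prob_P)
  have sub: "grid_point d x ` S \<subseteq> grid d r x" using S_subset grid_point_in_grid by auto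
  have "measure P (grid_point d x ` S) = (\<Sum>y\<in>grid_point d x ` S. measure P {y})"
    using sub by (intro P.finite_measure_eq_sum_singleton) (auto simp: sets_P)
  also have "\<dots> = (\<Sum>i\<in>S. measure P {grid_point d x i})"
    using inj_on_subset[OF grid_point_inj S_subset] by (simp add: sum.reindex)
  also have "\<dots> = (\<Sum>i\<in>S. p i)"
    using S_subset by (intro sum.cong) (auto simp: p_eq prob_array_def)
  finally have "AE y in P. y \<in> grid_point d x ` S"
    by (intro P.AE_prob_1) (simp add: p_props(4))
  then have "AE \<omega> in M. X k \<omega> \<in> grid_point d x ` S" if "1 \<le> k" for k
    using AE_distrD[OF measurable_X[OF that], of "\<lambda>y. y \<in> grid_point d x ` S"]
    by (simp only: distr_X[OF that])
  then have "AE \<omega> in M. \<forall>k. 1 \<le> k \<longrightarrow> X k \<omega> \<in> grid_point d x ` S"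
    by (subst AE_all_countable) auto
  then show ?thesis by (simp add: regular_def)
qed

lemma empirical_eq:
  "i \<in> index_set d r \<Longrightarrow> empirical_array d r x X n \<omega> i = (\<Sum>k=1..n. hit i k \<omega>) / real n"
  by (simp add: empirical_array_def hit_def)

lemma empirical_bounds:
  "0 \<le> empirical_array d r x X n \<omega> i" "empirical_array d r x X n \<omega> i \<le> 1"
proof -
  have *: "0 \<le> empirical_array d r x X n \<omega> i \<and> empirical_array d r x X n \<omega> i \<le> 1"
  proof (cases "i \<in> index_set d r")
    case True
    have "(\<Sum>k=1..n. hit i k \<omega>) \<le> (\<Sum>k=1..n. 1)" by (intro sum_mono hit_bounds)
    then show ?thesis
      using hit_bounds by (simp add: empirical_eq[OF True] sum_nonneg divide_le_eq)
  qed (simp add: empirical_array_def)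
  then show "0 \<le> empirical_array d r x X n \<omega> i" "empirical_array d r x X n \<omega> i \<le> 1" by auto
qed

lemma p_hat_eq: "p_hat n \<omega> i = real n / real (n + 1) * empirical_array d r x X n \<omega> i + 1 / real (n + 1) * U i"
  by (simp add: smoothed_array_def array_scale_def)

lemma U_bounds: "0 \<le> U i" "U i \<le> 1" "i \<in> S \<Longrightarrow> 0 < U i" "i \<notin> S \<Longrightarrow> U i = 0"
  using card_S_pos by (auto simp: uniform_on_def indicator_def)

text \<open>The uniform component makes unobserved cells of \<open>S\<close> positive, and
  regularity keeps all other cells at 0.\<close>

lemma p_hat_positive:
  assumes "regular \<omega>"
  shows "positive_on_S (p_hat n \<omega>)"
proof -
  have pos: "0 < p_hat n \<omega> i" if "i \<in> S" for i
    unfolding p_hat_eq using U_bounds(3)[OF that] empirical_bounds(1)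
    by (intro add_nonneg_pos mult_nonneg_nonneg mult_pos_pos) auto
  have "p_hat n \<omega> i = 0" if i: "i \<in> index_set d r" "i \<notin> S" for i
  proof -
    have "hit i k \<omega> = 0" if k: "k \<in> {1..n}" for k
    proof -
      obtain i' where "i' \<in> S" "X k \<omega> = grid_point d x i'"
        using assms k unfolding regular_def by auto
      then show ?thesis
        using i S_subset inj_onD[OF grid_point_inj, of i' i] by (auto simp: hit_def indicator_def)
    qed
    then have "empirical_array d r x X n \<omega> i = 0" by (simp add: empirical_eq[OF i(1)])
    then show ?thesis using U_bounds(4)[OF i(2)] by (simp add: p_hat_eq)
  qed
  then have "Supp d r (p_hat n \<omega>) = S"
    using pos S_subset by (auto simp: Supp_def) (metis less_irrefl)
  then show ?thesis using pos by (simp add: positive_on_S_def)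
qed

text \<open>Finitely many observations from a finite grid leave finitely many possible arrays. Hence
  every function of \<open>p_hat n\<close>, including the projection and its parameter, is
  measurable and integrable without any continuity argument.\<close>

lemma p_hat_simple: "simple_function M (p_hat n)"
proof -
  have X_simple: "simple_function M (X k)" if "1 \<le> k" for k
    unfolding simple_function_def
  proof (intro conjI ballI)
    have sub: "X k ` space M \<subseteq> grid d r x"
      using measurable_space[OF measurable_X[OF that]] space_P by auto
    then show "finite (X k ` space M)" using finite_grid finite_subset by blast
    fix y assume "y \<in> X k ` space M"
    then have "{y} \<in> sets P" using sub by (auto simp: sets_P)
    then show "X k -` {y} \<inter> space M \<in> events" by (rule measurable_sets[OF measurable_X[OF that]])
  qed
  define g :: "(nat \<Rightarrow> real) \<Rightarrow> array"
    where "g = (\<lambda>y i. if i \<in> index_set d r then indicator {grid_point d x i} y else 0)"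
  have "simple_function M (\<lambda>\<omega>. \<Sum>k=1..n. g (X k \<omega>))"
    by (intro simple_function_sum simple_function_compose1[OF X_simple]) auto
  then have "simple_function M (\<lambda>\<omega>. array_scale (real n / real (n + 1))
      (array_scale (1 / real n) (\<Sum>k=1..n. g (X k \<omega>))) + array_scale (1 / real (n + 1)) U)"
    by (rule simple_function_compose1)
  also have "(\<lambda>\<omega>. array_scale (real n / real (n + 1))
      (array_scale (1 / real n) (\<Sum>k=1..n. g (X k \<omega>))) + array_scale (1 / real (n + 1)) U) = p_hat n"
  proof -
    have "(\<Sum>k\<in>K. g (X k \<omega>)) i = (\<Sum>k\<in>K. g (X k \<omega>) i)" for K \<omega> i
      by (induction K rule: infinite_finite_induct) auto
    then have "array_scale (1 / real n) (\<Sum>k=1..n. g (X k \<omega>)) = empirical_array d r x X n \<omega>" for \<omega>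
      by (auto simp: array_scale_def empirical_array_def g_def fun_eq_iff)
    then show ?thesis by (simp add: smoothed_array_def)
  qed
  finally show ?thesis .
qed

lemma p_hat_measurable [measurable]: "(\<lambda>\<omega>. f (p_hat n \<omega>) :: real) \<in> borel_measurable M"
  by (intro borel_measurable_simple_function simple_function_compose1[OF p_hat_simple])

lemma p_hat_integrable:
  fixes f :: "array \<Rightarrow> 'b::{banach, second_countable_topology}"
  shows "integrable M (\<lambda>\<omega>. f (p_hat n \<omega>))"
proof (rule integrable_const_bound)
  have fin: "finite ((\<lambda>\<omega>. norm (f (p_hat n \<omega>))) ` space M)"
    by (rule simple_functionD(1)[OF simple_function_compose1[OF p_hat_simple]])
  show "AE \<omega> in M. norm (f (p_hat n \<omega>)) \<le> Max ((\<lambda>\<omega>. norm (f (p_hat n \<omega>))) ` space M)"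
    by (intro AE_I2 Max_ge[OF fin] imageI)
qed (intro borel_measurable_simple_function simple_function_compose1[OF p_hat_simple])

text \<open>Each cell contributes at most \<open>2 / n\<close> from the variance of a frequency and
  at most \<open>2 / n\<close> from smoothing; the factors 2 come from the square of a sum.\<close>

lemma expectation_p_hat_deviation:
  assumes "1 \<le> n"
  shows "expectation (\<lambda>\<omega>. \<Sum>i\<in>S. (p_hat n \<omega> i - p i)\<^sup>2) \<le> 4 * real (card S) / real n"
proof -
  define E where "E = (\<lambda>\<omega> i. \<Sum>k=1..n. hit i k \<omega> - p i)"
  have n: "0 < real n" using assms by simp
  have E_sq: "expectation (\<lambda>\<omega>. (E \<omega> i)\<^sup>2) \<le> real n * 1" if i: "i \<in> S" for i
    unfolding E_def
  proof (rule second_moment_sum_le)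
    have "i \<in> index_set d r" using i S_subset by blast
    have "indep_vars (\<lambda>_. borel) (\<lambda>k \<omega>. (\<lambda>y. indicator {grid_point d x i} y - p i) (X k \<omega>)) {1..}"
      by (rule indep_vars_compose2[OF indep_X]) (auto intro: measurable_P)
    then show "indep_vars (\<lambda>_. borel) (\<lambda>k \<omega>. hit i k \<omega> - p i) {1..}" by (simp add: hit_def)
    show bound: "\<bar>hit i k \<omega> - p i\<bar> \<le> 1" for k \<omega>
      using hit_bounds[of i k \<omega>] p_props(2,3)[of i] by linarith
    fix k :: nat assume k: "1 \<le> k"
    show "expectation (\<lambda>\<omega>. hit i k \<omega> - p i) = 0"
      using expectation_hit[OF \<open>i \<in> index_set d r\<close> k] hit_integrable[OF k] by (simp add: prob_space)
    have "(hit i k \<omega> - p i)\<^sup>2 \<le> 1" for \<omega>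
      using bound[of k \<omega>] by (simp add: abs_square_le_1)
    moreover have "integrable M (\<lambda>\<omega>. (hit i k \<omega> - p i)\<^sup>2)"
      using calculation hit_measurable[OF k] by (intro integrable_const_bound[of _ 1]) auto
    ultimately show "expectation (\<lambda>\<omega>. (hit i k \<omega> - p i)\<^sup>2) \<le> 1"
      using integral_mono[of M "\<lambda>\<omega>. (hit i k \<omega> - p i)\<^sup>2" "\<lambda>_. 1"] by (simp add: prob_space)
  qed
  have E_meas: "(\<lambda>\<omega>. E \<omega> i) \<in> borel_measurable M" for i
    unfolding E_def by (intro borel_measurable_sum borel_measurable_diff hit_measurable) auto
  have E_bound: "(E \<omega> i)\<^sup>2 \<le> (real n)\<^sup>2" for \<omega> i
  proof -
    have "\<bar>E \<omega> i\<bar> \<le> (\<Sum>k=1..n. \<bar>hit i k \<omega> - p i\<bar>)" unfolding E_def by (rule sum_abs)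
    also have "\<dots> \<le> (\<Sum>k=1..n. 1)"
    proof (rule sum_mono)
      show "\<bar>hit i k \<omega> - p i\<bar> \<le> 1" for k
        using hit_bounds[of i k \<omega>] p_props(2,3)[of i] by linarith
    qed
    finally show ?thesis by (simp add: abs_le_square_iff[symmetric])
  qed
  have E_int: "integrable M (\<lambda>\<omega>. (E \<omega> i)\<^sup>2)" for i
    using E_bound E_meas by (intro integrable_const_bound[of _ "(real n)\<^sup>2"]) auto
  have pointwise: "(p_hat n \<omega> i - p i)\<^sup>2 \<le> 2 / (real n)\<^sup>2 * (E \<omega> i)\<^sup>2 + 2 / real n" if i: "i \<in> S" for \<omega> i
  proof -
    have emp: "empirical_array d r x X n \<omega> i = E \<omega> i / real n + p i"
      using i S_subset n by (subst empirical_eq) (auto simp: E_def sum_subtractf field_simps)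
    \<comment> \<open>\<open>A\<close> is the sampling error and \<open>B\<close> the bias caused by
      smoothing.\<close>
    define A where "A = real n / real (n + 1) * (E \<omega> i / real n)"
    define B where "B = (U i - p i) / real (n + 1)"
    have "p_hat n \<omega> i - p i = A + B"
    proof -
      define c where "c = 1 / real (n + 1)"
      have n_frac: "real n / real (n + 1) = 1 - c" by (simp add: c_def field_simps)
      have B: "B = c * (U i - p i)" by (simp add: B_def c_def)
      show ?thesis
        unfolding p_hat_eq emp A_def B n_frac c_def[symmetric] by (simp only: algebra_simps)
    qed
    then have "(p_hat n \<omega> i - p i)\<^sup>2 \<le> 2 * A\<^sup>2 + 2 * B\<^sup>2"
      using sum_squares_bound[of A B] by (simp add: power2_sum)
    moreover have "A\<^sup>2 \<le> (E \<omega> i / real n)\<^sup>2"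
      unfolding A_def power_mult_distrib using n
      by (intro mult_left_le_one_le) (auto simp: power_le_one)
    moreover have "B\<^sup>2 \<le> 1 / real n"
    proof -
      have "\<bar>U i - p i\<bar> \<le> 1" using U_bounds(1,2)[of i] p_props(2,3)[of i] by linarith
      then have "(U i - p i)\<^sup>2 \<le> 1" by (simp add: abs_square_le_1)
      then have "B\<^sup>2 \<le> 1 / (real (n + 1))\<^sup>2"
        unfolding B_def power_divide by (intro divide_right_mono) auto
      also have "\<dots> \<le> 1 / real n"
      proof (rule divide_left_mono)
        show "real n \<le> (real (n + 1))\<^sup>2" by (simp add: power2_eq_square algebra_simps)
        show "0 < (real (n + 1))\<^sup>2 * real n" using n by (intro mult_pos_pos) auto
      qed simp
      finally show ?thesis .
    qed
    ultimately show ?thesis by (simp add: power_divide)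
  qed
  have "expectation (\<lambda>\<omega>. \<Sum>i\<in>S. (p_hat n \<omega> i - p i)\<^sup>2)
      \<le> expectation (\<lambda>\<omega>. \<Sum>i\<in>S. 2 / (real n)\<^sup>2 * (E \<omega> i)\<^sup>2 + 2 / real n)"
  proof (rule integral_mono)
    show "integrable M (\<lambda>\<omega>. \<Sum>i\<in>S. 2 / (real n)\<^sup>2 * (E \<omega> i)\<^sup>2 + 2 / real n)"
      using E_int by (intro Bochner_Integration.integrable_sum) auto
    show "(\<Sum>i\<in>S. (p_hat n \<omega> i - p i)\<^sup>2) \<le> (\<Sum>i\<in>S. 2 / (real n)\<^sup>2 * (E \<omega> i)\<^sup>2 + 2 / real n)" for \<omega>
      using pointwise by (rule sum_mono)
    show "integrable M (\<lambda>\<omega>. \<Sum>i\<in>S. (p_hat n \<omega> i - p i)\<^sup>2)"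
      by (rule p_hat_integrable)
  qed
  also have "\<dots> = (\<Sum>i\<in>S. 2 / (real n)\<^sup>2 * expectation (\<lambda>\<omega>. (E \<omega> i)\<^sup>2) + 2 / real n)"
    using E_int by (simp add: Bochner_Integration.integral_sum prob_space)
  also have "\<dots> \<le> (\<Sum>i\<in>S. 2 / (real n)\<^sup>2 * (real n * 1) + 2 / real n)"
    using E_sq by (intro sum_mono add_mono mult_left_mono) auto
  also have "\<dots> = 4 * real (card S) / real n"
    using n by (simp add: power2_eq_square)
  finally show ?thesis .
qed

end

subsection \<open>The limit law\<close>

context copula_sample
begin

text \<open>An observation hits at most one cell, so cross terms vanish and second moments reduce to
  expectations of hits.\<close>

lemma hit_sum_square:
  "(\<Sum>i\<in>S. c i * hit i k \<omega>)\<^sup>2 = (\<Sum>i\<in>S. (c i)\<^sup>2 * hit i k \<omega>)"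
proof (cases "\<exists>i0\<in>S. X k \<omega> = grid_point d x i0")
  case True
  then obtain i0 where i0: "i0 \<in> S" "X k \<omega> = grid_point d x i0" by blast
  have hit: "hit i k \<omega> = (if i = i0 then 1 else 0)" if "i \<in> S" for i
    using inj_onD[OF grid_point_inj, of i0 i] that i0 S_subset by (auto simp: hit_def indicator_def)
  have "(\<Sum>i\<in>S. b i * hit i k \<omega>) = b i0" for b
  proof -
    have "(\<Sum>i\<in>S. b i * hit i k \<omega>) = (\<Sum>i\<in>S. if i = i0 then b i0 else 0)"
      using hit by (intro sum.cong) auto
    then show ?thesis using i0 by simp
  qed
  then show ?thesis by simp
next
  case False
  then have "hit i k \<omega> = 0" if "i \<in> S" for i
    using that by (auto simp: hit_def indicator_def)
  then show ?thesis by simp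
qed

text \<open>The function \<open>a / p\<close> at the observed cell. For \<open>a \<in> Z\<close> it
  has mean 0 and variance \<open>wip S (\<lambda>i. 1 / p i) a a\<close>, and its sum over the
  sample is the linear part of the deviation of the projection.\<close>

definition score :: "array \<Rightarrow> nat \<Rightarrow> 'w \<Rightarrow> real" where
  "score a k \<omega> = (\<Sum>i\<in>S. a i / p i * hit i k \<omega>)"

lemma score_measurable: "1 \<le> k \<Longrightarrow> score a k \<in> borel_measurable M"
  unfolding score_def[abs_def]
  by (intro borel_measurable_sum borel_measurable_times borel_measurable_const hit_measurable)

lemma score_characteristic_function:
  assumes a: "a \<in> Z" and pos: "0 < wip S (\<lambda>i. 1 / p i) a a"
  shows "(\<lambda>n. CLINT \<omega>|M. iexp ((\<Sum>k=1..n. score a k \<omega>) / sqrt (real n)))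
    \<longlonglongrightarrow> complex_of_real (exp (- wip S (\<lambda>i. 1 / p i) a a / 2))"
proof (rule clt_characteristic_function[where \<mu> = "distr P borel (\<lambda>y. \<Sum>i\<in>S. a i / p i * indicator {grid_point d x i} y)"])
  define h where "h = (\<lambda>y. \<Sum>i\<in>S. a i / p i * indicator {grid_point d x i} y)"
  have h: "h \<in> borel_measurable P" by (intro measurable_P) auto
  have score_h: "score a k = (\<lambda>\<omega>. h (X k \<omega>))" for k
    by (simp add: score_def[abs_def] hit_def h_def)
  show "indep_vars (\<lambda>_. borel) (score a) {1..}"
    unfolding score_h[abs_def] by (rule indep_vars_compose2[OF indep_X h])
  fix k :: nat assume k: "1 \<le> k"
  have "distr M borel (score a k) = distr (distr M P (X k)) borel h"
    unfolding score_h using distr_distr[OF h measurable_X[OF k]] by (simp add: o_def)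
  then show "distr M borel (score a k) = distr P borel (\<lambda>y. \<Sum>i\<in>S. a i / p i * indicator {grid_point d x i} y)"
    by (simp add: distr_X[OF k] h_def)
  have E: "expectation (\<lambda>\<omega>. \<Sum>i\<in>S. c i * hit i k \<omega>) = (\<Sum>i\<in>S. c i * p i)" for c
  proof -
    have "expectation (\<lambda>\<omega>. \<Sum>i\<in>S. c i * hit i k \<omega>) = (\<Sum>i\<in>S. expectation (\<lambda>\<omega>. c i * hit i k \<omega>))"
      by (intro Bochner_Integration.integral_sum integrable_mult_right hit_integrable[OF k])
    also have "\<dots> = (\<Sum>i\<in>S. c i * p i)"
      using expectation_hit[OF _ k] S_subset by (intro sum.cong) auto
    finally show ?thesis .
  qed
  have p_nz: "p i \<noteq> 0" if "i \<in> S" for i using p_props(1)[OF that] by simp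
  have "expectation (score a k) = (\<Sum>i\<in>S. a i / p i * p i)"
    unfolding score_def[abs_def] by (rule E)
  also have "\<dots> = (\<Sum>i\<in>S. a i)" using p_nz by (intro sum.cong) auto
  finally show "expectation (score a k) = 0" using sum_zero_margin_space[OF a] by simp
  show "integrable M (\<lambda>\<omega>. (score a k \<omega>)\<^sup>2)"
    unfolding score_def hit_sum_square
    by (intro Bochner_Integration.integrable_sum integrable_mult_right hit_integrable[OF k])
  have "expectation (\<lambda>\<omega>. (score a k \<omega>)\<^sup>2) = (\<Sum>i\<in>S. (a i / p i)\<^sup>2 * p i)"
    unfolding score_def hit_sum_square by (rule E)
  also have "\<dots> = wip S (\<lambda>i. 1 / p i) a a"
    unfolding wip_def using p_nz by (intro sum.cong) (auto simp: power2_eq_square)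
  finally show "expectation (\<lambda>\<omega>. (score a k \<omega>)\<^sup>2) = wip S (\<lambda>i. 1 / p i) a a" .
qed (rule pos)

text \<open>With \<open>a = e j\<close> this is the coordinate squared in
  \<open>Sigma_quadratic_form\<close>, scaled by sqrt n.\<close>

definition projected_deviation :: "array \<Rightarrow> nat \<Rightarrow> 'w \<Rightarrow> real" where
  "projected_deviation a n \<omega> = sqrt (real n) *
    (\<Sum>i\<in>S. a i * ((I_proj d r (p_hat n \<omega>) i - I_proj d r p i) / I_proj d r p i))"

lemma projected_deviation_measurable: "projected_deviation a n \<in> borel_measurable M"
  unfolding projected_deviation_def[abs_def]
  by (rule p_hat_measurable[of "\<lambda>q. sqrt (real n) *
    (\<Sum>i\<in>S. a i * ((I_proj d r q i - I_proj d r p i) / I_proj d r p i))"])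

lemma score_sum_eq:
  assumes a: "a \<in> Z" and n: "1 \<le> n"
  shows "(\<Sum>k=1..n. score a k \<omega>) / sqrt (real n)
    = sqrt (real n) * (\<Sum>i\<in>S. a i / p i * (empirical_array d r x X n \<omega> i - p i))"
proof -
  have p_nz: "p i \<noteq> 0" if "i \<in> S" for i using p_props(1)[OF that] by simp
  have n0: "0 < real n" using n by simp
  have "(\<Sum>k=1..n. score a k \<omega>) = (\<Sum>i\<in>S. \<Sum>k=1..n. a i / p i * hit i k \<omega>)"
    unfolding score_def by (rule sum.swap)
  also have "\<dots> = (\<Sum>i\<in>S. real n * (a i / p i * empirical_array d r x X n \<omega> i))"
  proof (intro sum.cong refl)
    fix i assume "i \<in> S"
    then have "i \<in> index_set d r" using S_subset by blast
    then have "(\<Sum>k=1..n. hit i k \<omega>) = real n * empirical_array d r x X n \<omega> i"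
      using n0 by (simp add: empirical_eq)
    then have "a i / p i * (\<Sum>k=1..n. hit i k \<omega>) = real n * (a i / p i * empirical_array d r x X n \<omega> i)"
      by simp
    then show "(\<Sum>k=1..n. a i / p i * hit i k \<omega>) = real n * (a i / p i * empirical_array d r x X n \<omega> i)"
      unfolding sum_distrib_left .
  qed
  also have "\<dots> = real n * (\<Sum>i\<in>S. a i / p i * empirical_array d r x X n \<omega> i)"
    by (simp only: sum_distrib_left)
  \<comment> \<open>Centring at \<open>p\<close> is free, since pairing \<open>a / p\<close> with
    \<open>p\<close> gives the sum of \<open>a\<close>, which is 0.\<close>
  also have "(\<Sum>i\<in>S. a i / p i * empirical_array d r x X n \<omega> i)
      = (\<Sum>i\<in>S. a i / p i * (empirical_array d r x X n \<omega> i - p i) + a i)"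
    using p_nz by (intro sum.cong) (auto simp: right_diff_distrib)
  also have "\<dots> = (\<Sum>i\<in>S. a i / p i * (empirical_array d r x X n \<omega> i - p i))"
    by (simp add: sum.distrib sum_zero_margin_space[OF a])
  finally have "(\<Sum>k=1..n. score a k \<omega>) / sqrt (real n)
      = (real n / sqrt (real n)) * (\<Sum>i\<in>S. a i / p i * (empirical_array d r x X n \<omega> i - p i))"
    by simp
  then show ?thesis using n0 by (simp add: real_div_sqrt)
qed

text \<open>For a deviation \<open>D\<close> up to \<open>\<eta>\<close>, the linearisation costs
  \<open>c1 * sqrt n * D\<close> and the smoothing \<open>c2 / sqrt n\<close>. For larger
  \<open>D\<close> the trivial bound 2 is below \<open>2 / \<eta> * sqrt n * D\<close>, which
  explains the last summand of \<open>K\<close> and makes the estimate valid for every regular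
  sample.\<close>

lemma projected_deviation_approx:
  assumes a: "a \<in> Z"
  shows "\<exists>K. \<forall>n\<ge>1. \<forall>\<omega>. regular \<omega> \<longrightarrow>
    cmod (iexp (projected_deviation a n \<omega>) - iexp ((\<Sum>k=1..n. score a k \<omega>) / sqrt (real n)))
      \<le> K / sqrt (real n) + K * sqrt (real n) * (\<Sum>i\<in>S. (p_hat n \<omega> i - p i)\<^sup>2)"
proof -
  obtain \<eta> C where \<eta>: "0 < \<eta>" and C: "0 \<le> C"
    and lin: "\<And>q. positive_on_S q \<Longrightarrow> (\<Sum>i\<in>S. (q i - p i)\<^sup>2) \<le> \<eta> \<Longrightarrow>
      \<bar>\<Sum>i\<in>S. a i * ((I_proj d r q i - I_proj d r p i) / I_proj d r p i - (q i - p i) / p i)\<bar>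
        \<le> C * (\<Sum>i\<in>S. \<bar>a i\<bar>) * (\<Sum>i\<in>S. (q i - p i)\<^sup>2)"
    using I_proj_linearisation[OF p_positive] a by meson
  define c1 where "c1 = C * (\<Sum>i\<in>S. \<bar>a i\<bar>)"
  define c2 where "c2 = (\<Sum>i\<in>S. \<bar>a i / p i\<bar>)"
  define K where "K = c1 + c2 + 2 / \<eta>"
  have c: "0 \<le> c1" "0 \<le> c2" "0 \<le> 2 / \<eta>" using C \<eta> by (auto simp: c1_def c2_def sum_nonneg)
  have "cmod (iexp (projected_deviation a n \<omega>) - iexp ((\<Sum>k=1..n. score a k \<omega>) / sqrt (real n)))
      \<le> K / sqrt (real n) + K * sqrt (real n) * D"
    if n: "1 \<le> n" and \<omega>: "regular \<omega>" and D_def: "D = (\<Sum>i\<in>S. (p_hat n \<omega> i - p i)\<^sup>2)" for n \<omega> D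
  proof -
    define s where "s = sqrt (real n)"
    have s: "1 \<le> s" "s * s = real n" using n by (auto simp: s_def)
    have D: "0 \<le> D" unfolding D_def by (simp add: sum_nonneg)
    define q where "q = p_hat n \<omega>"
    define emp where "emp = empirical_array d r x X n \<omega>"
    show ?thesis
    proof (cases "D \<le> \<eta>")
      case False
      have "2 / \<eta> * s * D \<le> K * s * D"
        using c s D by (intro mult_right_mono) (auto simp: K_def)
      moreover have "0 \<le> K / s" using c s by (simp add: K_def)
      moreover have "2 \<le> 2 / \<eta> * s * D"
      proof -
        have "1 * \<eta> \<le> s * D" using False s \<eta> by (intro mult_mono) auto
        then show ?thesis using \<eta> by (simp add: field_simps)
      qed
      moreover note norm_iexp_diff_le_2[of "projected_deviation a n \<omega>" "(\<Sum>k=1..n. score a k \<omega>) / sqrt (real n)"]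
      ultimately show ?thesis unfolding s_def[symmetric] by linarith
    next
      case True
      have "projected_deviation a n \<omega> - (\<Sum>k=1..n. score a k \<omega>) / sqrt (real n)
          = s * ((\<Sum>i\<in>S. a i * ((I_proj d r q i - I_proj d r p i) / I_proj d r p i))
            - (\<Sum>i\<in>S. a i / p i * (emp i - p i)))"
        unfolding score_sum_eq[OF a n] projected_deviation_def s_def q_def emp_def
        by (simp only: right_diff_distrib)
      also have "(\<Sum>i\<in>S. a i * ((I_proj d r q i - I_proj d r p i) / I_proj d r p i))
            - (\<Sum>i\<in>S. a i / p i * (emp i - p i))
          = (\<Sum>i\<in>S. a i * ((I_proj d r q i - I_proj d r p i) / I_proj d r p i - (q i - p i) / p i))
            + (\<Sum>i\<in>S. a i / p i * (q i - emp i))"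
        unfolding sum_subtractf[symmetric] sum.distrib[symmetric]
      proof (intro sum.cong refl)
        fix i
        show "a i * ((I_proj d r q i - I_proj d r p i) / I_proj d r p i) - a i / p i * (emp i - p i)
          = a i * ((I_proj d r q i - I_proj d r p i) / I_proj d r p i - (q i - p i) / p i)
            + a i / p i * (q i - emp i)"
          by (simp add: right_diff_distrib diff_divide_distrib)
      qed
      finally have diff: "projected_deviation a n \<omega> - (\<Sum>k=1..n. score a k \<omega>) / sqrt (real n)
          = s * ((\<Sum>i\<in>S. a i * ((I_proj d r q i - I_proj d r p i) / I_proj d r p i - (q i - p i) / p i))
            + (\<Sum>i\<in>S. a i / p i * (q i - emp i)))" .
      have 1: "\<bar>\<Sum>i\<in>S. a i * ((I_proj d r q i - I_proj d r p i) / I_proj d r p i - (q i - p i) / p i)\<bar> \<le> c1 * D"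
        using lin[OF p_hat_positive[OF \<omega>], of n] True unfolding q_def c1_def D_def by blast
      have "\<bar>\<Sum>i\<in>S. a i / p i * (q i - emp i)\<bar> \<le> (\<Sum>i\<in>S. \<bar>a i / p i * (q i - emp i)\<bar>)"
        by (rule sum_abs)
      also have "\<dots> \<le> (\<Sum>i\<in>S. \<bar>a i / p i\<bar> * (1 / real n))"
      proof (rule sum_mono)
        fix i
        define t where "t = 1 / real (n + 1)"
        have n_frac: "real n / real (n + 1) = 1 - t" by (simp add: t_def field_simps)
        have "q i - emp i = t * (U i - emp i)"
          unfolding q_def emp_def p_hat_eq n_frac t_def[symmetric] by (simp only: algebra_simps)
        moreover have "\<bar>U i - emp i\<bar> \<le> 1"
          using U_bounds(1,2)[of i] empirical_bounds[of n \<omega> i] unfolding emp_def by linarith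
        moreover have "0 \<le> t" by (simp add: t_def)
        ultimately have "\<bar>q i - emp i\<bar> \<le> t" using mult_left_le[of "\<bar>U i - emp i\<bar>" t] by (simp add: abs_mult)
        also have "t \<le> 1 / real n" using n by (simp add: t_def field_simps)
        finally show "\<bar>a i / p i * (q i - emp i)\<bar> \<le> \<bar>a i / p i\<bar> * (1 / real n)"
          unfolding abs_mult by (intro mult_left_mono) auto
      qed
      also have "\<dots> = c2 * (1 / real n)" unfolding c2_def by (rule sum_distrib_right[symmetric])
      finally have 2: "\<bar>\<Sum>i\<in>S. a i / p i * (q i - emp i)\<bar> \<le> c2 * (1 / real n)" .
      have "\<bar>projected_deviation a n \<omega> - (\<Sum>k=1..n. score a k \<omega>) / sqrt (real n)\<bar>
          \<le> s * (c1 * D + c2 * (1 / real n))"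
      proof -
        have "\<bar>projected_deviation a n \<omega> - (\<Sum>k=1..n. score a k \<omega>) / sqrt (real n)\<bar>
            = s * \<bar>(\<Sum>i\<in>S. a i * ((I_proj d r q i - I_proj d r p i) / I_proj d r p i - (q i - p i) / p i))
            + (\<Sum>i\<in>S. a i / p i * (q i - emp i))\<bar>"
          unfolding diff abs_mult using s by simp
        also have "\<dots> \<le> s * (c1 * D + c2 * (1 / real n))"
          using 1 2 s by (intro mult_left_mono order_trans[OF abs_triangle_ineq] add_mono) auto
        finally show ?thesis .
      qed
      also have "\<dots> = c2 / s + c1 * s * D"
        using s n by (simp add: algebra_simps flip: s(2))
      also have "\<dots> \<le> K / s + K * s * D"
        using c s D by (intro add_mono divide_right_mono mult_right_mono) (auto simp: K_def)
      finally show ?thesis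
        unfolding s_def[symmetric] using norm_iexp_diff_le order_trans by blast
    qed
  qed
  then show ?thesis by blast
qed

text \<open>Since \<open>D\<close> has expectation of order 1 / n, the error sqrt n times
  \<open>D\<close> is of order 1 / sqrt n in mean, so the characteristic functions of the deviation
  and of the score sum have the same limit.\<close>

lemma projected_deviation_characteristic_function:
  assumes a: "a \<in> Z" and pos: "0 < wip S (\<lambda>i. 1 / p i) a a"
  shows "(\<lambda>n. CLINT \<omega>|M. iexp (projected_deviation a n \<omega>))
    \<longlonglongrightarrow> complex_of_real (exp (- wip S (\<lambda>i. 1 / p i) a a / 2))"
proof (rule Lim_transform[OF score_characteristic_function[OF a pos]])
  define B where "B = (\<lambda>n \<omega>. (\<Sum>k=1..n. score a k \<omega>) / sqrt (real n))"
  obtain K where K: "\<And>n \<omega>. 1 \<le> n \<Longrightarrow> regular \<omega> \<Longrightarrow>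
    cmod (iexp (projected_deviation a n \<omega>) - iexp (B n \<omega>))
      \<le> K / sqrt (real n) + K * sqrt (real n) * (\<Sum>i\<in>S. (p_hat n \<omega> i - p i)\<^sup>2)"
    using projected_deviation_approx[OF a] unfolding B_def by blast
  define L where "L = \<bar>K\<bar> * (1 + 4 * real (card S))"
  have B_meas: "B n \<in> borel_measurable M" for n
    unfolding B_def by (intro borel_measurable_divide borel_measurable_sum score_measurable) auto
  have int_A: "integrable M (\<lambda>\<omega>. iexp (projected_deviation a n \<omega>))" for n
    using projected_deviation_measurable[of a n] by (intro integrable_const_bound[of _ 1]) auto
  have int_B: "integrable M (\<lambda>\<omega>. iexp (B n \<omega>))" for n
    using B_meas[of n] by (intro integrable_const_bound[of _ 1]) auto
  have "cmod ((CLINT \<omega>|M. iexp (B n \<omega>)) - (CLINT \<omega>|M. iexp (projected_deviation a n \<omega>))) \<le> L / sqrt (real n)"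
    if n: "1 \<le> n" for n
  proof -
    have s: "0 < sqrt (real n)" using n by simp
    have "cmod ((CLINT \<omega>|M. iexp (B n \<omega>)) - (CLINT \<omega>|M. iexp (projected_deviation a n \<omega>)))
        = cmod (CLINT \<omega>|M. iexp (B n \<omega>) - iexp (projected_deviation a n \<omega>))"
      using int_A int_B by (simp add: Bochner_Integration.integral_diff)
    also have "\<dots> \<le> (LINT \<omega>|M. cmod (iexp (B n \<omega>) - iexp (projected_deviation a n \<omega>)))"
      by (rule integral_norm_bound)
    also have "\<dots> \<le> (LINT \<omega>|M. \<bar>K\<bar> / sqrt (real n) + \<bar>K\<bar> * sqrt (real n) * (\<Sum>i\<in>S. (p_hat n \<omega> i - p i)\<^sup>2))"
    proof (rule integral_mono_AE)
      show "integrable M (\<lambda>\<omega>. cmod (iexp (B n \<omega>) - iexp (projected_deviation a n \<omega>)))"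
        using int_A int_B by (intro integrable_norm Bochner_Integration.integrable_diff)
      show "integrable M (\<lambda>\<omega>. \<bar>K\<bar> / sqrt (real n) + \<bar>K\<bar> * sqrt (real n) * (\<Sum>i\<in>S. (p_hat n \<omega> i - p i)\<^sup>2))"
        by (rule p_hat_integrable)
      show "AE \<omega> in M. cmod (iexp (B n \<omega>) - iexp (projected_deviation a n \<omega>))
          \<le> \<bar>K\<bar> / sqrt (real n) + \<bar>K\<bar> * sqrt (real n) * (\<Sum>i\<in>S. (p_hat n \<omega> i - p i)\<^sup>2)"
        using AE_regular
      proof eventually_elim
        case (elim \<omega>)
        have "K / sqrt (real n) + K * sqrt (real n) * (\<Sum>i\<in>S. (p_hat n \<omega> i - p i)\<^sup>2)
            \<le> \<bar>K\<bar> / sqrt (real n) + \<bar>K\<bar> * sqrt (real n) * (\<Sum>i\<in>S. (p_hat n \<omega> i - p i)\<^sup>2)"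
          by (intro add_mono divide_right_mono mult_right_mono sum_nonneg) auto
        then show ?case
          using K[OF n elim] unfolding norm_minus_commute[of "iexp (B n \<omega>)"] by linarith
      qed
    qed
    also have "\<dots> = \<bar>K\<bar> / sqrt (real n) + \<bar>K\<bar> * sqrt (real n) * expectation (\<lambda>\<omega>. \<Sum>i\<in>S. (p_hat n \<omega> i - p i)\<^sup>2)"
      using p_hat_integrable[of "\<lambda>q. \<Sum>i\<in>S. (q i - p i)\<^sup>2" n] by (simp add: prob_space)
    also have "\<dots> \<le> \<bar>K\<bar> / sqrt (real n) + \<bar>K\<bar> * sqrt (real n) * (4 * real (card S) / real n)"
      by (intro add_left_mono mult_left_mono expectation_p_hat_deviation[OF n]) auto
    also have "\<dots> = L / sqrt (real n)"
    proof -
      have "sqrt (real n) * (4 * real (card S) / real n) = 4 * real (card S) / sqrt (real n)"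
        using s by (simp add: field_simps)
      then have "\<bar>K\<bar> * sqrt (real n) * (4 * real (card S) / real n) = \<bar>K\<bar> * (4 * real (card S) / sqrt (real n))"
        by (simp only: mult.assoc)
      then show ?thesis by (simp only: L_def) (simp add: add_divide_distrib distrib_left)
    qed
    finally show ?thesis .
  qed
  then have ev: "\<forall>\<^sub>F n in sequentially.
      cmod ((CLINT \<omega>|M. iexp (projected_deviation a n \<omega>)) - (CLINT \<omega>|M. iexp (B n \<omega>))) \<le> L / sqrt (real n)"
    unfolding eventually_sequentially by (metis norm_minus_commute)
  have "(\<lambda>n. L / sqrt (real n)) \<longlonglongrightarrow> 0"
    by real_asymp
  then show "(\<lambda>n. (CLINT \<omega>|M. iexp (projected_deviation a n \<omega>))
      - (CLINT \<omega>|M. iexp ((\<Sum>k=1..n. score a k \<omega>) / sqrt (real n)))) \<longlonglongrightarrow> 0"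
    using Lim_null_comparison[OF ev] unfolding B_def by blast
qed

text \<open>By \<open>eq\<close> the parameterisation starts at the projection of \<open>p\<close>,
  so the estimated parameter is the coordinate vector of the difference of the two projections, to
  which \<open>Sigma_quadratic_form\<close> applies.\<close>

theorem quadratic_form_weak_conv:
  assumes eq: "I_proj d r p = I_proj d r U"
  shows "weak_conv_m (\<lambda>n. distr M borel (\<lambda>\<omega>. real n * (theta_of d r S \<Delta>s (p_hat n \<omega>) \<bullet>
      (mat_inv (Sigma_theta d r S \<Delta>s p) *\<^sub>v theta_of d r S \<Delta>s (p_hat n \<omega>))))) (chi_square m)"
proof -
  obtain e D where e: "\<And>j. j < m \<Longrightarrow> e j \<in> Z"
    and on: "\<And>j k. j < m \<Longrightarrow> k < m \<Longrightarrow> wip S (\<lambda>i. 1 / p i) (e j) (e k) = (if j = k then 1 else 0)"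
    and span: "\<And>k i. k < m \<Longrightarrow> i \<in> S \<Longrightarrow> (\<Delta>s ! k) i = (\<Sum>j<m. D k j * e j i)"
    by (rule orthonormal_basis_exists[of p], erule p_props(1), blast)
  define W where "W = (\<lambda>n \<omega> j. projected_deviation (e j) n \<omega>)"
  define Q where "Q = (\<lambda>n \<omega>. real n * (theta_of d r S \<Delta>s (p_hat n \<omega>) \<bullet>
      (mat_inv (Sigma_theta d r S \<Delta>s p) *\<^sub>v theta_of d r S \<Delta>s (p_hat n \<omega>))))"
  have "weak_conv_m (\<lambda>n. distr M borel (\<lambda>\<omega>. \<Sum>j<m. (W n \<omega> j)\<^sup>2)) (chi_square m)"
  proof (rule sum_squares_weak_conv_chi_square)
    show "random_variable borel (\<lambda>\<omega>. W n \<omega> j)" for n j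
      unfolding W_def by (rule projected_deviation_measurable)
    fix z :: "nat \<Rightarrow> real"
    define a where "a = (\<lambda>i. \<Sum>j<m. z j * e j i)"
    have "a = (\<Sum>j<m. array_scale (z j) (e j))"
      by (simp add: a_def fun_eq_iff sum_array_scale_apply)
    also have "\<dots> \<in> array.span (set \<Delta>s)"
      using e by (intro array.span_sum array.span_scale) (auto simp: span_basis)
    finally have a: "a \<in> Z" by (simp add: span_basis)
    have "wip S (\<lambda>i. 1 / p i) (e j) a = z j" if "j < m" for j
    proof -
      have "wip S (\<lambda>i. 1 / p i) (e j) a = (\<Sum>k<m. if k = j then z j else 0)"
        unfolding a_def wip_sum_right using on[OF that] by (intro sum.cong) auto
      then show ?thesis using that by simp
    qed
    then have norm_a: "wip S (\<lambda>i. 1 / p i) a a = (\<Sum>j<m. (z j)\<^sup>2)"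
      using wip_orthonormal_expansion[OF on, of m a z] by (simp add: a_def)
    have lin: "(\<Sum>j<m. z j * W n \<omega> j) = projected_deviation a n \<omega>" for n \<omega>
    proof -
      have "(\<Sum>i\<in>S. a i * f i) = (\<Sum>j<m. z j * (\<Sum>i\<in>S. e j i * f i))" for f
        unfolding a_def sum_distrib_right sum_distrib_left
        by (subst sum.swap) (simp add: mult.assoc)
      note swap = this
      define f where "f = (\<lambda>i. (I_proj d r (p_hat n \<omega>) i - I_proj d r p i) / I_proj d r p i)"
      have dev: "projected_deviation b n \<omega> = sqrt (real n) * (\<Sum>i\<in>S. b i * f i)" for b
        by (simp add: projected_deviation_def f_def)
      have "(\<Sum>j<m. z j * W n \<omega> j) = (\<Sum>j<m. sqrt (real n) * (z j * (\<Sum>i\<in>S. e j i * f i)))"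
        by (simp only: W_def dev mult.left_commute)
      then show ?thesis by (simp only: sum_distrib_left[symmetric] swap[symmetric] dev)
    qed
    \<comment> \<open>The central limit theorem requires positive variance, so \<open>z = 0\<close>
      is separate; there both sides equal 1.\<close>
    show "(\<lambda>n. CLINT \<omega>|M. iexp (\<Sum>j<m. z j * W n \<omega> j))
        \<longlonglongrightarrow> complex_of_real (exp (- (\<Sum>j<m. (z j)\<^sup>2) / 2))"
    proof (cases "(\<Sum>j<m. (z j)\<^sup>2) = 0")
      case True
      then have "\<forall>j<m. z j = 0" by (simp add: sum_nonneg_eq_0_iff)
      then show ?thesis using True by (simp add: prob_space)
    next
      case False
      then have "0 < (\<Sum>j<m. (z j)\<^sup>2)"
        using sum_nonneg[of "{..<m}" "\<lambda>j. (z j)\<^sup>2"] by simp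
      then show ?thesis
        using projected_deviation_characteristic_function[OF a] unfolding lin norm_a by blast
    qed
  qed
  \<comment> \<open>\<open>Q n\<close> and the sum of squares agree on regular samples only, which
    is enough for equality of their laws.\<close>
  moreover have "distr M borel (Q n) = distr M borel (\<lambda>\<omega>. \<Sum>j<m. (W n \<omega> j)\<^sup>2)" for n
  proof (rule measure_eqI)
    have Q_meas: "Q n \<in> borel_measurable M"
      unfolding Q_def by (rule p_hat_measurable[of "\<lambda>q. real n * (theta_of d r S \<Delta>s q \<bullet>
        (mat_inv (Sigma_theta d r S \<Delta>s p) *\<^sub>v theta_of d r S \<Delta>s q))"])
    have W_meas: "(\<lambda>\<omega>. \<Sum>j<m. (W n \<omega> j)\<^sup>2) \<in> borel_measurable M"
      unfolding W_def
      by (intro borel_measurable_sum borel_measurable_power projected_deviation_measurable)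
    have AE_eq: "AE \<omega> in M. Q n \<omega> = (\<Sum>j<m. (W n \<omega> j)\<^sup>2)"
      using AE_regular
    proof eventually_elim
      case (elim \<omega>)
      have th: "is_theta d r S \<Delta>s (p_hat n \<omega>) (theta_of d r S \<Delta>s (p_hat n \<omega>))"
        by (rule is_theta_theta_of[OF p_hat_positive[OF elim]])
      have carrier: "theta_of d r S \<Delta>s (p_hat n \<omega>) \<in> carrier_vec m"
        and comb: "comb (vec_index (theta_of d r S \<Delta>s (p_hat n \<omega>)))
          = (\<lambda>i. I_proj d r (p_hat n \<omega>) i - I_proj d r p i)"
        using th unfolding is_theta_iff eq by auto
      have "theta_of d r S \<Delta>s (p_hat n \<omega>) \<bullet>
          (mat_inv (Sigma_theta d r S \<Delta>s p) *\<^sub>v theta_of d r S \<Delta>s (p_hat n \<omega>))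
        = (\<Sum>j<m. (\<Sum>i\<in>S. e j i * (comb (vec_index (theta_of d r S \<Delta>s (p_hat n \<omega>))) i / I_proj d r p i))\<^sup>2)"
        by (rule Sigma_quadratic_form[OF p_positive]) (fact e on span carrier)+
      then have "Q n \<omega> = real n * (\<Sum>j<m. (\<Sum>i\<in>S. e j i * ((I_proj d r (p_hat n \<omega>) i - I_proj d r p i) / I_proj d r p i))\<^sup>2)"
        unfolding Q_def comb by (simp only:)
      moreover have "(W n \<omega> j)\<^sup>2 = real n *
          (\<Sum>i\<in>S. e j i * ((I_proj d r (p_hat n \<omega>) i - I_proj d r p i) / I_proj d r p i))\<^sup>2" for j
        by (simp only: W_def projected_deviation_def power_mult_distrib real_sqrt_pow2 of_nat_0_le_iff)
      ultimately show "Q n \<omega> = (\<Sum>j<m. (W n \<omega> j)\<^sup>2)"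
        by (simp only: sum_distrib_left)
    qed
    fix A assume "A \<in> sets (distr M borel (Q n))"
    then have A: "A \<in> sets borel" by simp
    have "emeasure M (Q n -` A \<inter> space M) = emeasure M ((\<lambda>\<omega>. \<Sum>j<m. (W n \<omega> j)\<^sup>2) -` A \<inter> space M)"
    proof (rule emeasure_eq_AE)
      show "AE \<omega> in M. \<omega> \<in> Q n -` A \<inter> space M \<longleftrightarrow> \<omega> \<in> (\<lambda>\<omega>. \<Sum>j<m. (W n \<omega> j)\<^sup>2) -` A \<inter> space M"
        using AE_eq by eventually_elim auto
    qed (use measurable_sets[OF Q_meas A] measurable_sets[OF W_meas A] in auto)
    then show "emeasure (distr M borel (Q n)) A = emeasure (distr M borel (\<lambda>\<omega>. \<Sum>j<m. (W n \<omega> j)\<^sup>2)) A"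
      using Q_meas W_meas A by (simp add: emeasure_distr)
  qed simp
  ultimately show ?thesis unfolding Q_def by simp
qed

end

text \<open>Uniqueness of the parameter of \<open>p_hat n\<close> is almost sure because
  observations may leave \<open>S\<close> on a null event; whatever value \<open>theta_of\<close>
  takes there does not affect the laws.\<close>

theorem mainTheorem3:
  fixes d :: nat and r :: "nat \<Rightarrow> nat" and x :: "nat \<Rightarrow> nat \<Rightarrow> real"
    and P :: "(nat \<Rightarrow> real) measure"
    and M :: "'w measure" and X :: "nat \<Rightarrow> 'w \<Rightarrow> nat \<Rightarrow> real"
    and p :: array and S :: "multi_index set" and d0 :: nat and \<Delta>s :: "array list"
    and \<theta>\<^sub>p :: "real vec" and p_hat :: "nat \<Rightarrow> 'w \<Rightarrow> array"
    and \<theta>_hat :: "nat \<Rightarrow> 'w \<Rightarrow> real vec" and \<Sigma> :: "real mat"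
  assumes "1 \<le> d"
    and "\<And>l. l \<in> {1..d} \<Longrightarrow> 1 \<le> r l"
    and "\<And>l. l \<in> {1..d} \<Longrightarrow> strict_mono_on {1..r l} (x l)"
    and "prob_space P"
    and "sets P = sets (count_space (grid d r x))"
    and "prob_space M"
    and "prob_space.indep_vars M (\<lambda>_. P) X {1..}"
    and "\<And>k. 1 \<le> k \<Longrightarrow> distr M P (X k) = P"
    and "p = prob_array d r x P"
    and "p \<in> prob_arrays d r"
    and "S = Supp d r p"
    and "copula_arrays_on d r S \<noteq> {}"
    and "d0 = array.dim (zero_margin_space d r S)"
    and "1 \<le> d0"
    and "distinct \<Delta>s"
    and "array.independent (set \<Delta>s)"
    and "array.span (set \<Delta>s) = zero_margin_space d r S"
    and "\<theta>\<^sub>p = theta_of d r S \<Delta>s p"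
    and "\<And>n \<omega>. p_hat n \<omega> = smoothed_array d r x S X n \<omega>"
    and "\<And>n \<omega>. \<theta>_hat n \<omega> = theta_of d r S \<Delta>s (p_hat n \<omega>)"
    and "\<Sigma> = Sigma_theta d r S \<Delta>s p"
  shows "(\<exists>!\<theta>. is_theta d r S \<Delta>s p \<theta>) \<and>
    (AE \<omega> in M. \<forall>n\<ge>1. \<exists>!\<theta>. is_theta d r S \<Delta>s (p_hat n \<omega>) \<theta>) \<and>
    (quasi_independent d r p \<longleftrightarrow> \<theta>\<^sub>p = 0\<^sub>v d0) \<and>
    (\<theta>\<^sub>p = 0\<^sub>v d0 \<longrightarrow>
      weak_conv_m
        (\<lambda>n. distr M borel
          (\<lambda>\<omega>. real n * (\<theta>_hat n \<omega> \<bullet> (mat_inv \<Sigma> *\<^sub>v \<theta>_hat n \<omega>))))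
        (chi_square d0)) \<and>
    vec_space.rank d0 \<Sigma> = d0"
proof -
  interpret prob_space M by fact
  interpret copula_sample d r S \<Delta>s M x P X p
  proof (intro copula_sample.intro copula_basis.intro copula_support.intro
      copula_basis_axioms.intro copula_sample_axioms.intro)
    show "S \<subseteq> index_set d r" using assms(11) by (auto simp: Supp_def)
  qed (fact assms)+
  have d0: "d0 = m" using dim_zero_margin_space assms(13) by simp
  have "AE \<omega> in M. \<forall>n\<ge>1. \<exists>!\<theta>. is_theta d r S \<Delta>s (p_hat n \<omega>) \<theta>"
    using AE_regular
  proof eventually_elim
    case (elim \<omega>)
    show ?case
      unfolding assms(19) using theta_exists_unique[OF p_hat_positive[OF elim]] by blast
  qed
  moreover have "quasi_independent d r p \<longleftrightarrow> \<theta>\<^sub>p = 0\<^sub>v d0"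
    unfolding assms(18) d0 theta_of_eq_0_iff[OF p_positive]
    by (rule quasi_independent_iff_I_proj_eq[OF p_positive p_props(5)])
  moreover have "weak_conv_m
      (\<lambda>n. distr M borel (\<lambda>\<omega>. real n * (\<theta>_hat n \<omega> \<bullet> (mat_inv \<Sigma> *\<^sub>v \<theta>_hat n \<omega>)))) (chi_square d0)"
    if "\<theta>\<^sub>p = 0\<^sub>v d0"
    using quadratic_form_weak_conv that
    unfolding assms(18-21) d0 theta_of_eq_0_iff[OF p_positive] by blast
  ultimately show ?thesis
    using theta_exists_unique[OF p_positive] rank_Sigma[OF p_positive] d0 assms(21) by blast
qed

end
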